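(* Let $\mathscr G$ be a non-deterministic functor and $\mathcal G$ a finite set of proof obligations $\varepsilon_1=\varepsilon_2$ with $\varepsilon_1,\varepsilon_2\in\mathsf{Exp}_{\mathscr G}$. When $\oplus$ is taken modulo associativity, commutativity and idempotence, the CIRC reduction process started from $(\mathcal B_{\mathscr G},\{\},\langle\mathcal G\rangle)$ decides the goals: it terminates, and if it terminates by rule [Done] then every pair in $\mathcal G$ is bisimilar, whereas if it terminates by rule [Fail] the goals are not all bisimilar.
   Context: Non-deterministic functors $\mathscr{G}:\mathbf{Set}\to\mathbf{Set}$ are generated by $\mathscr{G}::= Id \mid \mathsf{B}\mid \mathscr{G}\,\hat{+}\,\mathscr{G}\mid \mathscr{G}\times\mathscr{G}\mid \mathscr{G}^A\mid \mathcal{P}_\omega\mathscr{G}$, where $\mathsf{B}$ is a finite join-semilattice (join $\vee$, bottom $\bot_{\mathsf B}$), $A$ a finite set, $\mathcal{P}_\omega$ finite powerset, $X\,\hat{+}\,Y=X\uplus Y\uplus\{\bot,\top\}$ (injections $\kappa_1,\kappa_2$). Ingredient relation $\lhd$: least reflexive transitive relation with $\mathscr{G}_i\lhd\mathscr{G}_1\times\mathscr{G}_2$, $\mathscr{G}_i\lhd\mathscr{G}_1\hat{+}\mathscr{G}_2$, $\mathscr{G}\lhd\mathscr{G}^A$, $\mathscr{G}\lhd\mathcal{P}_\omega\mathscr{G}$. Bisimulation on a $\mathscr G$-coalgebra $(S,f)$: $R$ with $(s,t)\in R\Rightarrow(f(s),f(t))\in\overline{\mathscr G}(R)=\{(\mathscr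 G(\pi_1)(z),\mathscr G(\pi_2)(z))\mid z\in\mathscr G(R)\}$; bisimilar means related by some bisimulation. Expressions: $\varepsilon::= x\mid\varepsilon\oplus\varepsilon\mid\gamma$, $\gamma::=\emptyset\mid\gamma\oplus\gamma\mid\mu x.\gamma\mid b\mid l\langle\varepsilon\rangle\mid r\langle\varepsilon\rangle\mid l[\varepsilon]\mid r[\varepsilon]\mid a(\varepsilon)\mid\{\varepsilon\}$. Typing $\vdash\varepsilon:\mathscr F\lhd\mathscr G$: $\emptyset:\mathscr F\lhd\mathscr G$; $b:\mathsf B\lhd\mathscr G$; $x:\mathscr G\lhd\mathscr G$; $\mu x.\varepsilon:\mathscr G\lhd\mathscr G$ if $\varepsilon:\mathscr G\lhd\mathscr G$; $\varepsilon_1\oplus\varepsilon_2:\mathscr F\lhd\mathscr G$ if both $\varepsilon_i:\mathscr F\lhd\mathscr G$; $\varepsilon:Id\lhd\mathscr G$ if $\varepsilon:\mathscr G\lhd\mathscr G$; $l\langle\varepsilon\rangle$ (resp. $r\langle\varepsilon\rangle$) $:\mathscr F_1\times\mathscr F_2\lhd\mathscr G$ if $\varepsilon:\mathscr F_1\lhd\mathscr G$ (resp. $\mathscr F_2$); $l[\varepsilon]$ (resp. $r[\varepsilon]$) $:\mathscr F_1\hat+\mathscr F_2\lhd\mathscr G$ if $\varepsilon:\mathscr F_1\lhd\mathscr G$ (resp. $\mathscr F_2$); $a(\varepsilon):\mathscr F^A\lhd\mathscr G$ if $\varepsilon:\mathscr F\lhd\mathscr G$; $\{\varepsilon\}:\mathcal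 P_\omega\mathscr F\lhd\mathscr G$ if $\varepsilon:\mathscr F\lhd\mathscr G$. $\mathsf{Exp}_{\mathscr G}$: closed expressions of type $\mathscr G\lhd\mathscr G$. Coalgebra $\delta_{\mathscr G}=\delta_{\mathscr G\lhd\mathscr G}:\mathsf{Exp}_{\mathscr G}\to\mathscr G(\mathsf{Exp}_{\mathscr G})$ with $\delta_{\mathscr F\lhd\mathscr G}$: $\delta(\emptyset)=Empty_{\mathscr F\lhd\mathscr G}$; $\delta(\varepsilon_1\oplus\varepsilon_2)=Plus(\delta(\varepsilon_1),\delta(\varepsilon_2))$; $\delta_{\mathscr G\lhd\mathscr G}(\mu x.\varepsilon)=\delta_{\mathscr G\lhd\mathscr G}(\varepsilon[\mu x.\varepsilon/x])$; $\delta_{Id\lhd\mathscr G}(\varepsilon)=\varepsilon$; $\delta_{\mathsf B\lhd\mathscr G}(b)=b$; $\delta(l\langle\varepsilon\rangle)=\langle\delta_{\mathscr F_1\lhd\mathscr G}(\varepsilon),Empty_{\mathscr F_2}\rangle$ and symmetrically; $\delta(l[\varepsilon])=\kappa_1(\delta_{\mathscr F_1\lhd\mathscr G}(\varepsilon))$ and symmetrically; $\delta(a(\varepsilon))=\lambda a'.(a'=a\ ?\ \delta_{\mathscr F\lhd\mathscr G}(\varepsilon):Empty_{\mathscr F})$; $\delta(\{\varepsilon\})=\{\delta_{\mathscr F\lhd\mathscr G}(\varepsilon)\}$; with $Empty_{Id}=\emptyset$, $Empty_{\mathsf B}=\bot_{\mathsf B}$, componentwise on products, $\bot$ on $\hat+$,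 $\lambda a.Empty$ on exponents, the empty set on $\mathcal P_\omega$; $Plus_{Id}=\oplus$, $Plus_{\mathsf B}=\vee$, componentwise/pointwise on products/exponents, union on $\mathcal P_\omega$, and on $\hat+$: $\bot$ unit, $\top$ absorbing, same injection combined recursively, different injections give $\top$. CIRC procedure: $\mathcal E_{\mathscr G}$ is an order-sorted equational specification (sorts include $\mathsf{Exp}$, $\mathsf{Slt}\le\mathsf{Exp}$, $\mathsf{ExpStruct}$ for structured expressions $\sigma::=\varepsilon\mid b\mid\langle\sigma,\sigma\rangle\mid k_1(\sigma)\mid k_2(\sigma)\mid\bot\mid\top\mid\lambda.(a,\mathscr F\lhd\mathscr G,\sigma)\mid\{\sigma_1,..,\sigma_n\}$) whose equations define joins, substitution, typing and $\delta,Empty,Plus$; a fresh sort $\mathsf{Frozen}$ with freezing operators $\langle-\rangle$. $\vdash_{NDF}$ is equational deduction extended with: pairs equal if components equal; $k_i(\sigma),k_i(\sigma')$ equal if $\sigma,\sigma'$ equal; functions equal if equal at all $a\in A$; finite sets equal if every element of each is equal to some element of the other (all under $\langle-\rangle$); plus interpolant closure. $\mathcal B_{\mathscr G}$ consists of $\mathcal E_{\mathscr G}$, the derivative $\delta_{\mathscr G\lhd\mathscr G}( *{:}\mathsf{Exp})$ (equations of sort $\mathsf{Exp}$ are derivable, $\Delta[\varepsilon=\varepsilon']=\{\delta_{\mathscr G\lhd\mathscr G}(\varepsilon)=\delta_{\mathscr G\lhd\mathscr G}(\varepsilon')\}$), and equational interpolants decomposing equations between pairs, injections, functions and finite sets into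 equations between components as described, and turning equations $t=t'$ of sort $\mathsf{Slt}$ into non-derivable $(t\simeq t')=\mathit{true}$. Rules on $(\mathcal B,\mathcal F,\mathcal G)$: [Done] $(\mathcal B,\mathcal F,\{\})$ stops with success; [Reduce] remove goal $\langle e\rangle$ if $\mathcal B\cup\mathcal F\vdash_{NDF}\langle e\rangle$; [Derive] if $e$ derivable and $\mathcal B\cup\mathcal F\not\vdash_{NDF}\langle e\rangle$, move $\langle e\rangle$ to $\mathcal F$ and add $\langle\Delta[e]\rangle$ to the goals; [Simplify] replace a goal $\langle\theta(e)\rangle$ by $\{\langle\theta(e_i)\rangle\}$ for an interpolant $e\Rightarrow\{e_i\}$ and substitution $\theta$; [Fail] stop with failure if a goal $\langle e\rangle$ is non-derivable and $\mathcal B\cup\mathcal F\not\vdash_{NDF}\langle e\rangle$. All expressions are identified modulo associativity, commutativity and idempotence of $\oplus$.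
   Formalization: [Fail] applies only to goals that no interpolant decomposes; a constant b of sort Slt and the expression b of sort Exp are frozen separately; simplifying an equation between finite sets branches over choices of partners, and the process fails only when every branch fails. *)

theory Defs
  imports Main "HOL-Library.FSet"
begin

section \<open>Non-deterministic functors and their coalgebras\<close>

text \<open>A finite join-semilattice is given by its carrier inside an ambient type, so that different
  semilattices may occur in one functor.\<close>

datatype 'b jsl = JSL (jcarrier: "'b set") (jjoin: "'b \<Rightarrow> 'b \<Rightarrow> 'b") (jbot: 'b)

definition finite_jsl :: "'b jsl \<Rightarrow> bool" where
  "finite_jsl B \<longleftrightarrow>
     finite (jcarrier B) \<and> jbot B \<in> jcarrier B \<and>
     (\<forall>x\<in>jcarrier B. \<forall>y\<in>jcarrier B. jjoin B x y \<in> jcarrier B \<and> jjoin B x y = jjoin B y x) \<and>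
     (\<forall>x\<in>jcarrier B. \<forall>y\<in>jcarrier B. \<forall>z\<in>jcarrier B.
        jjoin B (jjoin B x y) z = jjoin B x (jjoin B y z)) \<and>
     (\<forall>x\<in>jcarrier B. jjoin B x x = x \<and> jjoin B (jbot B) x = x)"

datatype ('a, 'b) ndf =
    FId
  | FLat "'b jsl"
  | FSum "('a, 'b) ndf" "('a, 'b) ndf"
  | FProd "('a, 'b) ndf" "('a, 'b) ndf"
  | FExp "('a, 'b) ndf" "'a set"
  | FPow "('a, 'b) ndf"

primrec nd_functor :: "('a, 'b) ndf \<Rightarrow> bool" where
  "nd_functor FId \<longleftrightarrow> True"
| "nd_functor (FLat B) \<longleftrightarrow> finite_jsl B"
| "nd_functor (FSum F1 F2) \<longleftrightarrow> nd_functor F1 \<and> nd_functor F2"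
| "nd_functor (FProd F1 F2) \<longleftrightarrow> nd_functor F1 \<and> nd_functor F2"
| "nd_functor (FExp F A) \<longleftrightarrow> nd_functor F \<and> finite A"
| "nd_functor (FPow F) \<longleftrightarrow> nd_functor F"

inductive ingredient :: "('a, 'b) ndf \<Rightarrow> ('a, 'b) ndf \<Rightarrow> bool" (infix "\<lhd>" 50) where
  ingr_refl: "F \<lhd> F"
| ingr_trans: "F \<lhd> G \<Longrightarrow> G \<lhd> H \<Longrightarrow> F \<lhd> H"
| ingr_prod1: "F1 \<lhd> FProd F1 F2"
| ingr_prod2: "F2 \<lhd> FProd F1 F2"
| ingr_sum1: "F1 \<lhd> FSum F1 F2"
| ingr_sum2: "F2 \<lhd> FSum F1 F2"
| ingr_exp: "F \<lhd> FExp F A"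
| ingr_pow: "F \<lhd> FPow F"

text \<open>Elements of sets \<open>G X\<close>. A function on the exponent \<open>A\<close> is a partial map with domain
  \<open>A\<close>, so that equality of elements is extensional on \<open>A\<close> and the generated \<open>map_val\<close> is the
  action of every functor on maps.\<close>

datatype ('a, dead 'b, 'x) val =
    VId 'x
  | VLat 'b
  | VBot
  | VTop
  | VK1 "('a, 'b, 'x) val"
  | VK2 "('a, 'b, 'x) val"
  | VPair "('a, 'b, 'x) val" "('a, 'b, 'x) val"
  | VFun "'a \<Rightarrow> ('a, 'b, 'x) val option"
  | VSet "('a, 'b, 'x) val fset"

primrec fobj :: "('a, 'b) ndf \<Rightarrow> 'x set \<Rightarrow> ('a, 'b, 'x) val set" where
  "fobj FId X = VId ` X"
| "fobj (FLat B) X = VLat ` jcarrier B"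
| "fobj (FSum F1 F2) X = VK1 ` fobj F1 X \<union> VK2 ` fobj F2 X \<union> {VBot, VTop}"
| "fobj (FProd F1 F2) X = {VPair u v | u v. u \<in> fobj F1 X \<and> v \<in> fobj F2 X}"
| "fobj (FExp F A) X = {VFun f | f. dom f = A \<and> ran f \<subseteq> fobj F X}"
| "fobj (FPow F) X = {VSet U | U. fset U \<subseteq> fobj F X}"

definition flift ::
  "('a, 'b) ndf \<Rightarrow> ('x \<times> 'x) set \<Rightarrow> (('a, 'b, 'x) val \<times> ('a, 'b, 'x) val) set" where
  "flift G R = {(map_val fst z, map_val snd z) | z. z \<in> fobj G R}"

definition bisimulation ::
  "('a, 'b) ndf \<Rightarrow> 'x set \<Rightarrow> ('x \<Rightarrow> ('a, 'b, 'x) val) \<Rightarrow> ('x \<times> 'x) set \<Rightarrow> bool" where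
  "bisimulation G S f R \<longleftrightarrow> R \<subseteq> S \<times> S \<and> (\<forall>(s, t) \<in> R. (f s, f t) \<in> flift G R)"

definition bisimilar ::
  "('a, 'b) ndf \<Rightarrow> 'x set \<Rightarrow> ('x \<Rightarrow> ('a, 'b, 'x) val) \<Rightarrow> 'x \<Rightarrow> 'x \<Rightarrow> bool" where
  "bisimilar G S f s t \<longleftrightarrow> (\<exists>R. bisimulation G S f R \<and> (s, t) \<in> R)"


section \<open>Expressions\<close>

text \<open>In the order of the constructors: \<open>x\<close>, the empty expression, \<open>\<oplus>\<close>, \<open>\<mu>x.\<epsilon>\<close>, \<open>b\<close>,
  \<open>l\<langle>\<epsilon>\<rangle>\<close>, \<open>r\<langle>\<epsilon>\<rangle>\<close>, \<open>l[\<epsilon>]\<close>, \<open>r[\<epsilon>]\<close>, \<open>a(\<epsilon>)\<close>, \<open>{\<epsilon>}\<close>.\<close>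

datatype ('a, 'b) exp =
    EVar nat
  | EEmpty
  | EPlus "('a, 'b) exp" "('a, 'b) exp"
  | EMu nat "('a, 'b) exp"
  | ELat 'b
  | EProdL "('a, 'b) exp"
  | EProdR "('a, 'b) exp"
  | ESumL "('a, 'b) exp"
  | ESumR "('a, 'b) exp"
  | EAct 'a "('a, 'b) exp"
  | ESing "('a, 'b) exp"

inductive is_exp :: "('a, 'b) exp \<Rightarrow> bool" and is_guarded :: "('a, 'b) exp \<Rightarrow> bool" where
  "is_exp (EVar x)"
| "is_exp e1 \<Longrightarrow> is_exp e2 \<Longrightarrow> is_exp (EPlus e1 e2)"
| "is_guarded g \<Longrightarrow> is_exp g"
| "is_guarded EEmpty"
| "is_guarded g1 \<Longrightarrow> is_guarded g2 \<Longrightarrow> is_guarded (EPlus g1 g2)"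
| "is_guarded g \<Longrightarrow> is_guarded (EMu x g)"
| "is_guarded (ELat b)"
| "is_exp e \<Longrightarrow> is_guarded (EProdL e)"
| "is_exp e \<Longrightarrow> is_guarded (EProdR e)"
| "is_exp e \<Longrightarrow> is_guarded (ESumL e)"
| "is_exp e \<Longrightarrow> is_guarded (ESumR e)"
| "is_exp e \<Longrightarrow> is_guarded (EAct a e)"
| "is_exp e \<Longrightarrow> is_guarded (ESing e)"

primrec fv :: "('a, 'b) exp \<Rightarrow> nat set" where
  "fv (EVar x) = {x}"
| "fv EEmpty = {}"
| "fv (EPlus e1 e2) = fv e1 \<union> fv e2"
| "fv (EMu x e) = fv e - {x}"
| "fv (ELat b) = {}"
| "fv (EProdL e) = fv e"
| "fv (EProdR e) = fv e"
| "fv (ESumL e) = fv e"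
| "fv (ESumR e) = fv e"
| "fv (EAct a e) = fv e"
| "fv (ESing e) = fv e"

text \<open>\<open>subst x s e\<close> is \<open>e[s/x]\<close>. Bound variables are not renamed; the function is only used
  with closed \<open>s\<close>.\<close>

primrec subst :: "nat \<Rightarrow> ('a, 'b) exp \<Rightarrow> ('a, 'b) exp \<Rightarrow> ('a, 'b) exp" where
  "subst x s (EVar y) = (if y = x then s else EVar y)"
| "subst x s EEmpty = EEmpty"
| "subst x s (EPlus e1 e2) = EPlus (subst x s e1) (subst x s e2)"
| "subst x s (EMu y e) = (if y = x then EMu y e else EMu y (subst x s e))"
| "subst x s (ELat b) = ELat b"
| "subst x s (EProdL e) = EProdL (subst x s e)"
| "subst x s (EProdR e) = EProdR (subst x s e)"
| "subst x s (ESumL e) = ESumL (subst x s e)"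
| "subst x s (ESumR e) = ESumR (subst x s e)"
| "subst x s (EAct a e) = EAct a (subst x s e)"
| "subst x s (ESing e) = ESing (subst x s e)"

text \<open>\<open>typed e F G\<close> is the judgement \<open>\<turnstile> e : F \<lhd> G\<close>; the premises of the form \<open>F \<lhd> G\<close>
  express that the judgement is only formed for ingredients.\<close>

inductive typed :: "('a, 'b) exp \<Rightarrow> ('a, 'b) ndf \<Rightarrow> ('a, 'b) ndf \<Rightarrow> bool" where
  "F \<lhd> G \<Longrightarrow> typed EEmpty F G"
| "FLat B \<lhd> G \<Longrightarrow> b \<in> jcarrier B \<Longrightarrow> typed (ELat b) (FLat B) G"
| "typed (EVar x) G G"
| "typed e G G \<Longrightarrow> typed (EMu x e) G G"
| "typed e1 F G \<Longrightarrow> typed e2 F G \<Longrightarrow> typed (EPlus e1 e2) F G"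
| "FId \<lhd> G \<Longrightarrow> typed e G G \<Longrightarrow> typed e FId G"
| "FProd F1 F2 \<lhd> G \<Longrightarrow> typed e F1 G \<Longrightarrow> typed (EProdL e) (FProd F1 F2) G"
| "FProd F1 F2 \<lhd> G \<Longrightarrow> typed e F2 G \<Longrightarrow> typed (EProdR e) (FProd F1 F2) G"
| "FSum F1 F2 \<lhd> G \<Longrightarrow> typed e F1 G \<Longrightarrow> typed (ESumL e) (FSum F1 F2) G"
| "FSum F1 F2 \<lhd> G \<Longrightarrow> typed e F2 G \<Longrightarrow> typed (ESumR e) (FSum F1 F2) G"
| "FExp F A \<lhd> G \<Longrightarrow> a \<in> A \<Longrightarrow> typed e F G \<Longrightarrow> typed (EAct a e) (FExp F A) G"
| "FPow F \<lhd> G \<Longrightarrow> typed e F G \<Longrightarrow> typed (ESing e) (FPow F) G"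

definition Exps :: "('a, 'b) ndf \<Rightarrow> ('a, 'b) ndf \<Rightarrow> ('a, 'b) exp set" where
  "Exps F G = {e. is_exp e \<and> fv e = {} \<and> typed e F G}"

abbreviation Exp :: "('a, 'b) ndf \<Rightarrow> ('a, 'b) exp set" where
  "Exp G \<equiv> Exps G G"

text \<open>The congruence generated by associativity, commutativity and idempotence of \<open>\<oplus>\<close>.\<close>

inductive aci :: "('a, 'b) exp \<Rightarrow> ('a, 'b) exp \<Rightarrow> bool" where
  aci_assoc: "aci (EPlus (EPlus e1 e2) e3) (EPlus e1 (EPlus e2 e3))"
| aci_comm: "aci (EPlus e1 e2) (EPlus e2 e1)"
| aci_idem: "aci (EPlus e e) e"
| aci_refl: "aci e e"
| aci_sym: "aci e e' \<Longrightarrow> aci e' e"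
| aci_trans: "aci e e' \<Longrightarrow> aci e' e'' \<Longrightarrow> aci e e''"
| aci_plus: "aci e1 e1' \<Longrightarrow> aci e2 e2' \<Longrightarrow> aci (EPlus e1 e2) (EPlus e1' e2')"
| aci_mu: "aci e e' \<Longrightarrow> aci (EMu x e) (EMu x e')"
| aci_prodl: "aci e e' \<Longrightarrow> aci (EProdL e) (EProdL e')"
| aci_prodr: "aci e e' \<Longrightarrow> aci (EProdR e) (EProdR e')"
| aci_suml: "aci e e' \<Longrightarrow> aci (ESumL e) (ESumL e')"
| aci_sumr: "aci e e' \<Longrightarrow> aci (ESumR e) (ESumR e')"
| aci_act: "aci e e' \<Longrightarrow> aci (EAct a e) (EAct a e')"
| aci_sing: "aci e e' \<Longrightarrow> aci (ESing e) (ESing e')"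


section \<open>The coalgebra of expressions\<close>

primrec empty_val :: "('a, 'b) ndf \<Rightarrow> ('a, 'b, ('a, 'b) exp) val" where
  "empty_val FId = VId EEmpty"
| "empty_val (FLat B) = VLat (jbot B)"
| "empty_val (FSum F1 F2) = VBot"
| "empty_val (FProd F1 F2) = VPair (empty_val F1) (empty_val F2)"
| "empty_val (FExp F A) = VFun (\<lambda>a. if a \<in> A then Some (empty_val F) else None)"
| "empty_val (FPow F) = VSet {||}"

primrec plus_val :: "('a, 'b) ndf \<Rightarrow> ('a, 'b, ('a, 'b) exp) val \<Rightarrow> ('a, 'b, ('a, 'b) exp) val \<Rightarrow>
    ('a, 'b, ('a, 'b) exp) val" where
  "plus_val FId = (\<lambda>u v. case (u, v) of (VId e1, VId e2) \<Rightarrow> VId (EPlus e1 e2))"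
| "plus_val (FLat B) = (\<lambda>u v. case (u, v) of (VLat b1, VLat b2) \<Rightarrow> VLat (jjoin B b1 b2))"
| "plus_val (FSum F1 F2) = (\<lambda>u v.
     if u = VBot then v else if v = VBot then u else
     case (u, v) of
       (VK1 u', VK1 v') \<Rightarrow> VK1 (plus_val F1 u' v')
     | (VK2 u', VK2 v') \<Rightarrow> VK2 (plus_val F2 u' v')
     | _ \<Rightarrow> VTop)"
| "plus_val (FProd F1 F2) = (\<lambda>u v. case (u, v) of
       (VPair u1 u2, VPair v1 v2) \<Rightarrow> VPair (plus_val F1 u1 v1) (plus_val F2 u2 v2))"
| "plus_val (FExp F A) = (\<lambda>u v. case (u, v) of
       (VFun f, VFun g) \<Rightarrow>
         VFun (\<lambda>a. if a \<in> A then Some (plus_val F (the (f a)) (the (g a))) else None))"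
| "plus_val (FPow F) = (\<lambda>u v. case (u, v) of (VSet U, VSet V) \<Rightarrow> VSet (U |\<union>| V))"

fun mu_height :: "('a, 'b) exp \<Rightarrow> nat" where
  "mu_height (EPlus e1 e2) = Suc (mu_height e1 + mu_height e2)"
| "mu_height (EMu x e) = Suc (mu_height e)"
| "mu_height e = 0"

lemma mu_height_subst:
  "is_exp e \<Longrightarrow> True"
  "is_guarded e \<Longrightarrow> mu_height (subst x s e) = mu_height e"
  by (induction e and e rule: is_exp_is_guarded.inducts) auto

text \<open>\<open>delta G F\<close> is \<open>\<delta>\<close> at \<open>F \<lhd> G\<close>. The clause for \<open>Id\<close> takes precedence, which only matters
  for \<open>\<mu>\<close>-expressions when \<open>G = Id\<close>. The value is arbitrary outside \<open>Exps F G\<close>.\<close>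

function delta ::
  "('a, 'b) ndf \<Rightarrow> ('a, 'b) ndf \<Rightarrow> ('a, 'b) exp \<Rightarrow> ('a, 'b, ('a, 'b) exp) val" where
  "delta G F e = (if F = FId then VId e else
     case e of
       EEmpty \<Rightarrow> empty_val F
     | EPlus e1 e2 \<Rightarrow> plus_val F (delta G F e1) (delta G F e2)
     | EMu x e' \<Rightarrow>
         (if F = G \<and> is_guarded e' then delta G G (subst x (EMu x e') e') else undefined)
     | ELat b \<Rightarrow> VLat b
     | EProdL e' \<Rightarrow> (case F of FProd F1 F2 \<Rightarrow> VPair (delta G F1 e') (empty_val F2))
     | EProdR e' \<Rightarrow> (case F of FProd F1 F2 \<Rightarrow> VPair (empty_val F1) (delta G F2 e'))
     | ESumL e' \<Rightarrow> (case F of FSum F1 F2 \<Rightarrow> VK1 (delta G F1 e'))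
     | ESumR e' \<Rightarrow> (case F of FSum F1 F2 \<Rightarrow> VK2 (delta G F2 e'))
     | EAct a e' \<Rightarrow> (case F of FExp F' A \<Rightarrow>
         VFun (\<lambda>a'. if a' \<in> A then Some (if a' = a then delta G F' e' else empty_val F') else None))
     | ESing e' \<Rightarrow> (case F of FPow F' \<Rightarrow> VSet {|delta G F' e'|}))"
  by pat_completeness auto
termination
  by (relation "measures [\<lambda>(G, F, e). size F, \<lambda>(G, F, e). mu_height e]")
    (auto simp: mu_height_subst)

declare delta.simps [simp del]

abbreviation exp_bisimilar :: "('a, 'b) ndf \<Rightarrow> ('a, 'b) exp \<Rightarrow> ('a, 'b) exp \<Rightarrow> bool" where
  "exp_bisimilar G \<equiv> bisimilar G (Exp G) (delta G G)"


section \<open>The equational specification\<close>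

text \<open>Ground terms over expressions. \<open>TExp\<close> and \<open>TLat\<close> embed the sorts \<open>Exp\<close> and \<open>Slt\<close> into
  \<open>ExpStruct\<close>; \<open>TLam a F t\<close> is \<open>\<lambda>.(a, F \<lhd> G, t)\<close>, the function with value \<open>t\<close> at \<open>a\<close> and
  \<open>Empty\<close> elsewhere; \<open>TSim\<close> is the Boolean operator \<open>\<simeq>\<close> on \<open>Slt\<close>.\<close>

datatype ('a, 'b) trm =
    TExp "('a, 'b) exp"
  | TLat 'b
  | TPair "('a, 'b) trm" "('a, 'b) trm"
  | TK1 "('a, 'b) trm"
  | TK2 "('a, 'b) trm"
  | TBot
  | TTop
  | TLam 'a "('a, 'b) ndf" "('a, 'b) trm"
  | TSet "('a, 'b) trm fset"
  | TApp "('a, 'b) trm" 'a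
  | TDelta "('a, 'b) ndf" "('a, 'b) exp"
  | TEmpty "('a, 'b) ndf"
  | TPlus "('a, 'b) ndf" "('a, 'b) trm" "('a, 'b) trm"
  | TSim "('a, 'b) trm" "('a, 'b) trm"
  | TTrue
  | TFalse

text \<open>Sorts are refined by the ingredient a structured term belongs to: \<open>STy FId\<close> is the sort
  \<open>Exp\<close>, \<open>STy (FLat B)\<close> is \<open>Slt\<close> for the semilattice \<open>B\<close>, and all other \<open>STy F\<close> are proper
  structured terms.\<close>

datatype ('a, 'b) srt = STy "('a, 'b) ndf" | SBool

inductive wt :: "('a, 'b) ndf \<Rightarrow> ('a, 'b) trm \<Rightarrow> ('a, 'b) srt \<Rightarrow> bool" for G where
  "e \<in> Exp G \<Longrightarrow> wt G (TExp e) (STy FId)"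
| "FLat B \<lhd> G \<Longrightarrow> b \<in> jcarrier B \<Longrightarrow> wt G (TLat b) (STy (FLat B))"
| "FProd F1 F2 \<lhd> G \<Longrightarrow> wt G t1 (STy F1) \<Longrightarrow> wt G t2 (STy F2) \<Longrightarrow>
     wt G (TPair t1 t2) (STy (FProd F1 F2))"
| "FSum F1 F2 \<lhd> G \<Longrightarrow> wt G t (STy F1) \<Longrightarrow> wt G (TK1 t) (STy (FSum F1 F2))"
| "FSum F1 F2 \<lhd> G \<Longrightarrow> wt G t (STy F2) \<Longrightarrow> wt G (TK2 t) (STy (FSum F1 F2))"
| "FSum F1 F2 \<lhd> G \<Longrightarrow> wt G TBot (STy (FSum F1 F2))"
| "FSum F1 F2 \<lhd> G \<Longrightarrow> wt G TTop (STy (FSum F1 F2))"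
| "FExp F A \<lhd> G \<Longrightarrow> a \<in> A \<Longrightarrow> wt G t (STy F) \<Longrightarrow> wt G (TLam a F t) (STy (FExp F A))"
| "FPow F \<lhd> G \<Longrightarrow> \<forall>t. t |\<in>| T \<longrightarrow> wt G t (STy F) \<Longrightarrow> wt G (TSet T) (STy (FPow F))"
| "FExp F A \<lhd> G \<Longrightarrow> a \<in> A \<Longrightarrow> wt G t (STy (FExp F A)) \<Longrightarrow> wt G (TApp t a) (STy F)"
| "F \<lhd> G \<Longrightarrow> e \<in> Exps F G \<Longrightarrow> wt G (TDelta F e) (STy F)"
| "F \<lhd> G \<Longrightarrow> wt G (TEmpty F) (STy F)"
| "F \<lhd> G \<Longrightarrow> wt G t (STy F) \<Longrightarrow> wt G u (STy F) \<Longrightarrow> wt G (TPlus F t u) (STy F)"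
| "FLat B \<lhd> G \<Longrightarrow> wt G t (STy (FLat B)) \<Longrightarrow> wt G u (STy (FLat B)) \<Longrightarrow> wt G (TSim t u) SBool"
| "wt G TTrue SBool"
| "wt G TFalse SBool"

text \<open>Ground instances of the equations. Substitution, joins of constants and typing are evaluated
  by the functions above. \<open>Empty\<close> and \<open>Plus\<close> on exponents are given by their values.\<close>

inductive axm :: "('a, 'b) ndf \<Rightarrow> ('a, 'b) trm \<Rightarrow> ('a, 'b) trm \<Rightarrow> bool" for G where
  ax_aci: "aci e e' \<Longrightarrow> axm G (TExp e) (TExp e')"
| ax_delta_aci: "aci e e' \<Longrightarrow> axm G (TDelta F e) (TDelta F e')"
| ax_delta_id: "axm G (TDelta FId e) (TExp e)"
| ax_delta_empty: "axm G (TDelta F EEmpty) (TEmpty F)"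
| ax_delta_plus: "axm G (TDelta F (EPlus e1 e2)) (TPlus F (TDelta F e1) (TDelta F e2))"
| ax_delta_mu: "G \<noteq> FId \<Longrightarrow> axm G (TDelta G (EMu x e)) (TDelta G (subst x (EMu x e) e))"
| ax_delta_lat: "axm G (TDelta (FLat B) (ELat b)) (TLat b)"
| ax_delta_prodl: "axm G (TDelta (FProd F1 F2) (EProdL e)) (TPair (TDelta F1 e) (TEmpty F2))"
| ax_delta_prodr: "axm G (TDelta (FProd F1 F2) (EProdR e)) (TPair (TEmpty F1) (TDelta F2 e))"
| ax_delta_suml: "axm G (TDelta (FSum F1 F2) (ESumL e)) (TK1 (TDelta F1 e))"
| ax_delta_sumr: "axm G (TDelta (FSum F1 F2) (ESumR e)) (TK2 (TDelta F2 e))"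
| ax_delta_act: "axm G (TDelta (FExp F A) (EAct a e)) (TLam a F (TDelta F e))"
| ax_delta_sing: "axm G (TDelta (FPow F) (ESing e)) (TSet {|TDelta F e|})"
| ax_lam_same: "axm G (TApp (TLam a F t) a) t"
| ax_lam_other: "a' \<noteq> a \<Longrightarrow> axm G (TApp (TLam a F t) a') (TEmpty F)"
| ax_empty_id: "axm G (TEmpty FId) (TExp EEmpty)"
| ax_empty_lat: "axm G (TEmpty (FLat B)) (TLat (jbot B))"
| ax_empty_prod: "axm G (TEmpty (FProd F1 F2)) (TPair (TEmpty F1) (TEmpty F2))"
| ax_empty_sum: "axm G (TEmpty (FSum F1 F2)) TBot"
| ax_empty_exp: "axm G (TApp (TEmpty (FExp F A)) a) (TEmpty F)"
| ax_empty_pow: "axm G (TEmpty (FPow F)) (TSet {||})"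
| ax_plus_id: "axm G (TPlus FId (TExp e1) (TExp e2)) (TExp (EPlus e1 e2))"
| ax_plus_lat: "axm G (TPlus (FLat B) (TLat b1) (TLat b2)) (TLat (jjoin B b1 b2))"
| ax_plus_prod: "axm G (TPlus (FProd F1 F2) (TPair t1 t2) (TPair u1 u2))
     (TPair (TPlus F1 t1 u1) (TPlus F2 t2 u2))"
| ax_plus_bot1: "axm G (TPlus (FSum F1 F2) TBot t) t"
| ax_plus_bot2: "axm G (TPlus (FSum F1 F2) t TBot) t"
| ax_plus_top1: "axm G (TPlus (FSum F1 F2) TTop t) TTop"
| ax_plus_top2: "axm G (TPlus (FSum F1 F2) t TTop) TTop"
| ax_plus_k11: "axm G (TPlus (FSum F1 F2) (TK1 t) (TK1 u)) (TK1 (TPlus F1 t u))"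
| ax_plus_k22: "axm G (TPlus (FSum F1 F2) (TK2 t) (TK2 u)) (TK2 (TPlus F2 t u))"
| ax_plus_k12: "axm G (TPlus (FSum F1 F2) (TK1 t) (TK2 u)) TTop"
| ax_plus_k21: "axm G (TPlus (FSum F1 F2) (TK2 t) (TK1 u)) TTop"
| ax_plus_exp: "axm G (TApp (TPlus (FExp F A) f g) a) (TPlus F (TApp f a) (TApp g a))"
| ax_plus_pow: "axm G (TPlus (FPow F) (TSet T) (TSet U)) (TSet (T |\<union>| U))"
| ax_sim_true: "axm G (TSim (TLat b) (TLat b)) TTrue"
| ax_sim_false: "b \<noteq> b' \<Longrightarrow> axm G (TSim (TLat b) (TLat b')) TFalse"

text \<open>\<open>deduce G s t u\<close>: the equation \<open>t = u\<close> between ground terms of sort \<open>s\<close> follows by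
  equational deduction. Congruence inside expressions is part of \<open>aci\<close>.\<close>

inductive deduce :: "('a, 'b) ndf \<Rightarrow> ('a, 'b) srt \<Rightarrow> ('a, 'b) trm \<Rightarrow> ('a, 'b) trm \<Rightarrow> bool"
  for G where
  ded_axm: "axm G t u \<Longrightarrow> wt G t s \<Longrightarrow> wt G u s \<Longrightarrow> deduce G s t u"
| ded_refl: "wt G t s \<Longrightarrow> deduce G s t t"
| ded_sym: "deduce G s t u \<Longrightarrow> deduce G s u t"
| ded_trans: "deduce G s t u \<Longrightarrow> deduce G s u v \<Longrightarrow> deduce G s t v"
| ded_pair: "FProd F1 F2 \<lhd> G \<Longrightarrow> deduce G (STy F1) t1 u1 \<Longrightarrow> deduce G (STy F2) t2 u2 \<Longrightarrow>
     deduce G (STy (FProd F1 F2)) (TPair t1 t2) (TPair u1 u2)"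
| ded_k1: "FSum F1 F2 \<lhd> G \<Longrightarrow> deduce G (STy F1) t u \<Longrightarrow>
     deduce G (STy (FSum F1 F2)) (TK1 t) (TK1 u)"
| ded_k2: "FSum F1 F2 \<lhd> G \<Longrightarrow> deduce G (STy F2) t u \<Longrightarrow>
     deduce G (STy (FSum F1 F2)) (TK2 t) (TK2 u)"
| ded_lam: "FExp F A \<lhd> G \<Longrightarrow> a \<in> A \<Longrightarrow> deduce G (STy F) t u \<Longrightarrow>
     deduce G (STy (FExp F A)) (TLam a F t) (TLam a F u)"
| ded_set: "FPow F \<lhd> G \<Longrightarrow>
     \<forall>t. t |\<in>| T \<longrightarrow> (\<exists>u. u |\<in>| U \<and> deduce G (STy F) t u) \<Longrightarrow>
     \<forall>u. u |\<in>| U \<longrightarrow> (\<exists>t. t |\<in>| T \<and> deduce G (STy F) t u) \<Longrightarrow>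
     deduce G (STy (FPow F)) (TSet T) (TSet U)"
| ded_app: "FExp F A \<lhd> G \<Longrightarrow> a \<in> A \<Longrightarrow> deduce G (STy (FExp F A)) t u \<Longrightarrow>
     deduce G (STy F) (TApp t a) (TApp u a)"
| ded_plus: "F \<lhd> G \<Longrightarrow> deduce G (STy F) t1 u1 \<Longrightarrow> deduce G (STy F) t2 u2 \<Longrightarrow>
     deduce G (STy F) (TPlus F t1 t2) (TPlus F u1 u2)"
| ded_sim: "FLat B \<lhd> G \<Longrightarrow> deduce G (STy (FLat B)) t1 u1 \<Longrightarrow> deduce G (STy (FLat B)) t2 u2 \<Longrightarrow>
     deduce G SBool (TSim t1 t2) (TSim u1 u2)"


section \<open>Frozen equations and interpolants\<close>

text \<open>\<open>Eqn s t u\<close> is the frozen equation \<open>\<langle>t\<rangle> = \<langle>u\<rangle>\<close>. There is one freezing operator for each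
  sort, and no other operator can be applied to a frozen term: frozen hypotheses are not usable
  under contexts.\<close>

datatype ('a, 'b) eqn = Eqn "('a, 'b) srt" "('a, 'b) trm" "('a, 'b) trm"

text \<open>\<open>interp e D\<close> is an interpolant decomposing \<open>e\<close>, given in disjunctive normal form: \<open>e\<close> is
  equivalent to the disjunction over \<open>K \<in> D\<close> of the conjunction of \<open>K\<close>. Only finite sets need
  more than one disjunct: ``every element of either set equals some element of the other'' has one
  disjunct for each choice of partners.\<close>

inductive interp :: "('a, 'b) eqn \<Rightarrow> ('a, 'b) eqn set set \<Rightarrow> bool" where
  ip_lat: "interp (Eqn (STy (FLat B)) t u) {{Eqn SBool (TSim t u) TTrue}}"
| ip_pair: "interp (Eqn (STy (FProd F1 F2)) (TPair t1 t2) (TPair u1 u2))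
     {{Eqn (STy F1) t1 u1, Eqn (STy F2) t2 u2}}"
| ip_k1: "interp (Eqn (STy (FSum F1 F2)) (TK1 t) (TK1 u)) {{Eqn (STy F1) t u}}"
| ip_k2: "interp (Eqn (STy (FSum F1 F2)) (TK2 t) (TK2 u)) {{Eqn (STy F2) t u}}"
| ip_fun: "interp (Eqn (STy (FExp F A)) f g) {{Eqn (STy F) (TApp f a) (TApp g a) | a. a \<in> A}}"
| ip_set: "(T = {||} \<longleftrightarrow> U = {||}) \<Longrightarrow> interp (Eqn (STy (FPow F)) (TSet T) (TSet U))
     {{Eqn (STy F) t (p t) | t. t |\<in>| T} \<union> {Eqn (STy F) (q u) u | u. u |\<in>| U} | p q.
        (\<forall>t. t |\<in>| T \<longrightarrow> p t |\<in>| U) \<and> (\<forall>u. u |\<in>| U \<longrightarrow> q u |\<in>| T)}"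

text \<open>\<open>ndf_entails G H e\<close>: the specification together with the frozen equations \<open>H\<close> entails the
  frozen equation \<open>e\<close>.\<close>

inductive ndf_entails :: "('a, 'b) ndf \<Rightarrow> ('a, 'b) eqn set \<Rightarrow> ('a, 'b) eqn \<Rightarrow> bool"
  for G H where
  ent_deduce: "deduce G s t u \<Longrightarrow> ndf_entails G H (Eqn s t u)"
| ent_hyp: "e \<in> H \<Longrightarrow> ndf_entails G H e"
| ent_sym: "ndf_entails G H (Eqn s t u) \<Longrightarrow> ndf_entails G H (Eqn s u t)"
| ent_trans: "ndf_entails G H (Eqn s t u) \<Longrightarrow> ndf_entails G H (Eqn s u v) \<Longrightarrow>
     ndf_entails G H (Eqn s t v)"
| ent_pair: "wt G (TPair t1 t2) (STy (FProd F1 F2)) \<Longrightarrow> wt G (TPair u1 u2) (STy (FProd F1 F2)) \<Longrightarrow>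
     ndf_entails G H (Eqn (STy F1) t1 u1) \<Longrightarrow> ndf_entails G H (Eqn (STy F2) t2 u2) \<Longrightarrow>
     ndf_entails G H (Eqn (STy (FProd F1 F2)) (TPair t1 t2) (TPair u1 u2))"
| ent_k1: "wt G (TK1 t) (STy (FSum F1 F2)) \<Longrightarrow> wt G (TK1 u) (STy (FSum F1 F2)) \<Longrightarrow>
     ndf_entails G H (Eqn (STy F1) t u) \<Longrightarrow>
     ndf_entails G H (Eqn (STy (FSum F1 F2)) (TK1 t) (TK1 u))"
| ent_k2: "wt G (TK2 t) (STy (FSum F1 F2)) \<Longrightarrow> wt G (TK2 u) (STy (FSum F1 F2)) \<Longrightarrow>
     ndf_entails G H (Eqn (STy F2) t u) \<Longrightarrow>
     ndf_entails G H (Eqn (STy (FSum F1 F2)) (TK2 t) (TK2 u))"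
| ent_fun: "wt G f (STy (FExp F A)) \<Longrightarrow> wt G g (STy (FExp F A)) \<Longrightarrow>
     \<forall>a\<in>A. ndf_entails G H (Eqn (STy F) (TApp f a) (TApp g a)) \<Longrightarrow>
     ndf_entails G H (Eqn (STy (FExp F A)) f g)"
| ent_set: "wt G (TSet T) (STy (FPow F)) \<Longrightarrow> wt G (TSet U) (STy (FPow F)) \<Longrightarrow>
     \<forall>t. t |\<in>| T \<longrightarrow> (\<exists>u. u |\<in>| U \<and> ndf_entails G H (Eqn (STy F) t u)) \<Longrightarrow>
     \<forall>u. u |\<in>| U \<longrightarrow> (\<exists>t. t |\<in>| T \<and> ndf_entails G H (Eqn (STy F) t u)) \<Longrightarrow>
     ndf_entails G H (Eqn (STy (FPow F)) (TSet T) (TSet U))"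
| ent_interp: "interp (Eqn s t u) D \<Longrightarrow> K \<in> D \<Longrightarrow> wt G t s \<Longrightarrow> wt G u s \<Longrightarrow>
     \<forall>e\<in>K. ndf_entails G H e \<Longrightarrow> ndf_entails G H (Eqn s t u)"


section \<open>The reduction process\<close>

text \<open>Terms are matched modulo the equations of the specification, so that for instance a goal
  \<open>\<delta>(\<epsilon>) = \<delta>(\<epsilon>')\<close> is decomposed once both sides are provably pairs.\<close>

definition simplifies :: "('a, 'b) ndf \<Rightarrow> ('a, 'b) eqn \<Rightarrow> ('a, 'b) eqn set set \<Rightarrow> bool" where
  "simplifies G e D \<longleftrightarrow>
     (\<exists>s t u t' u'. e = Eqn s t u \<and> deduce G s t t' \<and> deduce G s u u' \<and> interp (Eqn s t' u') D)"

definition derivable :: "('a, 'b) eqn \<Rightarrow> bool" where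
  "derivable e \<longleftrightarrow> (\<exists>t u. e = Eqn (STy FId) t u)"

definition derivative :: "('a, 'b) ndf \<Rightarrow> ('a, 'b) eqn \<Rightarrow> ('a, 'b) eqn \<Rightarrow> bool" where
  "derivative G e e' \<longleftrightarrow>
     (\<exists>t u \<epsilon> \<epsilon>'. e = Eqn (STy FId) t u \<and>
        deduce G (STy FId) t (TExp \<epsilon>) \<and> deduce G (STy FId) u (TExp \<epsilon>') \<and>
        e' = Eqn (STy G) (TDelta G \<epsilon>) (TDelta G \<epsilon>'))"

text \<open>A configuration consists of the frozen hypotheses and the frozen goals; the specification is
  fixed by \<open>G\<close>. A rule replaces a configuration by the set of its alternatives, of which there is
  exactly one except when a goal between finite sets is simplified.\<close>

type_synonym ('a, 'b) config = "('a, 'b) eqn set \<times> ('a, 'b) eqn set"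

inductive rule_step :: "('a, 'b) ndf \<Rightarrow> ('a, 'b) config \<Rightarrow> ('a, 'b) config set \<Rightarrow> bool"
  for G where
  Reduce: "e \<in> \<G> \<Longrightarrow> ndf_entails G \<F> e \<Longrightarrow> rule_step G (\<F>, \<G>) {(\<F>, \<G> - {e})}"
| Derive: "e \<in> \<G> \<Longrightarrow> derivable e \<Longrightarrow> \<not> ndf_entails G \<F> e \<Longrightarrow> derivative G e e' \<Longrightarrow>
     rule_step G (\<F>, \<G>) {(insert e \<F>, (\<G> - {e}) \<union> {e'})}"
| Simplify: "e \<in> \<G> \<Longrightarrow> simplifies G e D \<Longrightarrow>
     rule_step G (\<F>, \<G>) {(\<F>, (\<G> - {e}) \<union> K) | K. K \<in> D}"

text \<open>Failure is reported only for goals that admit no further decomposition.\<close>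

definition fails :: "('a, 'b) ndf \<Rightarrow> ('a, 'b) config \<Rightarrow> bool" where
  "fails G c \<longleftrightarrow>
     (\<exists>e\<in>snd c. \<not> derivable e \<and> \<not> ndf_entails G (fst c) e \<and> (\<nexists>D. simplifies G e D))"

text \<open>The process explores the alternatives in any order. It stops with success as soon as one of
  them has no goals left, and with failure when the last one fails.\<close>

datatype ('a, 'b) state = Running "('a, 'b) config set" | Success | Failure

inductive circ :: "('a, 'b) ndf \<Rightarrow> ('a, 'b) state \<Rightarrow> ('a, 'b) state \<Rightarrow> bool" for G where
  Done: "(\<F>, {}) \<in> S \<Longrightarrow> circ G (Running S) Success"
| Step: "c \<in> S \<Longrightarrow> rule_step G c C \<Longrightarrow> circ G (Running S) (Running ((S - {c}) \<union> C))"
| Fail_branch: "c \<in> S \<Longrightarrow> fails G c \<Longrightarrow> S \<noteq> {c} \<Longrightarrow> circ G (Running S) (Running (S - {c}))"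
| Fail: "fails G c \<Longrightarrow> circ G (Running {c}) Failure"

definition start :: "(('a, 'b) exp \<times> ('a, 'b) exp) set \<Rightarrow> ('a, 'b) state" where
  "start \<Gamma> = Running {({}, (\<lambda>(e1, e2). Eqn (STy FId) (TExp e1) (TExp e2)) ` \<Gamma>)}"

end

theory Submission
  imports Defs "HOL-Library.Multiset"
begin

text \<open>Ground terms are interpreted by structured values over expressions. Deduction is sound for this
  interpretation up to the lifting of \<open>aci\<close>, which is itself a bisimulation, and every well-sorted
  term is provably equal to one in constructor form. Hence a goal on structured terms that can be
  neither decomposed nor deduced is not valid for bisimilarity.

  The run keeps two invariants. The hypotheses are a bisimulation up to what hypotheses and goals
  together entail, and the initial goals are entailed as well; when no goals are left, the entailed
  equations form a bisimulation. Conversely, if the initial goals are bisimilar then some alternative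
  has only goals valid for bisimilarity, and such an alternative cannot fail.

  For termination, all expressions occurring in a run lie in a set with finitely many classes modulo
  \<open>aci\<close>: the sums over the finite closure of the initial expressions under subexpressions and
  unfolding.\<close>

section \<open>Relation lifting\<close>

text \<open>Functions are compared on the exponent only, so that terms can be interpreted by total
  functions without knowing their exponent.\<close>

primrec rlift :: "('a, 'b) ndf \<Rightarrow> ('x \<times> 'x) set \<Rightarrow> ('a, 'b, 'x) val \<Rightarrow> ('a, 'b, 'x) val \<Rightarrow> bool" where
  "rlift FId R u v \<longleftrightarrow> (\<exists>x y. u = VId x \<and> v = VId y \<and> (x, y) \<in> R)"
| "rlift (FLat B) R u v \<longleftrightarrow> (\<exists>b\<in>jcarrier B. u = VLat b \<and> v = VLat b)"
| "rlift (FSum F1 F2) R u v \<longleftrightarrow> (u = VBot \<and> v = VBot) \<or> (u = VTop \<and> v = VTop) \<or>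
     (\<exists>u' v'. u = VK1 u' \<and> v = VK1 v' \<and> rlift F1 R u' v') \<or>
     (\<exists>u' v'. u = VK2 u' \<and> v = VK2 v' \<and> rlift F2 R u' v')"
| "rlift (FProd F1 F2) R u v \<longleftrightarrow> (\<exists>u1 u2 v1 v2. u = VPair u1 u2 \<and> v = VPair v1 v2 \<and>
     rlift F1 R u1 v1 \<and> rlift F2 R u2 v2)"
| "rlift (FExp F A) R u v \<longleftrightarrow> (\<exists>f g. u = VFun f \<and> v = VFun g \<and>
     (\<forall>a\<in>A. \<exists>x y. f a = Some x \<and> g a = Some y \<and> rlift F R x y))"
| "rlift (FPow F) R u v \<longleftrightarrow> (\<exists>U V. u = VSet U \<and> v = VSet V \<and>
     (\<forall>x. x |\<in>| U \<longrightarrow> (\<exists>y. y |\<in>| V \<and> rlift F R x y)) \<and>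
     (\<forall>y. y |\<in>| V \<longrightarrow> (\<exists>x. x |\<in>| U \<and> rlift F R x y)))"

lemma rlift_mono: "rlift F R u v \<Longrightarrow> R \<subseteq> R' \<Longrightarrow> rlift F R' u v"
proof (induction F arbitrary: u v)
  case (FSum F1 F2) then show ?case by (auto; blast)
next
  case (FExp F A)
  then obtain f g where e: "u = VFun f" "v = VFun g"
    and fg: "\<And>a. a \<in> A \<Longrightarrow> \<exists>x y. f a = Some x \<and> g a = Some y \<and> rlift F R x y" by auto
  have "\<exists>x y. f a = Some x \<and> g a = Some y \<and> rlift F R' x y" if "a \<in> A" for a
    using fg[OF that] FExp.IH FExp.prems(2) by blast
  then show ?case using e by simp
next
  case (FPow F)
  then obtain U V where e: "u = VSet U" "v = VSet V"
    and uv: "\<And>x. x |\<in>| U \<Longrightarrow> \<exists>y. y |\<in>| V \<and> rlift F R x y"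
      "\<And>y. y |\<in>| V \<Longrightarrow> \<exists>x. x |\<in>| U \<and> rlift F R x y" by auto
  have "\<exists>y. y |\<in>| V \<and> rlift F R' x y" if "x |\<in>| U" for x
    using that uv(1)[OF that] FPow.IH FPow.prems(2) by blast
  moreover have "\<exists>x. x |\<in>| U \<and> rlift F R' x y" if "y |\<in>| V" for y
    using that uv(2)[OF that] FPow.IH FPow.prems(2) by blast
  ultimately show ?case using e by simp
qed (auto; blast)+

lemma rlift_comp: "rlift F R u v \<Longrightarrow> rlift F R' v w \<Longrightarrow> rlift F (R O R') u w"
proof (induction F arbitrary: u v w)
  case (FSum F1 F2) then show ?case by (auto; blast)
next
  case (FExp F A)
  then obtain f g h where e: "u = VFun f" "v = VFun g" "w = VFun h"
    and fg: "\<And>a. a \<in> A \<Longrightarrow> \<exists>x y. f a = Some x \<and> g a = Some y \<and> rlift F R x y"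
    and gh: "\<And>a. a \<in> A \<Longrightarrow> \<exists>x y. g a = Some x \<and> h a = Some y \<and> rlift F R' x y" by auto
  have "\<exists>x y. f a = Some x \<and> h a = Some y \<and> rlift F (R O R') x y" if "a \<in> A" for a
    using fg[OF that] gh[OF that] FExp.IH by fastforce
  then show ?case using e by simp
next
  case (FPow F)
  from FPow.prems obtain U V W where e: "u = VSet U" "v = VSet V" "w = VSet W"
    and uv: "\<And>x. x |\<in>| U \<Longrightarrow> \<exists>y. y |\<in>| V \<and> rlift F R x y" "\<And>y. y |\<in>| V \<Longrightarrow> \<exists>x. x |\<in>| U \<and> rlift F R x y"
    and vw: "\<And>x. x |\<in>| V \<Longrightarrow> \<exists>y. y |\<in>| W \<and> rlift F R' x y" "\<And>y. y |\<in>| W \<Longrightarrow> \<exists>x. x |\<in>| V \<and> rlift F R' x y"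
    by auto
  show ?case unfolding e using uv vw FPow.IH by simp meson
qed auto

lemma rlift_sym: "rlift F R u v \<Longrightarrow> rlift F (R\<inverse>) v u"
proof (induction F arbitrary: u v)
  case (FExp F A)
  then obtain f g where e: "u = VFun f" "v = VFun g"
    and fg: "\<And>a. a \<in> A \<Longrightarrow> \<exists>x y. f a = Some x \<and> g a = Some y \<and> rlift F R x y" by auto
  have "\<exists>x y. g a = Some x \<and> f a = Some y \<and> rlift F (R\<inverse>) x y" if "a \<in> A" for a
    using fg[OF that] FExp.IH  by blast
  then show ?case using e by simp
next
  case (FPow F)
  then obtain U V where e: "u = VSet U" "v = VSet V"
    and uv: "\<And>x. x |\<in>| U \<Longrightarrow> \<exists>y. y |\<in>| V \<and> rlift F R x y"
      "\<And>y. y |\<in>| V \<Longrightarrow> \<exists>x. x |\<in>| U \<and> rlift F R x y" by auto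
  have "\<exists>y. y |\<in>| V \<and> rlift F (R\<inverse>) y x" if "x |\<in>| U" for x
    using that uv(1)[OF that] FPow.IH  by blast
  moreover have "\<exists>x. x |\<in>| U \<and> rlift F (R\<inverse>) y x" if "y |\<in>| V" for y
    using that uv(2)[OF that] FPow.IH  by blast
  ultimately show ?case using e by simp
qed auto

lemma rlift_refl_left: "rlift F R u v \<Longrightarrow> Domain R \<subseteq> X \<Longrightarrow> rlift F (Id_on X) u u"
proof (induction F arbitrary: u v)
  case (FSum F1 F2) then show ?case by (auto; blast)
next
  case (FExp F A)
  then obtain f g where e: "u = VFun f" "v = VFun g"
    and fg: "\<And>a. a \<in> A \<Longrightarrow> \<exists>x y. f a = Some x \<and> g a = Some y \<and> rlift F R x y" by auto
  have "\<exists>x y. f a = Some x \<and> f a = Some y \<and> rlift F (Id_on X) x y" if "a \<in> A" for a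
    using fg[OF that] FExp.IH FExp.prems(2) by blast
  then show ?case using e by simp
next
  case (FPow F)
  then obtain U V where e: "u = VSet U" "v = VSet V"
    and uv: "\<And>x. x |\<in>| U \<Longrightarrow> \<exists>y. y |\<in>| V \<and> rlift F R x y"
      "\<And>y. y |\<in>| V \<Longrightarrow> \<exists>x. x |\<in>| U \<and> rlift F R x y" by auto
  have "\<exists>y. y |\<in>| U \<and> rlift F (Id_on X) x y" if "x |\<in>| U" for x
    using that uv(1)[OF that] FPow.IH FPow.prems(2) by blast
  moreover have "\<exists>x. x |\<in>| U \<and> rlift F (Id_on X) x y" if "y |\<in>| U" for y
    using that uv(1)[OF that] FPow.IH FPow.prems(2) by blast
  ultimately show ?case using e by simp
qed (auto; blast)+

lemma rlift_in_right:
  "rlift F R u v \<Longrightarrow> rlift F (Id_on X) u u \<Longrightarrow> R `` X \<subseteq> X \<Longrightarrow> rlift F (Id_on X) v v"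
proof (induction F arbitrary: u v)
  case (FSum F1 F2) then show ?case by (auto; blast)
next
  case (FExp F A)
  from FExp.prems(1) obtain f g where e: "u = VFun f" "v = VFun g"
    and fg: "\<And>a. a \<in> A \<Longrightarrow> \<exists>x y. f a = Some x \<and> g a = Some y \<and> rlift F R x y" by auto
  have ff: "\<exists>x. f a = Some x \<and> rlift F (Id_on X) x x" if "a \<in> A" for a
    using FExp.prems(2) that unfolding e by auto
  have "\<exists>x y. g a = Some x \<and> g a = Some y \<and> rlift F (Id_on X) x y" if "a \<in> A" for a
    using fg[OF that] ff[OF that] FExp.IH FExp.prems(3) by (metis option.inject)
  then show ?case using e by simp
next
  case (FPow F)
  from FPow.prems obtain U V where e: "u = VSet U" "v = VSet V"
    and uv: "\<forall>y. y |\<in>| V \<longrightarrow> (\<exists>x. x |\<in>| U \<and> rlift F R x y)"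
    and uu: "\<forall>x. x |\<in>| U \<longrightarrow> (\<exists>y. y |\<in>| U \<and> rlift F (Id_on X) x y)"
    unfolding rlift.simps by fastforce
  have "rlift F (Id_on X) y y" if "y |\<in>| V" for y
    using uv that uu rlift_refl_left[of F "Id_on X" _ _ X] FPow.IH FPow.prems(3) by (metis Domain_Id_on subset_refl)
  then show ?case unfolding e by auto
qed (auto; blast)+

lemma flift_imp_rlift: "(u, v) \<in> flift F R \<Longrightarrow> rlift F R u v"
proof -
  have "z \<in> fobj F R \<Longrightarrow> rlift F R (map_val fst z) (map_val snd z)" for z
  proof (induction F arbitrary: z)
    case (FExp F A) then show ?case by (fastforce simp: dom_def ran_def)
  next
    case (FPow F) then show ?case by (fastforce)
  qed auto
  then show "(u, v) \<in> flift F R \<Longrightarrow> rlift F R u v" by (auto simp: flift_def)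
qed

lemma rlift_imp_flift:
  "rlift F R u v \<Longrightarrow> u \<in> fobj F X \<Longrightarrow> v \<in> fobj F X \<Longrightarrow> (u, v) \<in> flift F R"
proof -
  have "\<exists>z\<in>fobj F R. map_val fst z = u \<and> map_val snd z = v"
    if "rlift F R u v" "u \<in> fobj F X" "v \<in> fobj F X" for u v
    using that
  proof (induction F arbitrary: u v)
    case FId then show ?case by force
  next
    case (FLat B) then show ?case by force
  next
    case (FSum F1 F2)
    from FSum.prems(1) consider "u = VBot" "v = VBot" | "u = VTop" "v = VTop"
      | u' v' where "u = VK1 u'" "v = VK1 v'" "rlift F1 R u' v'"
      | u' v' where "u = VK2 u'" "v = VK2 v'" "rlift F2 R u' v'" by auto
    then show ?case
    proof cases
      case 3
      with FSum.prems FSum.IH(1)[of u' v'] obtain z where "z \<in> fobj F1 R" "map_val fst z = u'" "map_val snd z = v'"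
        by auto
      with 3 show ?thesis by (intro bexI[of _ "VK1 z"]) auto
    next
      case 4
      with FSum.prems FSum.IH(2)[of u' v'] obtain z where "z \<in> fobj F2 R" "map_val fst z = u'" "map_val snd z = v'"
        by auto
      with 4 show ?thesis by (intro bexI[of _ "VK2 z"]) auto
    qed (auto intro: bexI[of _ VBot] bexI[of _ VTop])
  next
    case (FProd F1 F2)
    then obtain u1 u2 v1 v2 where e: "u = VPair u1 u2" "v = VPair v1 v2"
      and "rlift F1 R u1 v1" "rlift F2 R u2 v2" "u1 \<in> fobj F1 X" "v1 \<in> fobj F1 X" "u2 \<in> fobj F2 X" "v2 \<in> fobj F2 X"
      by auto
    with FProd.IH(1)[of u1 v1] FProd.IH(2)[of u2 v2] obtain z1 z2
      where "z1 \<in> fobj F1 R" "map_val fst z1 = u1" "map_val snd z1 = v1"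
        "z2 \<in> fobj F2 R" "map_val fst z2 = u2" "map_val snd z2 = v2" by blast
    then have "VPair z1 z2 \<in> fobj (FProd F1 F2) R" "map_val fst (VPair z1 z2) = VPair u1 u2"
      "map_val snd (VPair z1 z2) = VPair v1 v2" by simp_all
    then show ?case unfolding e by (intro bexI[of _ "VPair z1 z2"] conjI)
  next
    case (FExp F A)
    from FExp.prems(1) obtain f g where e: "u = VFun f" "v = VFun g"
      and fg: "\<And>a. a \<in> A \<Longrightarrow> \<exists>x y. f a = Some x \<and> g a = Some y \<and> rlift F R x y" by auto
    have d: "dom f = A" "dom g = A" "ran f \<subseteq> fobj F X" "ran g \<subseteq> fobj F X"
      using FExp.prems(2,3) unfolding e by simp_all
    have "\<exists>z. z \<in> fobj F R \<and> f a = Some (map_val fst z) \<and> g a = Some (map_val snd z)" if "a \<in> A" for a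
    proof -
      from fg[OF that] obtain x y where xy: "f a = Some x" "g a = Some y" "rlift F R x y" by auto
      with d have "x \<in> fobj F X" "y \<in> fobj F X" by (auto simp: ran_def)
      with xy FExp.IH show ?thesis by metis
    qed
    then obtain h where h: "\<And>a. a \<in> A \<Longrightarrow> h a \<in> fobj F R \<and> f a = Some (map_val fst (h a)) \<and> g a = Some (map_val snd (h a))"
      by metis
    let ?h = "\<lambda>a. if a \<in> A then Some (h a) else None"
    have "VFun ?h \<in> fobj (FExp F A) R" using h by (auto simp: ran_def split: if_splits)
    moreover have "map_val fst (VFun ?h) = u" "map_val snd (VFun ?h) = v"
      using h d by (auto simp: e fun_eq_iff dom_def)
    ultimately show ?case by blast
  next
    case (FPow F)
    from FPow.prems(1) obtain U V where e: "u = VSet U" "v = VSet V"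
      and uv: "\<And>x. x |\<in>| U \<Longrightarrow> \<exists>y. y |\<in>| V \<and> rlift F R x y" "\<And>y. y |\<in>| V \<Longrightarrow> \<exists>x. x |\<in>| U \<and> rlift F R x y"
      by auto
    have d: "fset U \<subseteq> fobj F X" "fset V \<subseteq> fobj F X"
      using FPow.prems(2,3) unfolding e by simp_all
    have "\<exists>z. z \<in> fobj F R \<and> x = map_val fst z \<and> map_val snd z |\<in>| V" if "x |\<in>| U" for x
    proof -
      from uv(1)[OF that] obtain y where *: "y |\<in>| V" "rlift F R x y" by blast
      have "x \<in> fobj F X" "y \<in> fobj F X" using d that *(1) by blast+
      from FPow.IH[OF *(2) this] *(1) show ?thesis by blast
    qed
    then obtain p where p: "\<And>x. x |\<in>| U \<Longrightarrow> p x \<in> fobj F R \<and> x = map_val fst (p x) \<and> map_val snd (p x) |\<in>| V"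
      by metis
    have "\<exists>z. z \<in> fobj F R \<and> y = map_val snd z \<and> map_val fst z |\<in>| U" if "y |\<in>| V" for y
    proof -
      from uv(2)[OF that] obtain x where *: "x |\<in>| U" "rlift F R x y" by blast
      have "x \<in> fobj F X" "y \<in> fobj F X" using d that *(1) by blast+
      from FPow.IH[OF *(2) this] *(1) show ?thesis by blast
    qed
    then obtain q where q: "\<And>y. y |\<in>| V \<Longrightarrow> q y \<in> fobj F R \<and> y = map_val snd (q y) \<and> map_val fst (q y) |\<in>| U"
      by metis
    let ?Z = "p |`| U |\<union>| q |`| V"
    have "VSet ?Z \<in> fobj (FPow F) R" using p q by auto
    moreover have "map_val fst |`| ?Z = U" "map_val snd |`| ?Z = V"
      using p q by (force simp: fset_eq_iff)+
    ultimately show ?case unfolding e by (metis val.map(9))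
  qed
  then show "rlift F R u v \<Longrightarrow> u \<in> fobj F X \<Longrightarrow> v \<in> fobj F X \<Longrightarrow> (u, v) \<in> flift F R"
    unfolding flift_def by fast
qed

section \<open>Expressions\<close>

lemma is_guarded_simps [simp]:
  "\<not> is_guarded (EVar x)"
  "is_guarded EEmpty"
  "is_guarded (EPlus e1 e2) \<longleftrightarrow> is_guarded e1 \<and> is_guarded e2"
  "is_guarded (EMu x e) \<longleftrightarrow> is_guarded e"
  "is_guarded (ELat b)"
  "is_guarded (EProdL e) \<longleftrightarrow> is_exp e"
  "is_guarded (EProdR e) \<longleftrightarrow> is_exp e"
  "is_guarded (ESumL e) \<longleftrightarrow> is_exp e"
  "is_guarded (ESumR e) \<longleftrightarrow> is_exp e"
  "is_guarded (EAct a e) \<longleftrightarrow> is_exp e"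
  "is_guarded (ESing e) \<longleftrightarrow> is_exp e"
  by (auto elim: is_guarded.cases intro: is_exp_is_guarded.intros)

lemma is_exp_simps [simp]:
  "is_exp (EVar x)"
  "is_exp EEmpty"
  "is_exp (EPlus e1 e2) \<longleftrightarrow> is_exp e1 \<and> is_exp e2"
  "is_exp (EMu x e) \<longleftrightarrow> is_guarded e"
  "is_exp (ELat b)"
  "is_exp (EProdL e) \<longleftrightarrow> is_exp e"
  "is_exp (EProdR e) \<longleftrightarrow> is_exp e"
  "is_exp (ESumL e) \<longleftrightarrow> is_exp e"
  "is_exp (ESumR e) \<longleftrightarrow> is_exp e"
  "is_exp (EAct a e) \<longleftrightarrow> is_exp e"
  "is_exp (ESing e) \<longleftrightarrow> is_exp e"
  by (auto simp: is_exp.simps[of "EPlus e1 e2"] is_exp.simps[of "EMu x e"] is_exp.simps[of "EProdL e"]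
      is_exp.simps[of "EProdR e"] is_exp.simps[of "ESumL e"] is_exp.simps[of "ESumR e"]
      is_exp.simps[of "EAct a e"] is_exp.simps[of "ESing e"] intro: is_exp_is_guarded.intros)

lemma is_exp_subst:
  "is_exp s \<Longrightarrow> (is_exp e \<longrightarrow> is_exp (subst x s e)) \<and> (is_guarded e \<longrightarrow> is_guarded (subst x s e))"
  by (induction e) auto

lemma fv_subst: "fv s = {} \<Longrightarrow> fv (subst x s e) = fv e - {x}"
  by (induction e) auto

lemma typed_ingredient: "typed e F G \<Longrightarrow> F \<lhd> G"
  by (induction rule: typed.induct) (auto intro: ingredient.intros)

lemma typed_subst: "typed e F G \<Longrightarrow> typed s G G \<Longrightarrow> typed (subst x s e) F G"
  by (induction rule: typed.induct) (auto intro: typed.intros)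

lemma typed_FId: "typed e FId G \<Longrightarrow> typed e G G"
proof -
  have "typed e F G \<Longrightarrow> F = FId \<Longrightarrow> typed e G G" for F
    by (induction rule: typed.induct) (auto intro: typed.intros ingr_refl)
  then show "typed e FId G \<Longrightarrow> typed e G G" by blast
qed

lemma typed_EPlus: "typed (EPlus e1 e2) F G \<longleftrightarrow> typed e1 F G \<and> typed e2 F G"
proof
  show "typed (EPlus e1 e2) F G \<Longrightarrow> typed e1 F G \<and> typed e2 F G"
    by (induction "EPlus e1 e2" F G rule: typed.induct) (auto intro: typed.intros)
qed (auto intro: typed.intros)

lemma typed_EMu: "typed (EMu x e) F G \<Longrightarrow> typed e G G \<and> (F = G \<or> F = FId)"
  by (induction "EMu x e" F G rule: typed.induct) auto

lemma Exps_FId: "e \<in> Exps FId G \<Longrightarrow> e \<in> Exp G"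
  by (auto simp: Exps_def typed_FId)

lemma Exps_ingredient: "e \<in> Exps F G \<Longrightarrow> F \<lhd> G"
  by (auto simp: Exps_def typed_ingredient)

lemma EEmpty_in_Exps [simp]: "F \<lhd> G \<Longrightarrow> EEmpty \<in> Exps F G"
  by (auto simp: Exps_def intro: typed.intros)

lemma EPlus_in_Exps [simp]: "EPlus e1 e2 \<in> Exps F G \<longleftrightarrow> e1 \<in> Exps F G \<and> e2 \<in> Exps F G"
  by (auto simp: Exps_def typed_EPlus)

lemma EMu_in_Exps:
  assumes "EMu x e \<in> Exps F G" "F \<noteq> FId"
  shows "F = G" "is_guarded e" "subst x (EMu x e) e \<in> Exp G"
proof -
  have t: "typed e G G" "F = G" using assms typed_EMu[of x e F G] by (auto simp: Exps_def)
  with assms show "F = G" "is_guarded e" "subst x (EMu x e) e \<in> Exp G"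
    by (auto simp: Exps_def fv_subst is_exp_subst intro: typed_subst is_exp_is_guarded.intros(3))
qed

lemma ELat_in_Exps: "ELat b \<in> Exps F G \<Longrightarrow> F \<noteq> FId \<Longrightarrow> \<exists>B. F = FLat B \<and> b \<in> jcarrier B"
  by (auto simp: Exps_def elim: typed.cases)

lemma EVar_notin_Exps: "EVar x \<notin> Exps F G"
  by (auto simp: Exps_def)

lemma EProdL_in_Exps: "EProdL e \<in> Exps F G \<Longrightarrow> F \<noteq> FId \<Longrightarrow> \<exists>F1 F2. F = FProd F1 F2 \<and> e \<in> Exps F1 G"
  by (auto simp: Exps_def elim: typed.cases)

lemma EProdR_in_Exps: "EProdR e \<in> Exps F G \<Longrightarrow> F \<noteq> FId \<Longrightarrow> \<exists>F1 F2. F = FProd F1 F2 \<and> e \<in> Exps F2 G"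
  by (auto simp: Exps_def elim: typed.cases)

lemma ESumL_in_Exps: "ESumL e \<in> Exps F G \<Longrightarrow> F \<noteq> FId \<Longrightarrow> \<exists>F1 F2. F = FSum F1 F2 \<and> e \<in> Exps F1 G"
  by (auto simp: Exps_def elim: typed.cases)

lemma ESumR_in_Exps: "ESumR e \<in> Exps F G \<Longrightarrow> F \<noteq> FId \<Longrightarrow> \<exists>F1 F2. F = FSum F1 F2 \<and> e \<in> Exps F2 G"
  by (auto simp: Exps_def elim: typed.cases)

lemma EAct_in_Exps:
  "EAct a e \<in> Exps F G \<Longrightarrow> F \<noteq> FId \<Longrightarrow> \<exists>F' A. F = FExp F' A \<and> a \<in> A \<and> e \<in> Exps F' G"
  by (auto simp: Exps_def elim: typed.cases)

lemma ESing_in_Exps: "ESing e \<in> Exps F G \<Longrightarrow> F \<noteq> FId \<Longrightarrow> \<exists>F'. F = FPow F' \<and> e \<in> Exps F' G"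
  by (auto simp: Exps_def elim: typed.cases)

lemma Exps_induct [consumes 1, case_names Id Empty Plus Mu Lat ProdL ProdR SumL SumR Act Sing]:
  assumes "e \<in> Exps F G"
    and "\<And>e. e \<in> Exps FId G \<Longrightarrow> P FId e"
    and "\<And>F. F \<noteq> FId \<Longrightarrow> F \<lhd> G \<Longrightarrow> P F EEmpty"
    and "\<And>F e1 e2. F \<noteq> FId \<Longrightarrow> e1 \<in> Exps F G \<Longrightarrow> e2 \<in> Exps F G \<Longrightarrow> P F e1 \<Longrightarrow> P F e2 \<Longrightarrow>
      P F (EPlus e1 e2)"
    and "\<And>x e. G \<noteq> FId \<Longrightarrow> EMu x e \<in> Exp G \<Longrightarrow> is_guarded e \<Longrightarrow> subst x (EMu x e) e \<in> Exp G \<Longrightarrow>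
      P G (subst x (EMu x e) e) \<Longrightarrow> P G (EMu x e)"
    and "\<And>B b. ELat b \<in> Exps (FLat B) G \<Longrightarrow> b \<in> jcarrier B \<Longrightarrow> P (FLat B) (ELat b)"
    and "\<And>F1 F2 e. EProdL e \<in> Exps (FProd F1 F2) G \<Longrightarrow> e \<in> Exps F1 G \<Longrightarrow> P F1 e \<Longrightarrow> P (FProd F1 F2) (EProdL e)"
    and "\<And>F1 F2 e. EProdR e \<in> Exps (FProd F1 F2) G \<Longrightarrow> e \<in> Exps F2 G \<Longrightarrow> P F2 e \<Longrightarrow> P (FProd F1 F2) (EProdR e)"
    and "\<And>F1 F2 e. ESumL e \<in> Exps (FSum F1 F2) G \<Longrightarrow> e \<in> Exps F1 G \<Longrightarrow> P F1 e \<Longrightarrow> P (FSum F1 F2) (ESumL e)"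
    and "\<And>F1 F2 e. ESumR e \<in> Exps (FSum F1 F2) G \<Longrightarrow> e \<in> Exps F2 G \<Longrightarrow> P F2 e \<Longrightarrow> P (FSum F1 F2) (ESumR e)"
    and "\<And>F A a e. EAct a e \<in> Exps (FExp F A) G \<Longrightarrow> a \<in> A \<Longrightarrow> e \<in> Exps F G \<Longrightarrow> P F e \<Longrightarrow> P (FExp F A) (EAct a e)"
    and "\<And>F e. ESing e \<in> Exps (FPow F) G \<Longrightarrow> e \<in> Exps F G \<Longrightarrow> P F e \<Longrightarrow> P (FPow F) (ESing e)"
  shows "P F e"
proof -
  have "\<forall>F e. p = (F, e) \<longrightarrow> e \<in> Exps F G \<longrightarrow> P F e" for p
  proof (induction p rule: wf_induct[OF wf_measures[of "[\<lambda>(F, e). size F, \<lambda>(F, e). mu_height e]"]])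
    case (1 p)
    have IH: "P F' e'" if "e' \<in> Exps F' G" "p = (F, e)"
      "size F' < size F \<or> size F' = size F \<and> mu_height e' < mu_height e" for F e F' e'
      using 1 that by auto
    show ?case
    proof (intro allI impI)
      fix F e assume p: "p = (F, e)" and e: "e \<in> Exps F G"
      show "P F e"
      proof (cases "F = FId")
        case True with assms(2) e show ?thesis by simp
      next
        case F: False
        show ?thesis
        proof (cases e)
          case (EVar x) with e show ?thesis by (simp add: EVar_notin_Exps)
        next
          case EEmpty with assms(3) F Exps_ingredient[OF e] show ?thesis by simp
        next
          case (EPlus e1 e2) with assms(4)[OF F, of e1 e2] IH[OF _ p, of e1 F] IH[OF _ p, of e2 F] e
          show ?thesis by auto
        next
          case (EMu x e')
          with assms(5)[of x e'] EMu_in_Exps[of x e' F G] e F IH[OF _ p, of "subst x (EMu x e') e'" F]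
          show ?thesis by (auto simp: mu_height_subst)
        next
          case (ELat b)
          with ELat_in_Exps[of b F G] e F obtain B where "F = FLat B" "b \<in> jcarrier B" by auto
          with assms(6)[of b B] e ELat show ?thesis by simp
        next
          case (EProdL e')
          with EProdL_in_Exps[of e' F G] e F obtain F1 F2 where "F = FProd F1 F2" "e' \<in> Exps F1 G" by auto
          with assms(7)[of e' F1 F2] IH[OF _ p, of e' F1] e EProdL show ?thesis by simp
        next
          case (EProdR e')
          with EProdR_in_Exps[of e' F G] e F obtain F1 F2 where "F = FProd F1 F2" "e' \<in> Exps F2 G" by auto
          with assms(8)[of e' F1 F2] IH[OF _ p, of e' F2] e EProdR show ?thesis by simp
        next
          case (ESumL e')
          with ESumL_in_Exps[of e' F G] e F obtain F1 F2 where "F = FSum F1 F2" "e' \<in> Exps F1 G" by auto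
          with assms(9)[of e' F1 F2] IH[OF _ p, of e' F1] e ESumL show ?thesis by simp
        next
          case (ESumR e')
          with ESumR_in_Exps[of e' F G] e F obtain F1 F2 where "F = FSum F1 F2" "e' \<in> Exps F2 G" by auto
          with assms(10)[of e' F1 F2] IH[OF _ p, of e' F2] e ESumR show ?thesis by simp
        next
          case (EAct a e')
          with EAct_in_Exps[of a e' F G] e F obtain F' A where "F = FExp F' A" "a \<in> A" "e' \<in> Exps F' G" by auto
          with assms(11)[of a e' F' A] IH[OF _ p, of e' F'] e EAct show ?thesis by simp
        next
          case (ESing e')
          with ESing_in_Exps[of e' F G] e F obtain F' where "F = FPow F'" "e' \<in> Exps F' G" by auto
          with assms(12)[of e' F'] IH[OF _ p, of e' F'] e ESing show ?thesis by simp
        qed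
      qed
    qed
  qed
  with assms(1) show ?thesis by blast
qed

lemma delta_simps [simp]:
  "delta G FId e = VId e"
  "F \<noteq> FId \<Longrightarrow> delta G F EEmpty = empty_val F"
  "F \<noteq> FId \<Longrightarrow> delta G F (EPlus e1 e2) = plus_val F (delta G F e1) (delta G F e2)"
  "G \<noteq> FId \<Longrightarrow> is_guarded e \<Longrightarrow> delta G G (EMu x e) = delta G G (subst x (EMu x e) e)"
  "delta G (FLat B) (ELat b) = VLat b"
  "delta G (FProd F1 F2) (EProdL e) = VPair (delta G F1 e) (empty_val F2)"
  "delta G (FProd F1 F2) (EProdR e) = VPair (empty_val F1) (delta G F2 e)"
  "delta G (FSum F1 F2) (ESumL e) = VK1 (delta G F1 e)"
  "delta G (FSum F1 F2) (ESumR e) = VK2 (delta G F2 e)"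
  "delta G (FExp F A) (EAct a e) =
     VFun (\<lambda>a'. if a' \<in> A then Some (if a' = a then delta G F e else empty_val F) else None)"
  "delta G (FPow F) (ESing e) = VSet {|delta G F e|}"
  by (subst delta.simps, simp)+

lemma nd_functor_ingredient: "F \<lhd> G \<Longrightarrow> nd_functor G \<Longrightarrow> nd_functor F"
  by (induction rule: ingredient.induct) auto

lemma ingredient_sub:
  "FSum F1 F2 \<lhd> G \<Longrightarrow> F1 \<lhd> G" "FSum F1 F2 \<lhd> G \<Longrightarrow> F2 \<lhd> G"
  "FProd F1 F2 \<lhd> G \<Longrightarrow> F1 \<lhd> G" "FProd F1 F2 \<lhd> G \<Longrightarrow> F2 \<lhd> G"
  "FExp F A \<lhd> G \<Longrightarrow> F \<lhd> G" "FPow F \<lhd> G \<Longrightarrow> F \<lhd> G"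
  by (blast intro: ingredient.intros)+

section \<open>The operations on values\<close>

lemma rlift_empty_val: "nd_functor F \<Longrightarrow> (EEmpty, EEmpty) \<in> R \<Longrightarrow> rlift F R (empty_val F) (empty_val F)"
  by (induction F) (auto simp: finite_jsl_def)

lemma rlift_plus_val:
  assumes "\<And>x x' y y'. (x, x') \<in> R \<Longrightarrow> (y, y') \<in> R \<Longrightarrow> (EPlus x y, EPlus x' y') \<in> R"
  shows "nd_functor F \<Longrightarrow> rlift F R u u' \<Longrightarrow> rlift F R v v' \<Longrightarrow>
    rlift F R (plus_val F u v) (plus_val F u' v')"
proof (induction F arbitrary: u u' v v')
  case (FExp F A)
  from FExp.prems(2) obtain f f' where f: "u = VFun f" "u' = VFun f'"
    and "\<And>a. a \<in> A \<Longrightarrow> \<exists>x y. f a = Some x \<and> f' a = Some y \<and> rlift F R x y" by auto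
  moreover from FExp.prems(3) obtain g g' where g: "v = VFun g" "v' = VFun g'"
    and "\<And>a. a \<in> A \<Longrightarrow> \<exists>x y. g a = Some x \<and> g' a = Some y \<and> rlift F R x y" by auto
  ultimately have "rlift F R (plus_val F (the (f a)) (the (g a))) (plus_val F (the (f' a)) (the (g' a)))"
    if "a \<in> A" for a using that FExp.IH FExp.prems(1) by fastforce
  then show ?case by (simp add: f g)
next
  case (FPow F)
  then show ?case by (fastforce)
qed (auto simp: assms finite_jsl_def)

lemma rlift_plus_val_comm:
  assumes "Id_on X \<subseteq> R" "\<And>x y. x \<in> X \<Longrightarrow> y \<in> X \<Longrightarrow> (EPlus x y, EPlus y x) \<in> R"
  shows "nd_functor F \<Longrightarrow> rlift F (Id_on X) u u \<Longrightarrow> rlift F (Id_on X) v v \<Longrightarrow>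
    rlift F R (plus_val F u v) (plus_val F v u)"
proof (induction F arbitrary: u v)
  case (FSum F1 F2)
  then show ?case by (auto simp: rlift_mono[OF _ assms(1)])
next
  case (FExp F A)
  from FExp.prems(2) obtain f where f: "u = VFun f"
    and "\<And>a. a \<in> A \<Longrightarrow> \<exists>x. f a = Some x \<and> rlift F (Id_on X) x x" by fastforce
  moreover from FExp.prems(3) obtain g where g: "v = VFun g"
    and "\<And>a. a \<in> A \<Longrightarrow> \<exists>x. g a = Some x \<and> rlift F (Id_on X) x x" by fastforce
  ultimately have "rlift F R (plus_val F (the (f a)) (the (g a))) (plus_val F (the (g a)) (the (f a)))"
    if "a \<in> A" for a using that FExp.IH FExp.prems(1) by fastforce
  then show ?case by (simp add: f g)
next
  case (FPow F)
  then obtain U V where "u = VSet U" "v = VSet V" by auto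
  moreover from calculation have "rlift (FPow F) (Id_on X) (VSet (U |\<union>| V)) (VSet (U |\<union>| V))"
    using FPow.prems by simp meson
  ultimately show ?case using rlift_mono[OF _ assms(1)] by (simp add: funion_commute del: rlift.simps)
qed (auto simp: assms finite_jsl_def)

lemma rlift_plus_val_assoc:
  assumes "Id_on X \<subseteq> R"
    "\<And>x y z. x \<in> X \<Longrightarrow> y \<in> X \<Longrightarrow> z \<in> X \<Longrightarrow> (EPlus (EPlus x y) z, EPlus x (EPlus y z)) \<in> R"
    "\<And>x y. x \<in> X \<Longrightarrow> y \<in> X \<Longrightarrow> EPlus x y \<in> X"
  shows "nd_functor F \<Longrightarrow> rlift F (Id_on X) u u \<Longrightarrow> rlift F (Id_on X) v v \<Longrightarrow> rlift F (Id_on X) w w \<Longrightarrow>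
    rlift F R (plus_val F (plus_val F u v) w) (plus_val F u (plus_val F v w))"
proof (induction F arbitrary: u v w)
  case (FSum F1 F2)
  have "(x, x') \<in> Id_on X \<Longrightarrow> (y, y') \<in> Id_on X \<Longrightarrow> (EPlus x y, EPlus x' y') \<in> Id_on X" for x x' y y'
    using assms(3) by auto
  note pl = rlift_plus_val[of "Id_on X", OF this]
  have *: "rlift F1 R (plus_val F1 x y) (plus_val F1 x y)"
    if "rlift F1 (Id_on X) x x" "rlift F1 (Id_on X) y y" for x y
    using that FSum.prems(1) by (intro rlift_mono[OF pl assms(1)]) auto
  have **: "rlift F2 R (plus_val F2 x y) (plus_val F2 x y)"
    if "rlift F2 (Id_on X) x x" "rlift F2 (Id_on X) y y" for x y
    using that FSum.prems(1) by (intro rlift_mono[OF pl assms(1)]) auto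
  have "u = VBot \<or> u = VTop \<or> (\<exists>u'. u = VK1 u' \<and> rlift F1 (Id_on X) u' u') \<or>
      (\<exists>u'. u = VK2 u' \<and> rlift F2 (Id_on X) u' u')"
    if "rlift (FSum F1 F2) (Id_on X) u u" for u
    using that by auto
  from FSum.prems(1) this[OF FSum.prems(2)] this[OF FSum.prems(3)] this[OF FSum.prems(4)]
  show ?case by (elim disjE exE conjE) (simp_all add: FSum.IH * ** rlift_mono[OF _ assms(1)])
next
  case (FExp F A)
  from FExp.prems(2) obtain f where f: "u = VFun f"
    and "\<And>a. a \<in> A \<Longrightarrow> \<exists>x. f a = Some x \<and> rlift F (Id_on X) x x" by fastforce
  moreover from FExp.prems(3) obtain g where g: "v = VFun g"
    and "\<And>a. a \<in> A \<Longrightarrow> \<exists>x. g a = Some x \<and> rlift F (Id_on X) x x" by fastforce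
  moreover from FExp.prems(4) obtain h where h: "w = VFun h"
    and "\<And>a. a \<in> A \<Longrightarrow> \<exists>x. h a = Some x \<and> rlift F (Id_on X) x x" by fastforce
  ultimately have "rlift F R (plus_val F (plus_val F (the (f a)) (the (g a))) (the (h a)))
      (plus_val F (the (f a)) (plus_val F (the (g a)) (the (h a))))"
    if "a \<in> A" for a using that FExp.IH FExp.prems(1) by fastforce
  then show ?case by (simp add: f g h)
next
  case (FPow F)
  then obtain U V W where "u = VSet U" "v = VSet V" "w = VSet W" by auto
  moreover from calculation have "rlift (FPow F) (Id_on X) (VSet (U |\<union>| V |\<union>| W)) (VSet (U |\<union>| V |\<union>| W))"
    using FPow.prems by simp meson
  ultimately show ?case using rlift_mono[OF _ assms(1)] by (simp add: funion_assoc del: rlift.simps)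
qed (auto simp: assms finite_jsl_def)

lemma rlift_plus_val_idem:
  assumes "Id_on X \<subseteq> R" "\<And>x. x \<in> X \<Longrightarrow> (EPlus x x, x) \<in> R"
  shows "nd_functor F \<Longrightarrow> rlift F (Id_on X) u u \<Longrightarrow> rlift F R (plus_val F u u) u"
proof (induction F arbitrary: u)
  case (FExp F A)
  from FExp.prems(2) obtain f where f: "u = VFun f"
    and "\<And>a. a \<in> A \<Longrightarrow> \<exists>x. f a = Some x \<and> rlift F (Id_on X) x x" by fastforce
  then have "\<exists>x. f a = Some x \<and> rlift F R (plus_val F (the (f a)) (the (f a))) x"
    if "a \<in> A" for a using that FExp.IH FExp.prems(1) by fastforce
  then show ?case by (simp add: f)
next
  case (FPow F)
  then obtain U where "u = VSet U" by auto
  then show ?case using rlift_mono[OF FPow.prems(2) assms(1)] by (simp del: rlift.simps)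
qed (auto simp: assms finite_jsl_def)

section \<open>The congruence\<close>

lemma aci_is_exp: "aci e e' \<Longrightarrow> (is_exp e \<longleftrightarrow> is_exp e') \<and> (is_guarded e \<longleftrightarrow> is_guarded e')"
  by (induction rule: aci.induct) auto

lemma aci_fv: "aci e e' \<Longrightarrow> fv e = fv e'"
  by (induction rule: aci.induct) auto

lemma typed_cong:
  assumes "\<And>F G. typed e F G \<Longrightarrow> typed e' F G"
  shows "typed (EMu x e) F G \<Longrightarrow> typed (EMu x e') F G"
    and "typed (EProdL e) F G \<Longrightarrow> typed (EProdL e') F G"
    and "typed (EProdR e) F G \<Longrightarrow> typed (EProdR e') F G"
    and "typed (ESumL e) F G \<Longrightarrow> typed (ESumL e') F G"
    and "typed (ESumR e) F G \<Longrightarrow> typed (ESumR e') F G"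
    and "typed (EAct a e) F G \<Longrightarrow> typed (EAct a e') F G"
    and "typed (ESing e) F G \<Longrightarrow> typed (ESing e') F G"
  subgoal by (induction "EMu x e" F G rule: typed.induct) (auto intro: typed.intros assms)
  subgoal by (induction "EProdL e" F G rule: typed.induct) (auto intro: typed.intros assms)
  subgoal by (induction "EProdR e" F G rule: typed.induct) (auto intro: typed.intros assms)
  subgoal by (induction "ESumL e" F G rule: typed.induct) (auto intro: typed.intros assms)
  subgoal by (induction "ESumR e" F G rule: typed.induct) (auto intro: typed.intros assms)
  subgoal by (induction "EAct a e" F G rule: typed.induct) (auto intro: typed.intros assms)
  subgoal by (induction "ESing e" F G rule: typed.induct) (auto intro: typed.intros assms)
  done

lemma aci_typed: "aci e e' \<Longrightarrow> typed e F G \<longleftrightarrow> typed e' F G"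
proof (induction arbitrary: F G rule: aci.induct)
  case (aci_mu e e' x) then show ?case using typed_cong(1)[of e e'] typed_cong(1)[of e' e] by blast
next
  case (aci_prodl e e') then show ?case using typed_cong(2)[of e e'] typed_cong(2)[of e' e] by blast
next
  case (aci_prodr e e') then show ?case using typed_cong(3)[of e e'] typed_cong(3)[of e' e] by blast
next
  case (aci_suml e e') then show ?case using typed_cong(4)[of e e'] typed_cong(4)[of e' e] by blast
next
  case (aci_sumr e e') then show ?case using typed_cong(5)[of e e'] typed_cong(5)[of e' e] by blast
next
  case (aci_act e e' a) then show ?case using typed_cong(6)[of e e'] typed_cong(6)[of e' e] by blast
next
  case (aci_sing e e') then show ?case using typed_cong(7)[of e e'] typed_cong(7)[of e' e] by blast
qed (auto simp: typed_EPlus)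

lemma aci_Exps: "aci e e' \<Longrightarrow> e \<in> Exps F G \<longleftrightarrow> e' \<in> Exps F G"
  unfolding Exps_def mem_Collect_eq by (metis aci_is_exp aci_fv aci_typed)

lemma aci_subst_same: "aci s s' \<Longrightarrow> aci (subst x s e) (subst x s' e)"
  by (induction e) (auto intro: aci.intros)

lemma aci_subst: "aci e e' \<Longrightarrow> aci s s' \<Longrightarrow> aci (subst x s e) (subst x s' e')"
proof -
  assume "aci s s'"
  assume "aci e e'"
  then have "aci (subst x s e) (subst x s e')"
    by (induction rule: aci.induct) (auto intro: aci.intros)
  then show ?thesis using aci_subst_same[OF \<open>aci s s'\<close>] aci_trans by blast
qed

text \<open>Unlike \<open>mu_height\<close>, the nesting depth of \<open>\<mu>\<close> is invariant under idempotence, so that it can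
  serve as an induction measure for statements about equivalence classes.\<close>

primrec mu_depth :: "('a, 'b) exp \<Rightarrow> nat" where
  "mu_depth (EVar x) = 0"
| "mu_depth EEmpty = 0"
| "mu_depth (EPlus e1 e2) = max (mu_depth e1) (mu_depth e2)"
| "mu_depth (EMu x e) = Suc (mu_depth e)"
| "mu_depth (ELat b) = 0"
| "mu_depth (EProdL e) = 0"
| "mu_depth (EProdR e) = 0"
| "mu_depth (ESumL e) = 0"
| "mu_depth (ESumR e) = 0"
| "mu_depth (EAct a e) = 0"
| "mu_depth (ESing e) = 0"

lemma aci_mu_depth: "aci e e' \<Longrightarrow> mu_depth e = mu_depth e'"
  by (induction rule: aci.induct) auto

lemma mu_depth_subst: "is_guarded e \<Longrightarrow> mu_depth (subst x s e) = mu_depth e"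
  by (induction e) auto

definition aci_rel :: "('a, 'b) ndf \<Rightarrow> (('a, 'b) exp \<times> ('a, 'b) exp) set" where
  "aci_rel G = {(e, e'). e \<in> Exp G \<and> e' \<in> Exp G \<and> aci e e'}"

lemma Id_on_aci_rel: "Id_on (Exp G) \<subseteq> aci_rel G"
  by (auto simp: aci_rel_def aci_refl)

lemma aci_rel_converse: "(aci_rel G)\<inverse> = aci_rel G"
  by (auto simp: aci_rel_def aci_sym)

lemma aci_rel_comp: "aci_rel G O aci_rel G = aci_rel G"
  by (auto simp: aci_rel_def intro: aci_trans aci_refl)

primrec decomps :: "('a, 'b) exp \<Rightarrow> ('a, 'b) exp set" where
  "decomps (EVar x) = {}"
| "decomps EEmpty = {}"
| "decomps (EPlus e1 e2) = {e1, e2}"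
| "decomps (EMu x e) = {subst x (EMu x e) e}"
| "decomps (ELat b) = {}"
| "decomps (EProdL e) = {e}"
| "decomps (EProdR e) = {e}"
| "decomps (ESumL e) = {e}"
| "decomps (ESumR e) = {e}"
| "decomps (EAct a e) = {e}"
| "decomps (ESing e) = {e}"

definition decomp_closed :: "('a, 'b) exp set \<Rightarrow> bool" where
  "decomp_closed C \<longleftrightarrow> (\<forall>e\<in>C. decomps e \<subseteq> C)"

lemma decomp_closedD:
  assumes "decomp_closed C"
  shows "EPlus e1 e2 \<in> C \<Longrightarrow> e1 \<in> C" "EPlus e1 e2 \<in> C \<Longrightarrow> e2 \<in> C"
    "EMu x e \<in> C \<Longrightarrow> subst x (EMu x e) e \<in> C"
    "EProdL e \<in> C \<Longrightarrow> e \<in> C" "EProdR e \<in> C \<Longrightarrow> e \<in> C" "ESumL e \<in> C \<Longrightarrow> e \<in> C"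
    "ESumR e \<in> C \<Longrightarrow> e \<in> C" "EAct a e \<in> C \<Longrightarrow> e \<in> C" "ESing e \<in> C \<Longrightarrow> e \<in> C"
  using assms unfolding decomp_closed_def by fastforce+

lemma rlift_delta_closed:
  assumes "e \<in> Exps F G" "e \<in> C" and G: "nd_functor G" and C: "decomp_closed C" "EEmpty \<in> C"
    and plus: "\<And>e1 e2. e1 \<in> C \<Longrightarrow> e2 \<in> C \<Longrightarrow> EPlus e1 e2 \<in> C"
  shows "rlift F (Id_on (C \<inter> Exp G)) (delta G F e) (delta G F e)"
proof -
  have emp: "rlift F (Id_on (C \<inter> Exp G)) (empty_val F) (empty_val F)" if "F \<lhd> G" for F
    by (intro rlift_empty_val nd_functor_ingredient[OF that G]) (auto simp: C(2) ingr_refl)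
  from assms(1,2) show ?thesis
  proof (induction rule: Exps_induct)
    case (Id e) then show ?case using Exps_FId by auto
  next
    case (Empty F) then show ?case using emp by simp
  next
    case (Plus F e1 e2)
    have "nd_functor F" using Plus(2) Exps_ingredient nd_functor_ingredient G by blast
    moreover have "e1 \<in> C" "e2 \<in> C" using decomp_closedD(1,2)[OF C(1) Plus.prems] .
    ultimately show ?case unfolding delta_simps(3)[OF Plus(1)]
      by (intro rlift_plus_val) (auto simp: plus Plus.IH)
  next
    case (Mu x e)
    then have "subst x (EMu x e) e \<in> C" using decomp_closedD(3)[OF C(1)] by blast
    then show ?case using Mu by simp
  next
    case (Lat B b) then show ?case by simp
  next
    case (ProdL F1 F2 e)
    have "e \<in> C" using decomp_closedD(4)[OF C(1) ProdL.prems] .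
    moreover have "F2 \<lhd> G" using ingredient_sub(4)[OF Exps_ingredient[OF ProdL(1)]] .
    ultimately show ?case using ProdL emp by simp
  next
    case (ProdR F1 F2 e)
    have "e \<in> C" using decomp_closedD(5)[OF C(1) ProdR.prems] .
    moreover have "F1 \<lhd> G" using ingredient_sub(3)[OF Exps_ingredient[OF ProdR(1)]] .
    ultimately show ?case using ProdR emp by simp
  next
    case (SumL F1 F2 e)
    have "e \<in> C" using decomp_closedD(6)[OF C(1) SumL.prems] .
    then show ?case using SumL by simp
  next
    case (SumR F1 F2 e)
    have "e \<in> C" using decomp_closedD(7)[OF C(1) SumR.prems] .
    then show ?case using SumR by simp
  next
    case (Act F A a e)
    have "e \<in> C" using decomp_closedD(8)[OF C(1) Act.prems] .
    moreover have "F \<lhd> G" using ingredient_sub(5)[OF Exps_ingredient[OF Act(1)]] .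
    ultimately show ?case using Act emp by simp
  next
    case (Sing F e)
    have "e \<in> C" using decomp_closedD(9)[OF C(1) Sing.prems] .
    then show ?case using Sing by simp
  qed
qed

lemma rlift_delta_refl:
  "e \<in> Exps F G \<Longrightarrow> nd_functor G \<Longrightarrow> rlift F (Id_on (Exp G)) (delta G F e) (delta G F e)"
  using rlift_delta_closed[of e F G UNIV] by (auto simp: decomp_closed_def)

lemma empty_val_fobj: "nd_functor F \<Longrightarrow> EEmpty \<in> X \<Longrightarrow> empty_val F \<in> fobj F X"
  by (induction F) (auto simp: finite_jsl_def ran_def split: if_splits)

lemma plus_val_fobj:
  assumes "\<And>x y. x \<in> X \<Longrightarrow> y \<in> X \<Longrightarrow> EPlus x y \<in> X"
  shows "nd_functor F \<Longrightarrow> u \<in> fobj F X \<Longrightarrow> v \<in> fobj F X \<Longrightarrow> plus_val F u v \<in> fobj F X"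
proof (induction F arbitrary: u v)
  case (FExp F A)
  from FExp.prems(2) obtain f where f: "u = VFun f" "dom f = A" "ran f \<subseteq> fobj F X" by auto
  from FExp.prems(3) obtain g where g: "v = VFun g" "dom g = A" "ran g \<subseteq> fobj F X" by auto
  have "plus_val F (the (f a)) (the (g a)) \<in> fobj F X" if "a \<in> A" for a
  proof -
    from that f(2) g(2) obtain x y where "f a = Some x" "g a = Some y" by blast
    moreover from this f(3) g(3) have "x \<in> fobj F X" "y \<in> fobj F X" by (auto simp: ran_def)
    ultimately show ?thesis using FExp.IH FExp.prems(1) by simp
  qed
  then show ?case by (auto simp: f(1) g(1) ran_def split: if_splits)
qed (auto simp: assms finite_jsl_def)

lemma delta_fobj:
  assumes "e \<in> Exps F G" and G: "nd_functor G"
  shows "delta G F e \<in> fobj F (Exp G)"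
proof -
  have emp: "empty_val F \<in> fobj F (Exp G)" if "F \<lhd> G" for F
    using empty_val_fobj[OF nd_functor_ingredient[OF that G]] by (auto simp: ingr_refl)
  from assms(1) show ?thesis
  proof (induction rule: Exps_induct)
    case (Id e) then show ?case using Exps_FId by auto
  next
    case (Empty F) then show ?case using emp by simp
  next
    case (Plus F e1 e2)
    have "nd_functor F" using Plus(2) Exps_ingredient nd_functor_ingredient G by blast
    then show ?case using Plus plus_val_fobj[of "Exp G" F] by simp
  next
    case (ProdL F1 F2 e)
    then have "F2 \<lhd> G" using Exps_ingredient ingredient_sub by blast
    then show ?case using ProdL emp by simp
  next
    case (ProdR F1 F2 e)
    then have "F1 \<lhd> G" using Exps_ingredient ingredient_sub by blast
    then show ?case using ProdR emp by simp
  next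
    case (Act F A a e)
    then have "F \<lhd> G" using Exps_ingredient by blast
    then show ?case using Act emp by (auto simp: ran_def split: if_splits)
  qed simp_all
qed

lemma rlift_delta_aci:
  assumes G: "nd_functor G"
  shows "aci e e' \<Longrightarrow> e \<in> Exps F G \<Longrightarrow> rlift F (aci_rel G) (delta G F e) (delta G F e')"
proof -
  have "\<forall>F n. p = (F, n) \<longrightarrow> (\<forall>e e'. aci e e' \<longrightarrow> e \<in> Exps F G \<longrightarrow> mu_depth e \<le> n \<longrightarrow>
      rlift F (aci_rel G) (delta G F e) (delta G F e'))" for p :: "('a, 'b) ndf \<times> nat"
  proof (induction p rule: wf_induct[OF wf_measures[of "[\<lambda>(F, n). size F, \<lambda>(F, n). n]"]])
    case (1 p)
    show ?case
    proof (intro allI impI)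
      fix F n and e e' :: "('a, 'b) exp"
      assume p: "p = (F, n)" and "aci e e'" "e \<in> Exps F G" "mu_depth e \<le> n"
      have IH: "rlift F' (aci_rel G) (delta G F' d) (delta G F' d')"
        if "aci d d'" "d \<in> Exps F' G" "size F' < size F \<or> F' = F \<and> mu_depth d < n" for F' d d'
        using 1 that unfolding p by auto
      show "rlift F (aci_rel G) (delta G F e) (delta G F e')"
      proof (cases "F = FId")
        case True
        with \<open>aci e e'\<close> \<open>e \<in> Exps F G\<close> show ?thesis using aci_Exps Exps_FId by (fastforce simp: aci_rel_def)
      next
        case F: False
        have nF: "nd_functor F"
          using \<open>e \<in> Exps F G\<close> Exps_ingredient nd_functor_ingredient G by blast
        have emp: "rlift F' (aci_rel G) (empty_val F') (empty_val F')" if "F' \<lhd> G" for F'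
          by (intro rlift_empty_val nd_functor_ingredient[OF that G])
            (auto simp: ingr_refl aci_rel_def aci_refl)
        note refl = rlift_mono[OF rlift_delta_refl[OF _ G] Id_on_aci_rel]
        from \<open>aci e e'\<close> \<open>e \<in> Exps F G\<close> \<open>mu_depth e \<le> n\<close> show ?thesis
        proof (induction rule: aci.induct)
          case (aci_assoc e1 e2 e3)
          then show ?case unfolding delta_simps(3)[OF F]
            by (intro rlift_plus_val_assoc[OF Id_on_aci_rel] nF rlift_delta_refl[OF _ G])
              (auto simp: aci_rel_def intro: aci.aci_assoc)
        next
          case (aci_comm e1 e2)
          then show ?case unfolding delta_simps(3)[OF F]
            by (intro rlift_plus_val_comm[OF Id_on_aci_rel] nF rlift_delta_refl[OF _ G])
              (auto simp: aci_rel_def intro: aci.aci_comm)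
        next
          case (aci_idem e)
          then show ?case unfolding delta_simps(3)[OF F]
            by (intro rlift_plus_val_idem[OF Id_on_aci_rel] nF rlift_delta_refl[OF _ G])
              (auto simp: aci_rel_def intro: aci.aci_idem)
        next
          case (aci_refl e) then show ?case using refl by blast
        next
          case (aci_sym e e')
          then show ?case using aci_Exps aci_mu_depth rlift_sym[of F "aci_rel G"]
            unfolding aci_rel_converse by metis
        next
          case (aci_trans e e' e'')
          then show ?case using aci_Exps aci_mu_depth rlift_comp[of F "aci_rel G" _ _ "aci_rel G"]
            unfolding aci_rel_comp by metis
        next
          case (aci_plus e1 e1' e2 e2')
          then show ?case unfolding delta_simps(3)[OF F]
            by (intro rlift_plus_val nF) (auto simp: aci_rel_def intro: aci.aci_plus)
        next
          case (aci_mu e e' x)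
          from EMu_in_Exps[OF aci_mu.prems(1) F] have *: "F = G" "is_guarded e"
            "subst x (EMu x e) e \<in> Exp G" .
          have "aci (subst x (EMu x e) e) (subst x (EMu x e') e')"
            using aci_mu.hyps aci_subst aci.aci_mu by blast
          moreover have "is_guarded e'" using * aci_mu.hyps aci_is_exp by blast
          ultimately show ?case using * F IH[of "subst x (EMu x e) e" _ F] aci_mu.prems(2)
            by (simp add: mu_depth_subst)
        next
          case (aci_prodl e e')
          then obtain F1 F2 where "F = FProd F1 F2" "e \<in> Exps F1 G" "F2 \<lhd> G"
            using EProdL_in_Exps F Exps_ingredient ingredient_sub by metis
          then show ?case using IH aci_prodl.hyps emp by simp
        next
          case (aci_prodr e e')
          then obtain F1 F2 where "F = FProd F1 F2" "e \<in> Exps F2 G" "F1 \<lhd> G"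
            using EProdR_in_Exps F Exps_ingredient ingredient_sub by metis
          then show ?case using IH aci_prodr.hyps emp by simp
        next
          case (aci_suml e e')
          then obtain F1 F2 where "F = FSum F1 F2" "e \<in> Exps F1 G"
            using ESumL_in_Exps F by metis
          then show ?case using IH aci_suml.hyps by simp
        next
          case (aci_sumr e e')
          then obtain F1 F2 where "F = FSum F1 F2" "e \<in> Exps F2 G"
            using ESumR_in_Exps F by metis
          then show ?case using IH aci_sumr.hyps by simp
        next
          case (aci_act e e' a)
          then obtain F' A where "F = FExp F' A" "e \<in> Exps F' G" "F' \<lhd> G"
            using EAct_in_Exps F Exps_ingredient ingredient_sub by metis
          then show ?case using IH aci_act.hyps emp by simp
        next
          case (aci_sing e e')
          then obtain F' where "F = FPow F'" "e \<in> Exps F' G"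
            using ESing_in_Exps F by metis
          then show ?case using IH aci_sing.hyps by simp
        qed
      qed
    qed
  qed
  from this[of "(F, mu_depth e)"]
  show "aci e e' \<Longrightarrow> e \<in> Exps F G \<Longrightarrow> rlift F (aci_rel G) (delta G F e) (delta G F e')" by simp
qed

section \<open>Bisimilarity\<close>

lemma bisimulation_iff:
  assumes "nd_functor G"
  shows "bisimulation G (Exp G) (delta G G) R \<longleftrightarrow>
    R \<subseteq> Exp G \<times> Exp G \<and> (\<forall>(s, t)\<in>R. rlift G R (delta G G s) (delta G G t))"
proof -
  have "(delta G G s, delta G G t) \<in> flift G R \<longleftrightarrow> rlift G R (delta G G s) (delta G G t)"
    if "R \<subseteq> Exp G \<times> Exp G" "(s, t) \<in> R" for s t
  proof
    from that have "s \<in> Exp G" "t \<in> Exp G" by blast+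
    then show "(delta G G s, delta G G t) \<in> flift G R"
      if "rlift G R (delta G G s) (delta G G t)"
      using rlift_imp_flift[OF that] delta_fobj[OF _ assms] by blast
  qed (rule flift_imp_rlift)
  then show ?thesis unfolding bisimulation_def by auto
qed

definition bisimilarity :: "('a, 'b) ndf \<Rightarrow> (('a, 'b) exp \<times> ('a, 'b) exp) set" where
  "bisimilarity G = {(s, t). exp_bisimilar G s t}"

context
  fixes G :: "('a, 'b) ndf"
  assumes G: "nd_functor G"
begin

lemma bisimilarityI:
  assumes "R \<subseteq> Exp G \<times> Exp G" "\<And>s t. (s, t) \<in> R \<Longrightarrow> rlift G R (delta G G s) (delta G G t)"
  shows "R \<subseteq> bisimilarity G"
  using assms bisimulation_iff[OF G, of R] unfolding bisimilarity_def bisimilar_def by blast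

lemma bisimilarity_Exp: "bisimilarity G \<subseteq> Exp G \<times> Exp G"
  unfolding bisimilarity_def bisimilar_def bisimulation_def by blast

lemma bisimilarity_delta:
  assumes "(s, t) \<in> bisimilarity G"
  shows "rlift G (bisimilarity G) (delta G G s) (delta G G t)"
proof -
  from assms obtain R where R: "bisimulation G (Exp G) (delta G G) R" "(s, t) \<in> R"
    unfolding bisimilarity_def bisimilar_def by blast
  then have "R \<subseteq> bisimilarity G" unfolding bisimilarity_def bisimilar_def by blast
  with R show ?thesis using bisimulation_iff[OF G, of R] rlift_mono[of G R] by blast
qed

lemma aci_rel_bisimilarity: "aci_rel G \<subseteq> bisimilarity G"
  by (rule bisimilarityI) (auto simp: aci_rel_def rlift_delta_aci[OF G, unfolded aci_rel_def])

lemma bisimilarity_comp: "bisimilarity G O bisimilarity G \<subseteq> bisimilarity G"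
proof (rule bisimilarityI)
  show "bisimilarity G O bisimilarity G \<subseteq> Exp G \<times> Exp G" using bisimilarity_Exp by blast
next
  fix s t assume "(s, t) \<in> bisimilarity G O bisimilarity G"
  then show "rlift G (bisimilarity G O bisimilarity G) (delta G G s) (delta G G t)"
    using bisimilarity_delta rlift_comp[of G "bisimilarity G" _ _ "bisimilarity G"] by blast
qed

end

section \<open>Terms\<close>

primrec den :: "('a, 'b) ndf \<Rightarrow> ('a, 'b) trm \<Rightarrow> ('a, 'b, ('a, 'b) exp) val" where
  "den G (TExp e) = VId e"
| "den G (TLat b) = VLat b"
| "den G (TPair t u) = VPair (den G t) (den G u)"
| "den G (TK1 t) = VK1 (den G t)"
| "den G (TK2 t) = VK2 (den G t)"
| "den G TBot = VBot"
| "den G TTop = VTop"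
| "den G (TLam a F t) = VFun (\<lambda>a'. Some (if a' = a then den G t else empty_val F))"
| "den G (TSet T) = VSet (den G |`| T)"
| "den G (TApp t a) = (case den G t of VFun f \<Rightarrow> the (f a))"
| "den G (TDelta F e) = delta G F e"
| "den G (TEmpty F) = empty_val F"
| "den G (TPlus F t u) = plus_val F (den G t) (den G u)"
| "den G (TSim t u) = (if den G t = den G u then VTop else VBot)"
| "den G TTrue = VTop"
| "den G TFalse = VBot"

primrec slift :: "('a, 'b) srt \<Rightarrow> ('x \<times> 'x) set \<Rightarrow> ('a, 'b, 'x) val \<Rightarrow> ('a, 'b, 'x) val \<Rightarrow> bool" where
  "slift (STy F) R u v \<longleftrightarrow> rlift F R u v"
| "slift SBool R u v \<longleftrightarrow> u = v"

lemma slift_mono: "slift s R u v \<Longrightarrow> R \<subseteq> R' \<Longrightarrow> slift s R' u v"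
  by (cases s) (auto intro: rlift_mono)

lemma slift_comp: "slift s R u v \<Longrightarrow> slift s R' v w \<Longrightarrow> slift s (R O R') u w"
  by (cases s) (auto intro: rlift_comp)

lemma slift_sym: "slift s R u v \<Longrightarrow> slift s (R\<inverse>) v u"
  by (cases s) (auto intro: rlift_sym)

inductive_cases wt_TExpE: "wt G (TExp e) s"
inductive_cases wt_TLatE: "wt G (TLat b) s"
inductive_cases wt_TPairE: "wt G (TPair t u) s"
inductive_cases wt_TK1E: "wt G (TK1 t) s"
inductive_cases wt_TK2E: "wt G (TK2 t) s"
inductive_cases wt_TSetE: "wt G (TSet T) s"
inductive_cases wt_TAppE: "wt G (TApp t a) s"
inductive_cases wt_TDeltaE: "wt G (TDelta F e) s"
inductive_cases wt_TEmptyE: "wt G (TEmpty F) s"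
inductive_cases wt_TPlusE: "wt G (TPlus F t u) s"

lemma wt_ingredient: "wt G t (STy F) \<Longrightarrow> F \<noteq> FId \<Longrightarrow> F \<lhd> G"
  by (induction t "STy F :: ('a, 'b) srt" rule: wt.induct) (auto intro: ingredient_sub)

context
  fixes G :: "('a, 'b) ndf"
  assumes G: "nd_functor G"
begin

lemma rlift_empty_val_Exp: "F \<lhd> G \<Longrightarrow> rlift F (Id_on (Exp G)) (empty_val F) (empty_val F)"
  by (intro rlift_empty_val nd_functor_ingredient[OF _ G]) (auto simp: ingr_refl)

lemma slift_den_refl: "wt G t s \<Longrightarrow> slift s (Id_on (Exp G)) (den G t) (den G t)"
proof (induction rule: wt.induct)
  case (8 F A a t)
  then show ?case using rlift_empty_val_Exp[OF ingredient_sub(5)[OF 8(1)]] by auto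
next
  case (9 F T)
  then show ?case by auto
next
  case (10 F A a t)
  then show ?case by auto
next
  case (11 F e)
  then show ?case using rlift_delta_refl[OF _ G] by simp
next
  case (12 F)
  then show ?case using rlift_empty_val_Exp by simp
next
  case (13 F t u)
  then show ?case unfolding slift.simps den.simps
    by (intro rlift_plus_val nd_functor_ingredient[OF _ G]) auto
qed auto

lemma slift_den_eq: "wt G t s \<Longrightarrow> den G t = den G u \<Longrightarrow> slift s (aci_rel G) (den G t) (den G u)"
  using slift_mono[OF slift_den_refl Id_on_aci_rel] by metis

lemma axm_sound:
  assumes "axm G t u" "wt G t s" "wt G u s"
  shows "slift s (aci_rel G) (den G t) (den G u)"
  using assms
proof cases
  case (ax_aci e e')
  then show ?thesis using assms by (auto elim!: wt_TExpE simp: aci_rel_def)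
next
  case (ax_delta_aci e e' F)
  then show ?thesis using assms rlift_delta_aci[OF G] by (auto elim!: wt_TDeltaE)
next
  case (ax_delta_mu x e)
  moreover from this assms have "EMu x e \<in> Exp G" by (auto elim!: wt_TDeltaE)
  ultimately show ?thesis using assms(2) EMu_in_Exps(2)[of x e G G]
    by (intro slift_den_eq) auto
next
  case (ax_delta_act F A a e)
  from assms(2) have *: "s = STy (FExp F A)" "EAct a e \<in> Exps (FExp F A) G" "FExp F A \<lhd> G"
    unfolding ax_delta_act by (auto elim!: wt_TDeltaE)
  have "e \<in> Exps F G" "F \<lhd> G" using EAct_in_Exps[OF *(2)] ingredient_sub(5)[OF *(3)] by auto
  then have "rlift F (aci_rel G) (delta G F e) (delta G F e)"
    "rlift F (aci_rel G) (empty_val F) (empty_val F)"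
    using rlift_mono[OF _ Id_on_aci_rel] rlift_delta_refl[OF _ G] rlift_empty_val_Exp by blast+
  then show ?thesis unfolding ax_delta_act * by simp
next
  case (ax_delta_empty F)
  then show ?thesis by (intro slift_den_eq assms) (cases "F = FId", auto)
next
  case (ax_delta_plus F e1 e2)
  then show ?thesis by (intro slift_den_eq assms) (cases "F = FId", auto)
next
  case (ax_empty_exp F A a)
  from assms(2) show ?thesis unfolding ax_empty_exp
    by (intro slift_den_eq) (auto elim!: wt_TAppE wt_TEmptyE)
next
  case (ax_plus_exp F A f g a)
  from assms(2) have *: "wt G f (STy (FExp F A))" "wt G g (STy (FExp F A))" "a \<in> A"
    unfolding ax_plus_exp by (auto elim!: wt_TAppE wt_TPlusE)
  from slift_den_refl[OF *(1)] slift_den_refl[OF *(2)] *(3) assms(2) show ?thesis unfolding ax_plus_exp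
    by (intro slift_den_eq) auto
next
  case (ax_plus_top1 F1 F2 t)
  then show ?thesis by (intro slift_den_eq assms) (auto split: val.split)
next
  case (ax_plus_top2 F1 F2 t)
  then show ?thesis by (intro slift_den_eq assms) (auto split: val.split)
next
  case (ax_plus_pow F T U)
  then show ?thesis by (intro slift_den_eq assms) (auto simp: fimage_funion)
qed ((rule slift_den_eq[OF assms(2)], simp)+)

lemma deduce_wt: "deduce G s t u \<Longrightarrow> wt G t s \<and> wt G u s"
proof (induction rule: deduce.induct)
  case (ded_set F T U)
  then show ?case by (meson wt.intros(9))
qed (auto intro: wt.intros)

lemma deduce_sound: "deduce G s t u \<Longrightarrow> slift s (aci_rel G) (den G t) (den G u)"
proof (induction rule: deduce.induct)
  case (ded_axm t u s) then show ?case by (rule axm_sound)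
next
  case (ded_refl t s) then show ?case using slift_den_eq by blast
next
  case (ded_sym s t u) then show ?case using slift_sym[of s "aci_rel G"] by (simp add: aci_rel_converse)
next
  case (ded_trans s t u v)
  then show ?case using slift_comp[of s "aci_rel G" _ _ "aci_rel G"] by (simp add: aci_rel_comp)
next
  case (ded_lam F A a t u)
  then show ?case
    using rlift_mono[OF rlift_empty_val_Exp[OF ingredient_sub(5)[OF ded_lam(1)]] Id_on_aci_rel] by auto
next
  case (ded_set F T U)
  then show ?case by fastforce
next
  case (ded_app F A a t u)
  then show ?case by auto
next
  case (ded_plus F t1 u1 t2 u2)
  then show ?case unfolding slift.simps den.simps
    by (intro rlift_plus_val nd_functor_ingredient[OF _ G]) (auto simp: aci_rel_def intro: aci_plus)
next
  case (ded_sim B t1 u1 t2 u2)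
  then show ?case by auto
qed auto

primrec canonical :: "('a, 'b) ndf \<Rightarrow> ('a, 'b) trm \<Rightarrow> bool" where
  "canonical FId t \<longleftrightarrow> (\<exists>e. deduce G (STy FId) t (TExp e))"
| "canonical (FLat B) t \<longleftrightarrow> (\<exists>b. deduce G (STy (FLat B)) t (TLat b))"
| "canonical (FSum F1 F2) t \<longleftrightarrow>
     deduce G (STy (FSum F1 F2)) t TBot \<or> deduce G (STy (FSum F1 F2)) t TTop \<or>
     (\<exists>t'. deduce G (STy (FSum F1 F2)) t (TK1 t') \<and> canonical F1 t') \<or>
     (\<exists>t'. deduce G (STy (FSum F1 F2)) t (TK2 t') \<and> canonical F2 t')"
| "canonical (FProd F1 F2) t \<longleftrightarrow>
     (\<exists>t1 t2. deduce G (STy (FProd F1 F2)) t (TPair t1 t2) \<and> canonical F1 t1 \<and> canonical F2 t2)"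
| "canonical (FExp F A) t \<longleftrightarrow> (\<forall>a\<in>A. canonical F (TApp t a))"
| "canonical (FPow F) t \<longleftrightarrow>
     (\<exists>T. deduce G (STy (FPow F)) t (TSet T) \<and> (\<forall>t'. t' |\<in>| T \<longrightarrow> canonical F t'))"

lemma canonical_deduce: "deduce G (STy F) t u \<Longrightarrow> canonical F u \<Longrightarrow> canonical F t"
proof (induction F arbitrary: t u)
  case (FExp F A)
  then have "FExp F A \<lhd> G" using deduce_wt wt_ingredient by blast
  with FExp show ?case by (auto intro: ded_app)
qed (auto intro: ded_trans)

lemma canonical_axm: "axm G t u \<Longrightarrow> wt G t (STy F) \<Longrightarrow> wt G u (STy F) \<Longrightarrow> canonical F u \<Longrightarrow> canonical F t"
  using canonical_deduce ded_axm by blast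

lemma canonical_TEmpty: "F \<lhd> G \<Longrightarrow> canonical F (TEmpty F)"
proof (induction F)
  case FId
  then have "deduce G (STy FId) (TEmpty FId) (TExp EEmpty)"
    by (intro ded_axm axm.intros wt.intros EEmpty_in_Exps) (auto simp: ingr_refl)
  then show ?case by auto
next
  case (FLat B)
  then have "jbot B \<in> jcarrier B" using nd_functor_ingredient[OF _ G] by (fastforce simp: finite_jsl_def)
  with FLat have "deduce G (STy (FLat B)) (TEmpty (FLat B)) (TLat (jbot B))"
    by (intro ded_axm axm.intros wt.intros) auto
  then show ?case by auto
next
  case (FSum F1 F2)
  then have "deduce G (STy (FSum F1 F2)) (TEmpty (FSum F1 F2)) TBot"
    by (intro ded_axm axm.intros wt.intros) auto
  then show ?case by auto
next
  case (FProd F1 F2)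
  then have *: "F1 \<lhd> G" "F2 \<lhd> G" by (auto intro: ingredient_sub)
  with FProd have "deduce G (STy (FProd F1 F2)) (TEmpty (FProd F1 F2)) (TPair (TEmpty F1) (TEmpty F2))"
    by (intro ded_axm axm.intros wt.intros) auto
  with FProd * show ?case by auto
next
  case (FExp F A)
  then have *: "F \<lhd> G" by (auto intro: ingredient_sub)
  have "canonical F (TApp (TEmpty (FExp F A)) a)" if "a \<in> A" for a
    using FExp that * by (intro canonical_axm[OF ax_empty_exp] wt.intros(10)[of F A] wt.intros(12)) auto
  then show ?case by simp
next
  case (FPow F)
  then have "deduce G (STy (FPow F)) (TEmpty (FPow F)) (TSet {||})"
    by (intro ded_axm axm.intros wt.intros) auto
  then show ?case by auto
qed

lemma canonical_TPlus:
  "F \<lhd> G \<Longrightarrow> wt G t (STy F) \<Longrightarrow> wt G u (STy F) \<Longrightarrow> canonical F t \<Longrightarrow> canonical F u \<Longrightarrow>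
    canonical F (TPlus F t u)"
proof (induction F arbitrary: t u)
  case FId
  then obtain e e' where *: "deduce G (STy FId) t (TExp e)" "deduce G (STy FId) u (TExp e')" by auto
  then have "e \<in> Exp G" "e' \<in> Exp G" using deduce_wt by (blast elim: wt_TExpE)+
  then have "deduce G (STy FId) (TPlus FId (TExp e) (TExp e')) (TExp (EPlus e e'))"
    using FId.prems(1) by (intro ded_axm axm.intros wt.intros) auto
  then show ?case using ded_trans[OF ded_plus[OF FId.prems(1) *]] by auto
next
  case (FLat B)
  then obtain e e' where *: "deduce G (STy (FLat B)) t (TLat e)" "deduce G (STy (FLat B)) u (TLat e')" by auto
  then have "e \<in> jcarrier B" "e' \<in> jcarrier B" using deduce_wt by (blast elim: wt_TLatE)+
  moreover have "finite_jsl B" using nd_functor_ingredient[OF FLat.prems(1) G] by simp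
  ultimately have "deduce G (STy (FLat B)) (TPlus (FLat B) (TLat e) (TLat e')) (TLat (jjoin B e e'))"
    using FLat.prems(1) by (intro ded_axm axm.intros wt.intros) (auto simp: finite_jsl_def)
  then show ?case using ded_trans[OF ded_plus[OF FLat.prems(1) *]] by auto
next
  case (FSum F1 F2)
  note sub = ingredient_sub(1,2)[OF FSum.prems(1)]
  have step: "canonical (FSum F1 F2) (TPlus (FSum F1 F2) t u)"
    if "deduce G (STy (FSum F1 F2)) t t'" "deduce G (STy (FSum F1 F2)) u u'"
      "axm G (TPlus (FSum F1 F2) t' u') v" "canonical (FSum F1 F2) v" "wt G v (STy (FSum F1 F2))" for t' u' v
  proof (rule canonical_deduce[OF ded_plus[OF FSum.prems(1) that(1,2)]])
    have "wt G t' (STy (FSum F1 F2))" "wt G u' (STy (FSum F1 F2))" using that(1,2) deduce_wt by auto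
    then show "canonical (FSum F1 F2) (TPlus (FSum F1 F2) t' u')"
      using that(3-5) FSum.prems(1) by (intro canonical_axm[OF that(3)] wt.intros) auto
  qed
  have W: "wt G v (STy (FSum F1 F2))" if "deduce G (STy (FSum F1 F2)) t v \<or> deduce G (STy (FSum F1 F2)) u v" for v
    using that deduce_wt by blast
  have self: "canonical (FSum F1 F2) v"
    if "deduce G (STy (FSum F1 F2)) t v \<or> deduce G (STy (FSum F1 F2)) u v" for v
    using that FSum.prems(4,5) canonical_deduce ded_sym by blast
  have top: "canonical (FSum F1 F2) TTop" "wt G TTop (STy (FSum F1 F2))"
    using FSum.prems(1) by (auto intro: ded_refl wt.intros)
  have k1: "canonical (FSum F1 F2) (TK1 (TPlus F1 x y)) \<and> wt G (TK1 (TPlus F1 x y)) (STy (FSum F1 F2))"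
    if "deduce G (STy (FSum F1 F2)) t (TK1 x)" "canonical F1 x"
      "deduce G (STy (FSum F1 F2)) u (TK1 y)" "canonical F1 y" for x y
  proof -
    have xy: "wt G x (STy F1)" "wt G y (STy F1)" using that deduce_wt by (auto elim: wt_TK1E)
    then have "wt G (TK1 (TPlus F1 x y)) (STy (FSum F1 F2))"
      using FSum.prems(1) sub by (intro wt.intros) auto
    then show ?thesis using FSum.IH(1)[OF sub(1) xy that(2,4)] by (auto intro: ded_refl)
  qed
  have k2: "canonical (FSum F1 F2) (TK2 (TPlus F2 x y)) \<and> wt G (TK2 (TPlus F2 x y)) (STy (FSum F1 F2))"
    if "deduce G (STy (FSum F1 F2)) t (TK2 x)" "canonical F2 x"
      "deduce G (STy (FSum F1 F2)) u (TK2 y)" "canonical F2 y" for x y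
  proof -
    have xy: "wt G x (STy F2)" "wt G y (STy F2)" using that deduce_wt by (auto elim: wt_TK2E)
    then have "wt G (TK2 (TPlus F2 x y)) (STy (FSum F1 F2))"
      using FSum.prems(1) sub by (intro wt.intros) auto
    then show ?thesis using FSum.IH(2)[OF sub(2) xy that(2,4)] by (auto intro: ded_refl)
  qed
  have refl: "deduce G (STy (FSum F1 F2)) t t" "deduce G (STy (FSum F1 F2)) u u"
    using FSum.prems(2,3) by (auto intro: ded_refl)
  from FSum.prems(4)[unfolded canonical.simps] show ?case
  proof (elim disjE exE conjE)
    assume "deduce G (STy (FSum F1 F2)) t TBot"
    from step[OF this refl(2) ax_plus_bot1] self W refl show ?case by blast
  next
    assume "deduce G (STy (FSum F1 F2)) t TTop"
    from step[OF this refl(2) ax_plus_top1] top show ?case by blast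
  next
    fix x assume x: "deduce G (STy (FSum F1 F2)) t (TK1 x)" "canonical F1 x"
    from FSum.prems(5)[unfolded canonical.simps] show ?case
    proof (elim disjE exE conjE)
      assume "deduce G (STy (FSum F1 F2)) u TBot"
      from step[OF refl(1) this ax_plus_bot2] self W refl show ?case by blast
    next
      assume "deduce G (STy (FSum F1 F2)) u TTop"
      from step[OF refl(1) this ax_plus_top2] top show ?case by blast
    next
      fix y assume y: "deduce G (STy (FSum F1 F2)) u (TK1 y)" "canonical F1 y"
      from step[OF x(1) y(1) ax_plus_k11] k1[OF x y] show ?case by blast
    next
      fix y assume y: "deduce G (STy (FSum F1 F2)) u (TK2 y)" "canonical F2 y"
      from step[OF x(1) y(1) ax_plus_k12] top show ?case by blast
    qed
  next
    fix x assume x: "deduce G (STy (FSum F1 F2)) t (TK2 x)" "canonical F2 x"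
    from FSum.prems(5)[unfolded canonical.simps] show ?case
    proof (elim disjE exE conjE)
      assume "deduce G (STy (FSum F1 F2)) u TBot"
      from step[OF refl(1) this ax_plus_bot2] self W refl show ?case by blast
    next
      assume "deduce G (STy (FSum F1 F2)) u TTop"
      from step[OF refl(1) this ax_plus_top2] top show ?case by blast
    next
      fix y assume y: "deduce G (STy (FSum F1 F2)) u (TK1 y)" "canonical F1 y"
      from step[OF x(1) y(1) ax_plus_k21] top show ?case by blast
    next
      fix y assume y: "deduce G (STy (FSum F1 F2)) u (TK2 y)" "canonical F2 y"
      from step[OF x(1) y(1) ax_plus_k22] k2[OF x y] show ?case by blast
    qed
  qed
next
  case (FProd F1 F2)
  note sub = ingredient_sub(3,4)[OF FProd.prems(1)]
  from FProd.prems obtain t1 t2 u1 u2 where *: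
    "deduce G (STy (FProd F1 F2)) t (TPair t1 t2)" "deduce G (STy (FProd F1 F2)) u (TPair u1 u2)"
    and c: "canonical F1 t1" "canonical F2 t2" "canonical F1 u1" "canonical F2 u2" by auto
  have w: "wt G t1 (STy F1)" "wt G t2 (STy F2)" "wt G u1 (STy F1)" "wt G u2 (STy F2)"
    using deduce_wt[OF *(1)] deduce_wt[OF *(2)] by (auto elim: wt_TPairE)
  then have "deduce G (STy (FProd F1 F2)) (TPlus (FProd F1 F2) (TPair t1 t2) (TPair u1 u2))
      (TPair (TPlus F1 t1 u1) (TPlus F2 t2 u2))"
    using FProd.prems(1) sub by (intro ded_axm axm.intros wt.intros) auto
  moreover have "canonical F1 (TPlus F1 t1 u1)" "canonical F2 (TPlus F2 t2 u2)"
    using FProd.IH(1)[OF sub(1)] FProd.IH(2)[OF sub(2)] w c by auto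
  ultimately show ?case using ded_trans[OF ded_plus[OF FProd.prems(1) *]] by auto
next
  case (FExp F A)
  note sub = ingredient_sub(5)[OF FExp.prems(1)]
  have "canonical F (TApp (TPlus (FExp F A) t u) a)" if "a \<in> A" for a
  proof (rule canonical_axm[OF ax_plus_exp])
    have w: "wt G (TApp t a) (STy F)" "wt G (TApp u a) (STy F)"
      using FExp.prems that by (auto intro: wt.intros)
    show "wt G (TApp (TPlus (FExp F A) t u) a) (STy F)"
      using FExp.prems that by (intro wt.intros(10)[of F A] wt.intros(13)) auto
    show "wt G (TPlus F (TApp t a) (TApp u a)) (STy F)"
      using w sub by (intro wt.intros(13))
    show "canonical F (TPlus F (TApp t a) (TApp u a))"
      using FExp.IH[OF sub w] FExp.prems(4,5) that by simp
  qed
  then show ?case by simp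
next
  case (FPow F)
  from FPow.prems obtain T U where *:
    "deduce G (STy (FPow F)) t (TSet T)" "deduce G (STy (FPow F)) u (TSet U)"
    and c: "\<And>x. x |\<in>| T \<Longrightarrow> canonical F x" "\<And>x. x |\<in>| U \<Longrightarrow> canonical F x" by auto
  have "wt G (TSet T) (STy (FPow F))" "wt G (TSet U) (STy (FPow F))"
    using deduce_wt[OF *(1)] deduce_wt[OF *(2)] by auto
  then have "deduce G (STy (FPow F)) (TPlus (FPow F) (TSet T) (TSet U)) (TSet (T |\<union>| U))"
    using FPow.prems(1) by (intro ded_axm axm.intros wt.intros) (auto elim: wt_TSetE)
  from ded_trans[OF ded_plus[OF FPow.prems(1) *] this] show ?case using c by auto
qed

lemma canonical_TDelta: "e \<in> Exps F G \<Longrightarrow> canonical F (TDelta F e)"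
proof (induction rule: Exps_induct)
  case (Id e)
  then have "deduce G (STy FId) (TDelta FId e) (TExp e)"
    using Exps_FId Exps_ingredient by (intro ded_axm axm.intros wt.intros) auto
  then show ?case by auto
next
  case (Empty F)
  then show ?case by (intro canonical_axm[OF ax_delta_empty] canonical_TEmpty wt.intros) auto
next
  case (Plus F e1 e2)
  then show ?case using Exps_ingredient
    by (intro canonical_axm[OF ax_delta_plus] canonical_TPlus wt.intros) auto
next
  case (Mu x e)
  then show ?case by (intro canonical_axm[OF ax_delta_mu] wt.intros) (auto simp: ingr_refl)
next
  case (Lat B b)
  then have "deduce G (STy (FLat B)) (TDelta (FLat B) (ELat b)) (TLat b)"
    using Exps_ingredient by (intro ded_axm axm.intros wt.intros) auto
  then show ?case by auto
next
  case (ProdL F1 F2 e)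
  note F = Exps_ingredient[OF ProdL(1)] Exps_ingredient[OF ProdL(2)] ingredient_sub(4)[OF Exps_ingredient[OF ProdL(1)]]
  have "deduce G (STy (FProd F1 F2)) (TDelta (FProd F1 F2) (EProdL e)) (TPair (TDelta F1 e) (TEmpty F2))"
    using ProdL F by (intro ded_axm axm.intros wt.intros) auto
  with ProdL canonical_TEmpty F show ?case by auto
next
  case (ProdR F1 F2 e)
  note F = Exps_ingredient[OF ProdR(1)] Exps_ingredient[OF ProdR(2)] ingredient_sub(3)[OF Exps_ingredient[OF ProdR(1)]]
  have "deduce G (STy (FProd F1 F2)) (TDelta (FProd F1 F2) (EProdR e)) (TPair (TEmpty F1) (TDelta F2 e))"
    using ProdR F by (intro ded_axm axm.intros wt.intros) auto
  with ProdR canonical_TEmpty F show ?case by auto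
next
  case (SumL F1 F2 e)
  have "deduce G (STy (FSum F1 F2)) (TDelta (FSum F1 F2) (ESumL e)) (TK1 (TDelta F1 e))"
    using SumL Exps_ingredient by (intro ded_axm axm.intros wt.intros) auto
  with SumL show ?case by auto
next
  case (SumR F1 F2 e)
  have "deduce G (STy (FSum F1 F2)) (TDelta (FSum F1 F2) (ESumR e)) (TK2 (TDelta F2 e))"
    using SumR Exps_ingredient by (intro ded_axm axm.intros wt.intros) auto
  with SumR show ?case by auto
next
  case (Act F A a e)
  note F = Exps_ingredient[OF Act(1)] Exps_ingredient[OF Act(3)]
  have w: "wt G (TLam a F (TDelta F e)) (STy (FExp F A))"
    using Act F by (intro wt.intros) auto
  have "canonical F (TApp (TLam a F (TDelta F e)) a')" if "a' \<in> A" for a'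
  proof (cases "a' = a")
    case True
    show ?thesis unfolding True
      using Act F w by (intro canonical_axm[OF ax_lam_same] wt.intros(10)[of F A]) (auto intro: wt.intros)
  next
    case False
    show ?thesis using that F w
      by (intro canonical_axm[OF ax_lam_other[OF False]] wt.intros(10)[of F A])
        (auto intro: wt.intros canonical_TEmpty)
  qed
  then have "canonical (FExp F A) (TLam a F (TDelta F e))" by simp
  then show ?case by (rule canonical_axm[OF ax_delta_act, rotated 2]) (use w Act F in \<open>auto intro: wt.intros\<close>)
next
  case (Sing F e)
  have "deduce G (STy (FPow F)) (TDelta (FPow F) (ESing e)) (TSet {|TDelta F e|})"
    using Sing Exps_ingredient by (intro ded_axm axm.intros wt.intros) (auto intro: wt.intros)
  with Sing show ?case by auto
qed

lemma wt_canonical: "wt G t (STy F) \<Longrightarrow> canonical F t"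
proof (induction t "STy F :: ('a, 'b) srt" arbitrary: F rule: wt.induct)
  case (8 F A a t)
  have w: "wt G (TLam a F t) (STy (FExp F A))" using 8 by (intro wt.intros(8))
  have "canonical F (TApp (TLam a F t) a')" if "a' \<in> A" for a'
  proof (cases "a' = a")
    case True
    show ?thesis unfolding True
      using 8 w by (intro canonical_axm[OF ax_lam_same] wt.intros(10)[of F A]) auto
  next
    case False
    show ?thesis using that 8 w ingredient_sub(5)[OF 8(1)]
      by (intro canonical_axm[OF ax_lam_other[OF False]] wt.intros(10)[of F A])
        (auto intro: wt.intros canonical_TEmpty)
  qed
  then show ?case by simp
next
  case (11 F e) then show ?case by (intro canonical_TDelta)
next
  case (12 F) then show ?case by (intro canonical_TEmpty)
next
  case (13 F t u) then show ?case by (intro canonical_TPlus)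
qed (auto intro!: ded_refl intro: wt.intros)

lemma wt_TExp: "wt G (TExp e) s \<longleftrightarrow> s = STy FId \<and> e \<in> Exp G"
  by (auto elim: wt_TExpE intro: wt.intros)

lemma wt_FId:
  assumes "wt G t (STy FId)"
  obtains e where "deduce G (STy FId) t (TExp e)" "e \<in> Exp G"
proof -
  from wt_canonical[OF assms] obtain e where "deduce G (STy FId) t (TExp e)" by auto
  with deduce_wt[OF this] that show thesis by (auto simp: wt_TExp)
qed

lemma wt_SBool: "wt G t SBool \<Longrightarrow> deduce G SBool t TTrue \<or> deduce G SBool t TFalse"
proof (induction t "SBool :: ('a, 'b) srt" rule: wt.induct)
  case (14 B t u)
  then obtain b c where *: "deduce G (STy (FLat B)) t (TLat b)" "deduce G (STy (FLat B)) u (TLat c)"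
    using wt_canonical[of t "FLat B"] wt_canonical[of u "FLat B"] by auto
  then have "wt G (TSim (TLat b) (TLat c)) SBool" using 14(1) deduce_wt[OF *(1)] deduce_wt[OF *(2)] by (intro wt.intros(14)) auto
  then have "deduce G SBool (TSim (TLat b) (TLat c)) TTrue \<or> deduce G SBool (TSim (TLat b) (TLat c)) TFalse"
    by (cases "b = c") (auto intro: ded_axm axm.intros wt.intros)
  then show ?case using ded_trans[OF ded_sim[OF 14(1) *]] by blast
qed (auto intro: ded_refl wt.intros)

end

section \<open>Finitely many derivatives\<close>

text \<open>Simultaneous substitution turns the unfolding of \<open>\<mu>\<close>-expressions, which is not structurally
  recursive, into a structural recursion with an environment: \<open>clos \<sigma> e\<close> collects what is reachable
  from the closed instance of \<open>e\<close> under \<open>\<sigma>\<close>.\<close>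

primrec msubst :: "(nat \<Rightarrow> ('a, 'b) exp) \<Rightarrow> ('a, 'b) exp \<Rightarrow> ('a, 'b) exp" where
  "msubst \<sigma> (EVar y) = \<sigma> y"
| "msubst \<sigma> EEmpty = EEmpty"
| "msubst \<sigma> (EPlus e1 e2) = EPlus (msubst \<sigma> e1) (msubst \<sigma> e2)"
| "msubst \<sigma> (EMu y e) = EMu y (msubst (\<sigma>(y := EVar y)) e)"
| "msubst \<sigma> (ELat b) = ELat b"
| "msubst \<sigma> (EProdL e) = EProdL (msubst \<sigma> e)"
| "msubst \<sigma> (EProdR e) = EProdR (msubst \<sigma> e)"
| "msubst \<sigma> (ESumL e) = ESumL (msubst \<sigma> e)"
| "msubst \<sigma> (ESumR e) = ESumR (msubst \<sigma> e)"
| "msubst \<sigma> (EAct a e) = EAct a (msubst \<sigma> e)"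
| "msubst \<sigma> (ESing e) = ESing (msubst \<sigma> e)"

primrec clos :: "(nat \<Rightarrow> ('a, 'b) exp) \<Rightarrow> ('a, 'b) exp \<Rightarrow> ('a, 'b) exp set" where
  "clos \<sigma> (EVar y) = {\<sigma> y}"
| "clos \<sigma> EEmpty = {EEmpty}"
| "clos \<sigma> (EPlus e1 e2) = insert (msubst \<sigma> (EPlus e1 e2)) (clos \<sigma> e1 \<union> clos \<sigma> e2)"
| "clos \<sigma> (EMu y e) = insert (msubst \<sigma> (EMu y e)) (clos (\<sigma>(y := msubst \<sigma> (EMu y e))) e)"
| "clos \<sigma> (ELat b) = {ELat b}"
| "clos \<sigma> (EProdL e) = insert (msubst \<sigma> (EProdL e)) (clos \<sigma> e)"
| "clos \<sigma> (EProdR e) = insert (msubst \<sigma> (EProdR e)) (clos \<sigma> e)"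
| "clos \<sigma> (ESumL e) = insert (msubst \<sigma> (ESumL e)) (clos \<sigma> e)"
| "clos \<sigma> (ESumR e) = insert (msubst \<sigma> (ESumR e)) (clos \<sigma> e)"
| "clos \<sigma> (EAct a e) = insert (msubst \<sigma> (EAct a e)) (clos \<sigma> e)"
| "clos \<sigma> (ESing e) = insert (msubst \<sigma> (ESing e)) (clos \<sigma> e)"

lemma msubst_EVar [simp]: "msubst EVar e = e"
  by (induction e) (simp_all add: fun_upd_idem)

lemma subst_fresh: "x \<notin> fv e \<Longrightarrow> subst x s e = e"
  by (induction e) auto

lemma fv_msubst: "fv (msubst \<sigma> e) \<subseteq> (\<Union>z\<in>fv e. fv (\<sigma> z))"
proof (induction e arbitrary: \<sigma>)
  case (EPlus e1 e2)
  from EPlus.IH(1)[of \<sigma>] EPlus.IH(2)[of \<sigma>] show ?case by auto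
next
  case (EMu y e)
  have "w \<in> (\<Union>z\<in>fv (EMu y e). fv (\<sigma> z))" if "w \<noteq> y" "w \<in> fv (msubst (\<sigma>(y := EVar y)) e)" for w
  proof -
    from that(2) EMu[of "\<sigma>(y := EVar y)"] obtain z where "z \<in> fv e" "w \<in> fv ((\<sigma>(y := EVar y)) z)"
      by blast
    with that(1) show ?thesis by (cases "z = y") auto
  qed
  then show ?case by auto
qed auto

lemma subst_msubst:
  "(\<And>z. z \<in> fv e \<Longrightarrow> z \<noteq> x \<Longrightarrow> x \<notin> fv (\<sigma> z)) \<Longrightarrow>
    subst x s (msubst (\<sigma>(x := EVar x)) e) = msubst (\<sigma>(x := s)) e"
proof (induction e arbitrary: \<sigma>)
  case (EMu y e)
  show ?case
  proof (cases "y = x")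
    case False
    then have "subst x s (msubst (\<sigma>(y := EVar y, x := EVar x)) e) = msubst (\<sigma>(y := EVar y, x := s)) e"
      using EMu.prems by (intro EMu.IH) auto
    then show ?thesis
      unfolding fun_upd_twist[OF False] msubst.simps subst.simps by (simp only: False if_False)
  qed (simp del: fun_upd_apply)
qed (auto simp: subst_fresh)

lemma finite_clos: "finite (clos \<sigma> e)"
  by (induction e arbitrary: \<sigma>) auto

lemma msubst_in_clos: "msubst \<sigma> e \<in> clos \<sigma> e"
  by (cases e) auto

lemma decomps_clos:
  "(\<And>z. z \<in> fv e \<Longrightarrow> fv (\<sigma> z) = {}) \<Longrightarrow> c \<in> clos \<sigma> e \<Longrightarrow> decomps c \<subseteq> clos \<sigma> e \<or> c \<in> \<sigma> ` fv e"
proof (induction e arbitrary: \<sigma> c)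
  case (EPlus e1 e2)
  from EPlus.prems(2) consider "c = msubst \<sigma> (EPlus e1 e2)" | "c \<in> clos \<sigma> e1" | "c \<in> clos \<sigma> e2" by auto
  then show ?case
  proof cases
    case 1 then show ?thesis using msubst_in_clos[of \<sigma> e1] msubst_in_clos[of \<sigma> e2] by auto
  next
    case 2 with EPlus.IH(1)[of \<sigma> c] EPlus.prems(1) show ?thesis by auto
  next
    case 3 with EPlus.IH(2)[of \<sigma> c] EPlus.prems(1) show ?thesis by auto
  qed
next
  case (EMu y e)
  let ?s = "msubst \<sigma> (EMu y e)"
  let ?\<sigma> = "\<sigma>(y := ?s)"
  have "subst y ?s (msubst (\<sigma>(y := EVar y)) e) = msubst ?\<sigma> e"
    using EMu.prems(1) by (intro subst_msubst) auto
  then have top: "decomps ?s \<subseteq> clos ?\<sigma> e" using msubst_in_clos[of ?\<sigma> e] by simp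
  show ?case
  proof (cases "c = ?s")
    case True then show ?thesis using top by auto
  next
    case False
    with EMu.prems(2) have c: "c \<in> clos ?\<sigma> e" by simp
    have s: "fv ?s = {}" using fv_msubst[of \<sigma> "EMu y e"] EMu.prems(1) by auto
    have "decomps c \<subseteq> clos ?\<sigma> e \<or> c \<in> ?\<sigma> ` fv e"
    proof (rule EMu.IH[OF _ c])
      show "fv (?\<sigma> z) = {}" if "z \<in> fv e" for z
        using that EMu.prems(1)[of z] s by (cases "z = y") simp_all
    qed
    with False show ?thesis by (auto split: if_splits)
  qed
next
  case (EProdL e) with EProdL.IH[of \<sigma> c] msubst_in_clos[of \<sigma> e] show ?case by auto
next
  case (EProdR e) with EProdR.IH[of \<sigma> c] msubst_in_clos[of \<sigma> e] show ?case by auto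
next
  case (ESumL e) with ESumL.IH[of \<sigma> c] msubst_in_clos[of \<sigma> e] show ?case by auto
next
  case (ESumR e) with ESumR.IH[of \<sigma> c] msubst_in_clos[of \<sigma> e] show ?case by auto
next
  case (EAct a e) with EAct.IH[of \<sigma> c] msubst_in_clos[of \<sigma> e] show ?case by auto
next
  case (ESing e) with ESing.IH[of \<sigma> c] msubst_in_clos[of \<sigma> e] show ?case by auto
qed auto

lemma finite_decomp_closed:
  assumes "finite S" "\<And>e. e \<in> S \<Longrightarrow> fv e = {}"
  obtains C where "finite C" "S \<subseteq> C" "decomp_closed C"
proof
  show "finite (\<Union>e\<in>S. clos EVar e)" using assms(1) by (simp add: finite_clos)
  show "S \<subseteq> (\<Union>e\<in>S. clos EVar e)" using msubst_in_clos[of EVar] by fastforce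
  show "decomp_closed (\<Union>e\<in>S. clos EVar e)"
    unfolding decomp_closed_def using decomps_clos[of _ EVar] assms(2) by fastforce
qed

inductive sum_of :: "('a, 'b) exp set \<Rightarrow> ('a, 'b) exp set \<Rightarrow> ('a, 'b) exp \<Rightarrow> bool" for C where
  sum_of_base: "e \<in> C \<Longrightarrow> sum_of C {e} e"
| sum_of_plus: "sum_of C A e \<Longrightarrow> sum_of C A' e' \<Longrightarrow> sum_of C (A \<union> A') (EPlus e e')"

lemma sum_of_subset: "sum_of C A e \<Longrightarrow> A \<subseteq> C"
  by (induction rule: sum_of.induct) auto

lemma sum_of_absorb_base: "sum_of C A e \<Longrightarrow> c \<in> A \<Longrightarrow> aci (EPlus c e) e"
proof (induction rule: sum_of.induct)
  case (sum_of_base e) then show ?case by (auto intro: aci_idem)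
next
  case (sum_of_plus A e A' e')
  then consider "aci (EPlus c e) e" | "aci (EPlus c e') e'" by blast
  then show ?case
  proof cases
    case 1
    then show ?thesis by (meson aci_assoc aci_sym aci_trans aci_plus aci_refl)
  next
    case 2
    have "aci (EPlus c (EPlus e e')) (EPlus (EPlus c e) e')" by (intro aci_sym[OF aci_assoc])
    moreover have "aci (EPlus (EPlus c e) e') (EPlus (EPlus e c) e')" by (intro aci_plus aci_comm aci_refl)
    moreover have "aci (EPlus (EPlus e c) e') (EPlus e (EPlus c e'))" by (rule aci_assoc)
    moreover have "aci (EPlus e (EPlus c e')) (EPlus e e')" using 2 by (intro aci_plus aci_refl)
    ultimately show ?thesis by (meson aci_trans)
  qed
qed

lemma sum_of_absorb:
  "sum_of C A e \<Longrightarrow> sum_of C A' e' \<Longrightarrow> A \<subseteq> A' \<Longrightarrow> aci (EPlus e e') e'"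
proof (induction rule: sum_of.induct)
  case (sum_of_base e) then show ?case by (intro sum_of_absorb_base[of C A']) auto
next
  case (sum_of_plus A1 e1 A2 e2)
  then have "aci (EPlus e1 e') e'" "aci (EPlus e2 e') e'" by auto
  then show ?case by (meson aci_assoc aci_trans aci_plus aci_refl)
qed

lemma sum_of_unique: "sum_of C A e \<Longrightarrow> sum_of C A e' \<Longrightarrow> aci e e'"
  by (meson sum_of_absorb order_refl aci_comm aci_sym aci_trans)

definition aci_class :: "('a, 'b) exp \<Rightarrow> ('a, 'b) exp set" where
  "aci_class e = {e'. aci e e'}"

lemma aci_class_eq: "aci_class e = aci_class e' \<longleftrightarrow> aci e e'"
  unfolding aci_class_def by (metis aci_refl aci_sym aci_trans mem_Collect_eq Collect_cong)

lemma finite_derivatives: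
  fixes G :: "('a, 'b) ndf"
  assumes G: "nd_functor G" and S: "finite S" "S \<subseteq> Exp G"
  obtains X where "S \<subseteq> X" "X \<subseteq> Exp G" "aci_rel G `` X \<subseteq> X" "finite (aci_class ` X)"
    "\<And>e. e \<in> X \<Longrightarrow> rlift G (Id_on X) (delta G G e) (delta G G e)"
proof -
  have "fv e = {}" if "e \<in> insert EEmpty S" for e using that S(2) by (auto simp: Exps_def)
  with S(1) obtain C where C: "finite C" "insert EEmpty S \<subseteq> C" "decomp_closed C"
    using finite_decomp_closed[of "insert EEmpty S"] by auto
  define D where "D = {e. \<exists>A. sum_of C A e}"
  define X where "X = {e \<in> Exp G. \<exists>d\<in>D. aci e d}"
  have CD: "C \<subseteq> D" unfolding D_def using sum_of_base by blast
  have plus: "EPlus e e' \<in> D" if "e \<in> D" "e' \<in> D" for e e'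
    using that sum_of_plus unfolding D_def by blast
  have dec: "decomp_closed D" unfolding decomp_closed_def
  proof
    fix e assume "e \<in> D"
    then obtain A where "sum_of C A e" unfolding D_def by blast
    then show "decomps e \<subseteq> D"
    proof cases
      case sum_of_base
      then show ?thesis using C(3) CD unfolding decomp_closed_def by blast
    next
      case (sum_of_plus A e A' e') then show ?thesis by (auto simp: D_def)
    qed
  qed
  have DX: "D \<inter> Exp G \<subseteq> X" unfolding X_def using aci_refl by blast
  show thesis
  proof
    show "S \<subseteq> X" using C(2) CD DX S(2) by blast
    show "X \<subseteq> Exp G" unfolding X_def by blast
    show closed: "aci_rel G `` X \<subseteq> X"
      unfolding X_def aci_rel_def using aci_trans aci_sym by blast
    show "rlift G (Id_on X) (delta G G e) (delta G G e)" if "e \<in> X" for e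
    proof -
      from that obtain d where d: "d \<in> D" "aci e d" "e \<in> Exp G" unfolding X_def by blast
      then have dG: "d \<in> Exp G" using aci_Exps by blast
      have "rlift G (Id_on (D \<inter> Exp G)) (delta G G d) (delta G G d)"
        using C(2) CD by (intro rlift_delta_closed dG d(1) G dec plus) auto
      then have "rlift G (Id_on X) (delta G G d) (delta G G d)"
        by (rule rlift_mono) (use DX in auto)
      moreover have "rlift G (aci_rel G) (delta G G d) (delta G G e)"
        using rlift_delta_aci[OF G aci_sym[OF d(2)] dG] .
      ultimately show ?thesis using rlift_in_right closed by blast
    qed
    have "aci_class ` X \<subseteq> (\<lambda>A. aci_class (SOME d. sum_of C A d)) ` Pow C"
    proof
      fix c assume "c \<in> aci_class ` X"
      then obtain e d A where e: "c = aci_class e" "aci e d" "sum_of C A d"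
        unfolding X_def D_def by blast
      then have "aci d (SOME d. sum_of C A d)" using sum_of_unique someI by metis
      with e have "c = aci_class (SOME d. sum_of C A d)" using aci_trans aci_class_eq by metis
      with sum_of_subset[OF e(3)] show "c \<in> (\<lambda>A. aci_class (SOME d. sum_of C A d)) ` Pow C" by blast
    qed
    then show "finite (aci_class ` X)" using C(1) by (meson finite_Pow_iff finite_imageI finite_subset)
  qed
qed

section \<open>Entailment\<close>

primrec wt_eqn :: "('a, 'b) ndf \<Rightarrow> ('a, 'b) eqn \<Rightarrow> bool" where
  "wt_eqn G (Eqn s t u) \<longleftrightarrow> wt G t s \<and> wt G u s"

primrec sat :: "('a, 'b) ndf \<Rightarrow> (('a, 'b) exp \<times> ('a, 'b) exp) set \<Rightarrow> ('a, 'b) eqn \<Rightarrow> bool" where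
  "sat G R (Eqn s t u) \<longleftrightarrow> slift s R (den G t) (den G u)"

primrec over :: "('a, 'b) ndf \<Rightarrow> ('a, 'b) exp set \<Rightarrow> ('a, 'b) eqn \<Rightarrow> bool" where
  "over G X (Eqn s t u) \<longleftrightarrow> slift s (Id_on X) (den G t) (den G t) \<and> slift s (Id_on X) (den G u) (den G u)"

primrec eqn_size :: "('a, 'b) eqn \<Rightarrow> nat" where
  "eqn_size (Eqn s t u) = (case s of STy F \<Rightarrow> Suc (size F) | SBool \<Rightarrow> 0)"

definition progress :: "('a, 'b) ndf \<Rightarrow> ('a, 'b) eqn set \<Rightarrow> ('a, 'b) eqn set \<Rightarrow> bool" where
  "progress G H H' \<longleftrightarrow> (\<forall>e\<in>H. wt_eqn G e \<and> (\<exists>e'. derivative G e e' \<and> ndf_entails G H' e'))"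

lemma sat_TSet:
  "sat G R (Eqn (STy (FPow F)) (TSet T) (TSet U)) \<longleftrightarrow>
    (\<forall>t. t |\<in>| T \<longrightarrow> (\<exists>u. u |\<in>| U \<and> rlift F R (den G t) (den G u))) \<and>
    (\<forall>u. u |\<in>| U \<longrightarrow> (\<exists>t. t |\<in>| T \<and> rlift F R (den G t) (den G u)))"
  by auto

lemma entails_cut:
  "ndf_entails G H e \<Longrightarrow> (\<And>h. h \<in> H \<Longrightarrow> ndf_entails G H' h) \<Longrightarrow> ndf_entails G H' e"
proof (induction rule: ndf_entails.induct)
  case (ent_set T F U)
  then show ?case by (intro ndf_entails.ent_set) blast+
next
  case (ent_fun f F A g)
  then show ?case by (intro ndf_entails.ent_fun) blast+
next
  case (ent_trans s t u v)
  then show ?case using ndf_entails.ent_trans by blast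
next
  case (ent_interp s t u D K)
  then show ?case by (intro ndf_entails.ent_interp[of s t u D K]) blast+
qed (auto intro: ndf_entails.intros)

lemma entails_mono: "ndf_entails G H e \<Longrightarrow> H \<subseteq> H' \<Longrightarrow> ndf_entails G H' e"
  using entails_cut ent_hyp by blast

lemma interp_complete:
  assumes "interp e D" "sat G R e"
  shows "\<exists>K\<in>D. \<forall>h\<in>K. sat G R h"
  using assms(1)
proof cases
  case (ip_fun F A f g)
  with assms(2) obtain f' g' where fg: "den G f = VFun f'" "den G g = VFun g'"
    "\<And>a. a \<in> A \<Longrightarrow> \<exists>x y. f' a = Some x \<and> g' a = Some y \<and> rlift F R x y" by auto
  then have "rlift F R (the (f' a)) (the (g' a))" if "a \<in> A" for a using that by fastforce
  then show ?thesis unfolding ip_fun(2) using fg(1,2) by auto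
next
  case (ip_set T U F)
  with assms(2) have "\<forall>t. t |\<in>| T \<longrightarrow> (\<exists>u. u |\<in>| U \<and> rlift F R (den G t) (den G u))"
    "\<forall>u. u |\<in>| U \<longrightarrow> (\<exists>t. t |\<in>| T \<and> rlift F R (den G t) (den G u))"
    unfolding ip_set(1) sat_TSet by simp_all
  then obtain p q where p: "\<forall>t. t |\<in>| T \<longrightarrow> p t |\<in>| U \<and> rlift F R (den G t) (den G (p t))"
    and q: "\<forall>u. u |\<in>| U \<longrightarrow> q u |\<in>| T \<and> rlift F R (den G (q u)) (den G u)"
    using choice[of "\<lambda>t u. t |\<in>| T \<longrightarrow> u |\<in>| U \<and> rlift F R (den G t) (den G u)"]
      choice[of "\<lambda>u t. u |\<in>| U \<longrightarrow> t |\<in>| T \<and> rlift F R (den G t) (den G u)"] by auto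
  let ?K = "{Eqn (STy F) t (p t) | t. t |\<in>| T} \<union> {Eqn (STy F) (q u) u | u. u |\<in>| U}"
  have "?K \<in> D" unfolding ip_set(2) using p q by blast
  moreover have "\<forall>h\<in>?K. sat G R h" using p q by auto
  ultimately show ?thesis by blast
qed (use assms(2) in auto)

lemma interp_over:
  assumes "interp e D" "over G X e" "K \<in> D" "h \<in> K"
  shows "over G X h"
  using assms(1)
proof cases
  case (ip_fun F A f g)
  with assms(2) obtain f' g' where fg: "den G f = VFun f'" "den G g = VFun g'"
    "\<And>a. a \<in> A \<Longrightarrow> \<exists>x y. f' a = Some x \<and> f' a = Some y \<and> rlift F (Id_on X) x y"
    "\<And>a. a \<in> A \<Longrightarrow> \<exists>x y. g' a = Some x \<and> g' a = Some y \<and> rlift F (Id_on X) x y" by auto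
  then have "rlift F (Id_on X) (the (f' a)) (the (f' a))" "rlift F (Id_on X) (the (g' a)) (the (g' a))"
    if "a \<in> A" for a using that by fastforce+
  then show ?thesis using assms(3,4) fg(1,2) unfolding ip_fun(2) by auto
next
  case (ip_set T U F)
  have "rlift F (Id_on X) x x" if "rlift F (Id_on X) x y" for x y
    using rlift_refl_left[OF that, of X] by auto
  then have "\<forall>t. t |\<in>| T \<longrightarrow> rlift F (Id_on X) (den G t) (den G t)"
    "\<forall>u. u |\<in>| U \<longrightarrow> rlift F (Id_on X) (den G u) (den G u)"
    using assms(2) unfolding ip_set(1) by auto
  then show ?thesis using assms(3,4) unfolding ip_set(2) by auto
qed (use assms(2-4) in auto)

context
  fixes G :: "('a, 'b) ndf"
  assumes G: "nd_functor G"
begin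

lemma entails_wt: "ndf_entails G H e \<Longrightarrow> (\<And>h. h \<in> H \<Longrightarrow> wt_eqn G h) \<Longrightarrow> wt_eqn G e"
  by (induction rule: ndf_entails.induct) (use deduce_wt[OF G] in auto)

lemma interp_wt:
  assumes "interp e D" "wt_eqn G e" "K \<in> D" "h \<in> K"
  shows "wt_eqn G h"
  using assms
proof cases
  case (ip_lat B t u)
  with assms have "FLat B \<lhd> G" using wt_ingredient by auto
  with ip_lat assms show ?thesis by (auto intro: wt.intros)
next
  case (ip_fun F A f g)
  with assms have "FExp F A \<lhd> G" using wt_ingredient by auto
  with ip_fun assms show ?thesis by (auto intro: wt.intros)
qed (use assms in \<open>auto elim!: wt_TPairE wt_TK1E wt_TK2E wt_TSetE\<close>)

lemma interp_finite:
  assumes "interp e D" "wt_eqn G e"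
  shows "finite D" "D \<noteq> {}" "K \<in> D \<Longrightarrow> finite K"
proof -
  have "finite D \<and> D \<noteq> {} \<and> (\<forall>K\<in>D. finite K)"
    using assms
  proof cases
    case (ip_fun F A f g)
    with assms(2) have "FExp F A \<lhd> G" using wt_ingredient by auto
    with nd_functor_ingredient[OF _ G] have "finite A" by fastforce
    with ip_fun show ?thesis by simp
  next
    case (ip_set T U F)
    let ?P = "(\<lambda>(t, u). Eqn (STy F) t u) ` (fset T \<times> fset U)"
    have sub: "K \<subseteq> ?P" if "K \<in> D" for K using that unfolding ip_set(2) by force
    have fin: "finite ?P" by simp
    have choice: "\<exists>p. \<forall>t. t |\<in>| T \<longrightarrow> p t |\<in>| U" if "T = {||} \<longleftrightarrow> U = {||}" for T U :: "('a, 'b) trm fset"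
    proof (cases "T = {||}")
      case False
      with that obtain u where "u |\<in>| U" by auto
      then show ?thesis by (intro exI[of _ "\<lambda>_. u"]) simp
    qed simp
    from choice[of T U] choice[of U T] ip_set(3)
    have "\<exists>p. \<forall>t. t |\<in>| T \<longrightarrow> p t |\<in>| U" "\<exists>q. \<forall>u. u |\<in>| U \<longrightarrow> q u |\<in>| T" by simp_all
    then have "D \<noteq> {}" unfolding ip_set(2) by blast
    moreover have "finite D" using sub fin by (intro finite_subset[of D "Pow ?P"]) auto
    ultimately show ?thesis using sub fin finite_subset by blast
  qed auto
  then show "finite D" "D \<noteq> {}" "K \<in> D \<Longrightarrow> finite K" by auto
qed

lemma interp_sound:
  assumes "interp e D" "wt_eqn G e" "K \<in> D" "\<forall>h\<in>K. sat G R h"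
  shows "sat G R e"
  using assms(1)
proof cases
  case (ip_lat B t u)
  with assms(2) slift_den_refl[OF G, of t "STy (FLat B)"]
  have "slift (STy (FLat B)) (Id_on (Exp G)) (den G t) (den G t)" by simp
  moreover from ip_lat assms(3,4) have "den G t = den G u" by (auto split: if_splits)
  ultimately show ?thesis using ip_lat(1) by auto
next
  case (ip_fun F A f g)
  with assms(2) have "slift (STy (FExp F A)) (Id_on (Exp G)) (den G f) (den G f)"
    "slift (STy (FExp F A)) (Id_on (Exp G)) (den G g) (den G g)"
    using slift_den_refl[OF G, of f "STy (FExp F A)"] slift_den_refl[OF G, of g "STy (FExp F A)"]
    by (simp_all del: slift.simps)
  then obtain f' g' where fg: "den G f = VFun f'" "den G g = VFun g'"
    "\<And>a. a \<in> A \<Longrightarrow> \<exists>x. f' a = Some x" "\<And>a. a \<in> A \<Longrightarrow> \<exists>x. g' a = Some x" by fastforce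
  have "rlift F R (the (f' a)) (the (g' a))" if "a \<in> A" for a
    using assms(3,4) that fg(1,2) unfolding ip_fun(2) by fastforce
  then show ?thesis using fg unfolding ip_fun(1) by fastforce
next
  case (ip_set T U F)
  from assms(3) obtain p q where K: "K = {Eqn (STy F) t (p t) | t. t |\<in>| T} \<union> {Eqn (STy F) (q u) u | u. u |\<in>| U}"
    "\<forall>t. t |\<in>| T \<longrightarrow> p t |\<in>| U" "\<forall>u. u |\<in>| U \<longrightarrow> q u |\<in>| T" unfolding ip_set(2) by blast
  have "\<exists>u. u |\<in>| U \<and> rlift F R (den G t) (den G u)" if "t |\<in>| T" for t
    using that assms(4) K(2) unfolding K(1) by (intro exI[of _ "p t"]) force
  moreover have "\<exists>t. t |\<in>| T \<and> rlift F R (den G t) (den G u)" if "u |\<in>| U" for u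
    using that assms(4) K(3) unfolding K(1) by (intro exI[of _ "q u"]) force
  ultimately show ?thesis unfolding ip_set(1) sat_TSet by blast
qed (use assms(3,4) in auto)

lemma entails_sound:
  assumes R: "aci_rel G \<subseteq> R" "R\<inverse> \<subseteq> R" "R O R \<subseteq> R"
    and H: "\<And>h. h \<in> H \<Longrightarrow> wt_eqn G h" "\<And>h. h \<in> H \<Longrightarrow> sat G R h"
  shows "ndf_entails G H e \<Longrightarrow> sat G R e"
proof (induction rule: ndf_entails.induct)
  case (ent_deduce s t u)
  then show ?case using deduce_sound[OF G] slift_mono R(1) by fastforce
next
  case (ent_hyp e) then show ?case by (rule H(2))
next
  case (ent_sym s t u) then show ?case using slift_mono[OF slift_sym R(2)] by fastforce
next
  case (ent_trans s t u v)
  then show ?case using slift_mono[OF slift_comp R(3)] by fastforce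
next
  case (ent_fun f F A g)
  have "sat G R (Eqn (STy (FExp F A)) f g)"
    by (rule interp_sound[OF ip_fun]) (use ent_fun in auto)
  then show ?case .
next
  case (ent_set T F U) then show ?case unfolding sat_TSet by (simp del: fset_simps) blast
next
  case (ent_interp s t u D K) then show ?case by (intro interp_sound[of "Eqn s t u" D K]) auto
qed auto

section \<open>Bisimulation from a final configuration\<close>

lemma progress_bisimilar:
  assumes H: "progress G H H" and e: "ndf_entails G H (Eqn (STy FId) (TExp e1) (TExp e2))"
    and E: "e1 \<in> Exp G" "e2 \<in> Exp G"
  shows "(e1, e2) \<in> bisimilarity G"
proof -
  define R where "R = {(x, y). x \<in> Exp G \<and> y \<in> Exp G \<and> ndf_entails G H (Eqn (STy FId) (TExp x) (TExp y))}"
  have wtH: "wt_eqn G h" if "h \<in> H" for h using H that unfolding progress_def by blast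
  have aciR: "aci_rel G \<subseteq> R"
    unfolding R_def aci_rel_def by (auto simp: wt_TExp[OF G] intro!: ent_deduce ded_axm ax_aci)
  have symR: "R\<inverse> \<subseteq> R" unfolding R_def by (auto intro: ent_sym)
  have transR: "R O R \<subseteq> R" unfolding R_def by (auto intro: ent_trans)
  have aci_of: "aci x y" if "deduce G (STy FId) (TExp x) (TExp y)" for x y
    using deduce_sound[OF G that] by (simp add: aci_rel_def)
  have satH: "sat G R h" if "h \<in> H" for h
  proof -
    from H that obtain t u where h: "h = Eqn (STy FId) t u" unfolding progress_def derivative_def by blast
    with wtH[OF that] obtain x y where xy: "deduce G (STy FId) t (TExp x)" "x \<in> Exp G"
      "deduce G (STy FId) u (TExp y)" "y \<in> Exp G" using wt_FId[OF G] by (metis wt_eqn.simps)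
    have "ndf_entails G H (Eqn (STy FId) (TExp x) (TExp y))"
      using ent_trans[OF ent_trans[OF ent_deduce[OF ded_sym[OF xy(1)]] ent_hyp[OF that[unfolded h]]] ent_deduce[OF xy(3)]] .
    with xy have R: "slift (STy FId) R (den G (TExp x)) (den G (TExp y))" by (simp add: R_def)
    have "slift (STy FId) (aci_rel G O R O aci_rel G) (den G t) (den G u)"
      using slift_comp[OF deduce_sound[OF G xy(1)] slift_comp[OF R deduce_sound[OF G ded_sym[OF xy(3)]]]] .
    moreover have "aci_rel G O R O aci_rel G \<subseteq> R" using aciR transR by blast
    ultimately show ?thesis unfolding h sat.simps using slift_mono by blast
  qed
  have aci_step: "rlift G R (delta G G x) (delta G G y)"
    if "x \<in> Exp G" "aci x y" for x y
    using rlift_mono[OF rlift_delta_aci[OF G that(2,1)] aciR] .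
  have comp: "rlift G R u w" if "rlift G R u v" "rlift G R v w" for u v w
    using rlift_mono[OF rlift_comp[OF that] transR] .
  have step: "ndf_entails G H e \<Longrightarrow> (\<And>t u x y. e = Eqn (STy FId) t u \<Longrightarrow> deduce G (STy FId) t (TExp x) \<Longrightarrow>
      deduce G (STy FId) u (TExp y) \<Longrightarrow> rlift G R (delta G G x) (delta G G y))" for e
  proof (induction rule: ndf_entails.induct)
    case (ent_deduce s t u t' u' x y)
    then have "deduce G (STy FId) (TExp x) (TExp y)" by (auto intro: ded_sym ded_trans)
    with deduce_wt[OF G this] show ?case using aci_of aci_step by (auto simp: wt_TExp[OF G])
  next
    case (ent_hyp h t u x y)
    from H ent_hyp obtain z w where zw: "deduce G (STy FId) t (TExp z)" "deduce G (STy FId) u (TExp w)"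
      "ndf_entails G H (Eqn (STy G) (TDelta G z) (TDelta G w))"
      unfolding progress_def derivative_def by blast
    have "rlift G R (delta G G z) (delta G G w)"
      using entails_sound[OF aciR symR transR wtH satH zw(3)] by simp
    moreover have "deduce G (STy FId) (TExp x) (TExp z)" "deduce G (STy FId) (TExp w) (TExp y)"
      using ent_hyp zw by (auto intro: ded_sym ded_trans)
    moreover from this have "x \<in> Exp G" "w \<in> Exp G" using deduce_wt[OF G] wt_TExp[OF G] by blast+
    ultimately show ?case using comp aci_step aci_of by blast
  next
    case (ent_sym s t u t' u' x y)
    then have "rlift G R (delta G G y) (delta G G x)" by blast
    from rlift_mono[OF rlift_sym[OF this] symR] show ?case .
  next
    case (ent_trans s t u v t' v' x y)
    then have "wt G u (STy FId)" using entails_wt[OF ent_trans.hyps(1)] wtH by auto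
    then obtain z where "deduce G (STy FId) u (TExp z)" using wt_FId[OF G] by blast
    with ent_trans comp show ?case by blast
  next
    case (ent_interp s t u D K) then show ?case by (auto elim: interp.cases)
  qed auto
  have "R \<subseteq> bisimilarity G"
  proof (rule bisimilarityI[OF G])
    show "R \<subseteq> Exp G \<times> Exp G" unfolding R_def by blast
    fix s t assume "(s, t) \<in> R"
    then have "s \<in> Exp G" "t \<in> Exp G" "ndf_entails G H (Eqn (STy FId) (TExp s) (TExp t))"
      unfolding R_def by auto
    then show "rlift G R (delta G G s) (delta G G t)"
      by (intro step[OF _ refl]) (auto intro: ded_refl wt.intros)
  qed
  with e E show ?thesis unfolding R_def by blast
qed

section \<open>Matching modulo the equations\<close>

lemma simplifiesE:
  assumes "simplifies G e D"
  obtains e' where "interp e' D" "wt_eqn G e" "wt_eqn G e'" "eqn_size e' = eqn_size e"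
    "\<And>H. ndf_entails G H e' \<Longrightarrow> ndf_entails G H e"
    "\<And>R. aci_rel G \<subseteq> R \<Longrightarrow> R O R \<subseteq> R \<Longrightarrow> sat G R e \<Longrightarrow> sat G R e'"
    "\<And>X. aci_rel G `` X \<subseteq> X \<Longrightarrow> over G X e \<Longrightarrow> over G X e'"
proof -
  from assms obtain s t u t' u' where e: "e = Eqn s t u" "interp (Eqn s t' u') D"
    and d: "deduce G s t t'" "deduce G s u u'" unfolding simplifies_def by blast
  show thesis
  proof (rule that[OF e(2)])
    show "wt_eqn G e" "wt_eqn G (Eqn s t' u')" using deduce_wt[OF G] d e by auto
    show "eqn_size (Eqn s t' u') = eqn_size e" using e by simp
    show "ndf_entails G H e" if "ndf_entails G H (Eqn s t' u')" for H
      using ent_trans[OF ent_trans[OF ent_deduce[OF d(1)] that] ent_deduce[OF ded_sym[OF d(2)]]] e by simp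
    show "sat G R (Eqn s t' u')" if R: "aci_rel G \<subseteq> R" "R O R \<subseteq> R" and "sat G R e" for R
    proof -
      have "slift s R (den G t) (den G u)" using that(3) e by simp
      from slift_comp[OF deduce_sound[OF G ded_sym[OF d(1)]] slift_comp[OF this deduce_sound[OF G d(2)]]]
      have "slift s (aci_rel G O R O aci_rel G) (den G t') (den G u')" .
      moreover have "aci_rel G O R O aci_rel G \<subseteq> R" using R by blast
      ultimately show ?thesis using slift_mono by fastforce
    qed
    show "over G X (Eqn s t' u')" if X: "aci_rel G `` X \<subseteq> X" "over G X e" for X
    proof (cases s)
      case (STy F)
      with X(2) e have "rlift F (Id_on X) (den G t) (den G t)" "rlift F (Id_on X) (den G u) (den G u)" by auto
      then show ?thesis using deduce_sound[OF G d(1)] deduce_sound[OF G d(2)] X(1) rlift_in_right STy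
        by (metis over.simps slift.simps(1))
    qed simp
  qed
qed

lemma sat_not_fails:
  assumes "wt_eqn G e" "\<not> derivable e" "sat G R e" "\<nexists>D. simplifies G e D"
  shows "ndf_entails G H e"
proof -
  obtain s t u where e: "e = Eqn s t u" by (cases e)
  have w: "wt G t s" "wt G u s" using assms(1) e by auto
  have ns: "\<not> interp (Eqn s t' u') D" if "deduce G s t t'" "deduce G s u u'" for t' u' D
    using assms(4) that unfolding simplifies_def e by blast
  have "deduce G s t u"
  proof (cases s)
    case SBool
    have "den G t = den G u" using assms(3) e SBool by simp
    have d: "den G t = den G t'" if "deduce G SBool t t'" for t t' using deduce_sound[OF G that] by simp
    from wt_SBool[OF G w(1)[unfolded SBool]] wt_SBool[OF G w(2)[unfolded SBool]]
    show ?thesis unfolding SBool using d[of t TTrue] d[of t TFalse] d[of u TTrue] d[of u TFalse]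
      \<open>den G t = den G u\<close> by (auto intro: ded_sym ded_trans)
  next
    case (STy F)
    have c: "canonical G F t" "canonical G F u" using wt_canonical[OF G] w STy by auto
    have sat: "rlift F R (den G t) (den G u)" using assms(3) e STy by simp
    show ?thesis
    proof (cases F)
      case FId with assms(2) e STy show ?thesis by (simp add: derivable_def)
    next
      case (FLat B) with ns[OF ded_refl ded_refl, OF w] show ?thesis by (auto simp: STy intro: interp.intros)
    next
      case (FProd F1 F2)
      with c obtain t1 t2 u1 u2 where "deduce G s t (TPair t1 t2)" "deduce G s u (TPair u1 u2)"
        by (auto simp: STy canonical.simps[OF G])
      with ns show ?thesis by (auto simp: STy FProd intro: interp.intros)
    next
      case (FExp F' A) with ns[OF ded_refl ded_refl, OF w] show ?thesis by (auto simp: STy intro: interp.intros)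
    next
      case (FPow F')
      with c obtain T U where TU: "deduce G s t (TSet T)" "deduce G s u (TSet U)"
        by (auto simp: STy canonical.simps[OF G])
      obtain V W where VW: "den G t = VSet V" "den G u = VSet W" "V = {||} \<longleftrightarrow> W = {||}"
        using sat by (auto simp: FPow)
      have "T = {||} \<longleftrightarrow> V = {||}" "U = {||} \<longleftrightarrow> W = {||}"
        using deduce_sound[OF G TU(1)] deduce_sound[OF G TU(2)] VW(1,2) by (auto simp: STy FPow)
      with VW(3) ns[OF TU] show ?thesis by (auto simp: STy FPow intro: interp.intros)
    next
      case (FSum F1 F2)
      have snd: "slift s (aci_rel G) (den G v) (den G v')" if "deduce G s v v'" for v v'
        using deduce_sound[OF G that] .
      have nk1: "\<not> (deduce G s t (TK1 t') \<and> deduce G s u (TK1 u'))" for t' u'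
        using ns[of "TK1 t'" "TK1 u'"] ip_k1 STy FSum by blast
      have nk2: "\<not> (deduce G s t (TK2 t') \<and> deduce G s u (TK2 u'))" for t' u'
        using ns[of "TK2 t'" "TK2 u'"] ip_k2 STy FSum by blast
      have form: "deduce G s v TBot \<or> deduce G s v TTop \<or> (\<exists>v'. deduce G s v (TK1 v')) \<or> (\<exists>v'. deduce G s v (TK2 v'))"
        if "canonical G F v" for v using that by (auto simp: STy FSum canonical.simps[OF G])
      have bot: "den G v = VBot" if "deduce G s v TBot" for v using snd[OF that] by (auto simp: STy FSum)
      have top: "den G v = VTop" if "deduce G s v TTop" for v using snd[OF that] by (auto simp: STy FSum)
      have k1: "\<exists>x. den G v = VK1 x" if "deduce G s v (TK1 v')" for v v' using snd[OF that] by (auto simp: STy FSum)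
      have k2: "\<exists>x. den G v = VK2 x" if "deduce G s v (TK2 v')" for v v' using snd[OF that] by (auto simp: STy FSum)
      have tu: "deduce G s t u" if "deduce G s t v" "deduce G s u v" for v using that ded_sym ded_trans by blast
      have is_bot: "deduce G s v TBot" if "canonical G F v" "den G v = VBot" for v
        using form[OF that(1)] that(2) top[of v] k1[of v] k2[of v] by fastforce
      have is_top: "deduce G s v TTop" if "canonical G F v" "den G v = VTop" for v
        using form[OF that(1)] that(2) bot[of v] k1[of v] k2[of v] by fastforce
      have is_k1: "\<exists>v'. deduce G s v (TK1 v')" if "canonical G F v" "den G v = VK1 x" for v x
        using form[OF that(1)] that(2) bot[of v] top[of v] k2[of v] by fastforce
      have is_k2: "\<exists>v'. deduce G s v (TK2 v')" if "canonical G F v" "den G v = VK2 x" for v x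
        using form[OF that(1)] that(2) bot[of v] top[of v] k1[of v] by fastforce
      from sat consider "den G t = VBot" "den G u = VBot" | "den G t = VTop" "den G u = VTop"
        | x y where "den G t = VK1 x" "den G u = VK1 y" | x y where "den G t = VK2 x" "den G u = VK2 y"
        by (auto simp: FSum)
      then show ?thesis
      proof cases
        case 1 then show ?thesis using tu is_bot c by blast
      next
        case 2 then show ?thesis using tu is_top c by blast
      next
        case 3 then show ?thesis using is_k1 c nk1 by blast
      next
        case 4 then show ?thesis using is_k2 c nk2 by blast
      qed
    qed
  qed
  then show ?thesis unfolding e by (rule ent_deduce)
qed

end

section \<open>Termination measure\<close>

lemma mset_set_replace_mult1:
  assumes "finite B" "c \<in> B" "finite C" "\<And>d. d \<in> C \<Longrightarrow> (d, c) \<in> r"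
  shows "(mset_set ((B - {c}) \<union> C), mset_set B) \<in> mult1 r"
proof -
  have "mset_set B = add_mset c (mset_set (B - {c}))"
    using assms(1,2) by (simp add: mset_set.remove)
  moreover have "mset_set ((B - {c}) \<union> C) = mset_set (B - {c}) + mset_set (C - (B - {c}))"
    using assms(1,3) by (subst Un_Diff_cancel[symmetric], subst mset_set_Union) auto
  moreover have "\<forall>b. b \<in># mset_set (C - (B - {c})) \<longrightarrow> (b, c) \<in> r"
    using assms(3,4) by simp
  ultimately show ?thesis unfolding mult1_def by blast
qed

lemma interp_eqn_size: "interp e D \<Longrightarrow> K \<in> D \<Longrightarrow> h \<in> K \<Longrightarrow> eqn_size h < eqn_size e"
  by (induction rule: interp.induct) auto

definition unknown :: "('a, 'b) ndf \<Rightarrow> ('a, 'b) exp set \<Rightarrow> ('a, 'b) eqn set \<Rightarrow>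
    (('a, 'b) exp set \<times> ('a, 'b) exp set) set" where
  "unknown G X H = {(aci_class x, aci_class y) | x y. x \<in> X \<and> y \<in> X \<and>
     \<not> ndf_entails G H (Eqn (STy FId) (TExp x) (TExp y))}"

text \<open>A derivation step identifies a new pair of classes; all other steps leave the hypotheses
  unchanged and replace a goal by finitely many goals of smaller sorts.\<close>

definition config_order :: "('a, 'b) ndf \<Rightarrow> ('a, 'b) exp set \<Rightarrow> ('a, 'b) config rel" where
  "config_order G X = inv_image (less_than <*lex*> mult1 (measure eqn_size))
     (\<lambda>c. (card (unknown G X (fst c)), mset_set (snd c)))"

lemma wf_config_order: "wf (config_order G X)"
  unfolding config_order_def by (intro wf_inv_image wf_lex_prod wf_less_than wf_mult1 wf_measure)

section \<open>The invariant\<close>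

locale reduction =
  fixes G :: "('a, 'b) ndf" and X :: "('a, 'b) exp set" and \<Gamma> :: "(('a, 'b) exp \<times> ('a, 'b) exp) set"
  assumes G: "nd_functor G"
    and \<Gamma>: "finite \<Gamma>" "\<Gamma> \<subseteq> X \<times> X"
    and X: "X \<subseteq> Exp G" "aci_rel G `` X \<subseteq> X" "finite (aci_class ` X)"
      "\<And>e. e \<in> X \<Longrightarrow> rlift G (Id_on X) (delta G G e) (delta G G e)"
begin

definition goal_eqns :: "('a, 'b) eqn set" where
  "goal_eqns = (\<lambda>(e1, e2). Eqn (STy FId) (TExp e1) (TExp e2)) ` \<Gamma>"

definition all_bisimilar :: bool where
  "all_bisimilar \<longleftrightarrow> (\<forall>(e1, e2)\<in>\<Gamma>. (e1, e2) \<in> bisimilarity G)"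

fun config_inv :: "('a, 'b) config \<Rightarrow> bool" where
  "config_inv (H, K) \<longleftrightarrow> finite K \<and> (\<forall>e\<in>K. wt_eqn G e \<and> over G X e) \<and>
     progress G H (H \<union> K) \<and> (\<forall>e\<in>goal_eqns. ndf_entails G (H \<union> K) e)"

definition config_sat :: "('a, 'b) config \<Rightarrow> bool" where
  "config_sat c \<longleftrightarrow> (\<forall>e\<in>snd c. sat G (bisimilarity G) e)"

fun state_inv :: "('a, 'b) state \<Rightarrow> bool" where
  "state_inv (Running S) \<longleftrightarrow> finite S \<and> S \<noteq> {} \<and> (\<forall>c\<in>S. config_inv c) \<and>
     (all_bisimilar \<longrightarrow> (\<exists>c\<in>S. config_sat c))"
| "state_inv Success \<longleftrightarrow> all_bisimilar"
| "state_inv Failure \<longleftrightarrow> \<not> all_bisimilar"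

lemma finite_unknown: "finite (unknown G X H)"
  by (rule finite_subset[of _ "aci_class ` X \<times> aci_class ` X"]) (auto simp: unknown_def X(3))

lemma unknown_mono: "H \<subseteq> H' \<Longrightarrow> unknown G X H' \<subseteq> unknown G X H"
  unfolding unknown_def using entails_mono by blast

lemma unknown_insert:
  assumes xy: "x \<in> X" "y \<in> X" and d: "deduce G (STy FId) t (TExp x)" "deduce G (STy FId) u (TExp y)"
    and n: "\<not> ndf_entails G H (Eqn (STy FId) t u)"
  shows "card (unknown G X (insert (Eqn (STy FId) t u) H)) < card (unknown G X H)"
proof (rule psubset_card_mono[OF finite_unknown])
  let ?H = "insert (Eqn (STy FId) t u) H"
  have "\<not> ndf_entails G H (Eqn (STy FId) (TExp x) (TExp y))"
    using n ent_trans[OF ent_trans[OF ent_deduce[OF d(1)]] ent_deduce[OF ded_sym[OF d(2)]]] by blast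
  then have "(aci_class x, aci_class y) \<in> unknown G X H" using xy unfolding unknown_def by blast
  moreover have "(aci_class x, aci_class y) \<notin> unknown G X ?H"
  proof
    assume "(aci_class x, aci_class y) \<in> unknown G X ?H"
    then obtain x' y' where *: "aci x x'" "aci y y'" "x' \<in> X" "y' \<in> X"
      "\<not> ndf_entails G ?H (Eqn (STy FId) (TExp x') (TExp y'))"
      unfolding unknown_def by (auto simp: aci_class_eq)
    have dd: "deduce G (STy FId) (TExp z) (TExp z')" if "aci z z'" "z \<in> X" "z' \<in> X" for z z'
      using that X(1) by (intro ded_axm ax_aci) (auto intro: wt.intros)
    have "ndf_entails G ?H (Eqn (STy FId) (TExp x) (TExp y))"
      using ent_trans[OF ent_trans[OF ent_deduce[OF ded_sym[OF d(1)]] ent_hyp] ent_deduce[OF d(2)]] by blast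
    from ent_trans[OF ent_trans[OF ent_deduce[OF ded_sym[OF dd[OF *(1) xy(1) *(3)]]] this]
        ent_deduce[OF dd[OF *(2) xy(2) *(4)]]] *(5)
    show False by blast
  qed
  ultimately show "unknown G X ?H \<subset> unknown G X H" using unknown_mono[of H ?H] by blast
qed

lemma aci_closed: "(x, y) \<in> aci_rel G \<Longrightarrow> x \<in> X \<Longrightarrow> y \<in> X"
  using X(2) by blast

lemma over_TExp:
  assumes "over G X (Eqn (STy FId) t u)"
  shows "deduce G (STy FId) t (TExp x) \<Longrightarrow> x \<in> X" "deduce G (STy FId) u (TExp x) \<Longrightarrow> x \<in> X"
  using assms deduce_sound[OF G, of "STy FId" t "TExp x"] deduce_sound[OF G, of "STy FId" u "TExp x"]
  by (auto intro: aci_closed)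

lemma sat_bisimilarity_aci: "aci_rel G O bisimilarity G O aci_rel G \<subseteq> bisimilarity G"
  using aci_rel_bisimilarity[OF G] bisimilarity_comp[OF G] by blast

lemma progress_mono:
  assumes "progress G H K" "\<And>e. e \<in> K \<Longrightarrow> ndf_entails G K' e"
  shows "progress G H K'"
  using assms entails_cut[of G K _ K'] unfolding progress_def by blast

lemma rule_step_inv:
  assumes "rule_step G c C" "config_inv c"
  shows "finite C \<and> C \<noteq> {} \<and> (\<forall>c'\<in>C. config_inv c' \<and> (c', c) \<in> config_order G X) \<and>
    (config_sat c \<longrightarrow> (\<exists>c'\<in>C. config_sat c'))"
  using assms(1)
proof cases
  case (Reduce e K H)
  have ent: "ndf_entails G (H \<union> (K - {e})) h" if "h \<in> H \<union> K" for h
    using that Reduce(4) by (cases "h = e") (auto intro: ent_hyp entails_mono)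
  have "config_inv (H, K - {e})"
    using assms(2) ent progress_mono[of H "H \<union> K"] entails_cut[of G "H \<union> K"] unfolding Reduce(1) by auto
  moreover have "((H, K - {e}), (H, K)) \<in> config_order G X"
    using mset_set_replace_mult1[of K e "{}" "measure eqn_size"] Reduce(3) assms(2)
    unfolding Reduce(1) config_order_def by simp
  ultimately show ?thesis unfolding Reduce(1,2) config_sat_def by auto
next
  case (Derive e K H e')
  from Derive(6) obtain t u x y where e: "e = Eqn (STy FId) t u"
    and d: "deduce G (STy FId) t (TExp x)" "deduce G (STy FId) u (TExp y)"
    and e': "e' = Eqn (STy G) (TDelta G x) (TDelta G y)" unfolding derivative_def by blast
  have inv: "finite K" "wt_eqn G e" "over G X e" "\<forall>h\<in>K. wt_eqn G h \<and> over G X h"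
    "progress G H (H \<union> K)" "\<forall>h\<in>goal_eqns. ndf_entails G (H \<union> K) h"
    using assms(2) Derive(3) unfolding Derive(1) by auto
  have xy: "x \<in> X" "y \<in> X" using over_TExp d inv(3) e by blast+
  then have w: "wt_eqn G e'" using X(1) by (auto simp: e' ingr_refl intro!: wt.intros)
  have o: "over G X e'" using X(4) xy by (simp add: e')
  let ?H = "insert e H" and ?K = "(K - {e}) \<union> {e'}"
  have ent: "ndf_entails G (?H \<union> ?K) h" if "h \<in> H \<union> K" for h
    using that by (auto intro: ent_hyp)
  have "progress G H (?H \<union> ?K)" using progress_mono[OF inv(5) ent] .
  moreover have "progress G {e} (?H \<union> ?K)"
    unfolding progress_def using inv(2) Derive(6) ent_hyp[of e' "?H \<union> ?K" G] by auto
  ultimately have "progress G ?H (?H \<union> ?K)" unfolding progress_def by blast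
  then have "config_inv (?H, ?K)"
    using inv w o ent entails_cut[of G "H \<union> K" _ "?H \<union> ?K"] by auto
  moreover have "((?H, ?K), (H, K)) \<in> config_order G X"
    using unknown_insert[OF xy d] Derive(5) unfolding e config_order_def by simp
  moreover have "config_sat (?H, ?K)" if "config_sat (H, K)"
  proof -
    have "slift (STy FId) (bisimilarity G) (den G t) (den G u)"
      using that Derive(3) unfolding config_sat_def e by auto
    from slift_comp[OF deduce_sound[OF G ded_sym[OF d(1)]] slift_comp[OF this deduce_sound[OF G d(2)]]]
    have "(x, y) \<in> bisimilarity G" using sat_bisimilarity_aci by auto
    then have "sat G (bisimilarity G) e'" using bisimilarity_delta[OF G] by (simp add: e')
    with that show ?thesis unfolding config_sat_def by auto
  qed
  ultimately show ?thesis unfolding Derive(1,2) by blast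
next
  case (Simplify e K D H)
  have inv: "finite K" "wt_eqn G e" "over G X e" "\<forall>h\<in>K. wt_eqn G h \<and> over G X h"
    "progress G H (H \<union> K)" "\<forall>h\<in>goal_eqns. ndf_entails G (H \<union> K) h"
    using assms(2) Simplify(3) unfolding Simplify(1) by auto
  from simplifiesE[OF G Simplify(4)] obtain e' where e': "interp e' D" "wt_eqn G e'"
    "\<And>H. ndf_entails G H e' \<Longrightarrow> ndf_entails G H e"
    "sat G (bisimilarity G) e \<Longrightarrow> sat G (bisimilarity G) e'" "over G X e'"
    and sz: "eqn_size e' = eqn_size e"
    using aci_rel_bisimilarity[OF G] bisimilarity_comp[OF G] X(2) inv(3) by metis
  have "config_inv (H, (K - {e}) \<union> L) \<and> ((H, (K - {e}) \<union> L), (H, K)) \<in> config_order G X" if L: "L \<in> D" for L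
  proof
    have fin: "finite L" using interp_finite(3)[OF G e'(1,2) L] .
    let ?K = "(K - {e}) \<union> L"
    have "ndf_entails G (H \<union> ?K) e'"
    proof -
      obtain s t u where stu: "e' = Eqn s t u" by (cases e')
      have "\<forall>h\<in>L. ndf_entails G (H \<union> ?K) h" by (simp add: ent_hyp)
      with e'(1,2) L show ?thesis unfolding stu by (intro ent_interp[of s t u D L]) simp_all
    qed
    then have ent: "ndf_entails G (H \<union> ?K) h" if "h \<in> H \<union> K" for h
      using that e'(3) by (cases "h = e") (auto intro: ent_hyp)
    have "wt_eqn G h \<and> over G X h" if "h \<in> L" for h
      using interp_wt[OF G e'(1,2) L that] interp_over[OF e'(1,5) L that] by simp
    then show "config_inv (H, ?K)"
      using inv fin progress_mono[OF inv(5) ent] entails_cut[of G "H \<union> K" _ "H \<union> ?K"] ent by auto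
    show "((H, ?K), (H, K)) \<in> config_order G X"
      using mset_set_replace_mult1[OF inv(1) Simplify(3) fin, of "measure eqn_size"]
        interp_eqn_size[OF e'(1) L] sz unfolding config_order_def by simp
  qed
  moreover have "finite D" "D \<noteq> {}" using interp_finite(1,2)[OF G e'(1,2)] .
  moreover have "\<exists>L\<in>D. config_sat (H, (K - {e}) \<union> L)" if "config_sat (H, K)"
  proof -
    have "sat G (bisimilarity G) e'" using that e'(4) Simplify(3) unfolding config_sat_def by auto
    from interp_complete[OF e'(1) this] show ?thesis using that unfolding config_sat_def by auto
  qed
  ultimately show ?thesis unfolding Simplify(1,2) by auto
qed

lemma not_fails_sat:
  assumes "config_inv c" "config_sat c"
  shows "\<not> fails G c"
proof
  assume "fails G c"
  then obtain e where e: "e \<in> snd c" "\<not> derivable e" "\<not> ndf_entails G (fst c) e" "\<nexists>D. simplifies G e D"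
    unfolding fails_def by blast
  have "wt_eqn G e" using assms(1) e(1) by (cases c) auto
  with sat_not_fails[OF G this e(2) _ e(4)] e(1,3) assms(2) show False unfolding config_sat_def by blast
qed

lemma config_inv_done:
  assumes "config_inv (H, {})"
  shows all_bisimilar
  unfolding all_bisimilar_def
proof clarify
  fix e1 e2 assume e: "(e1, e2) \<in> \<Gamma>"
  then have "Eqn (STy FId) (TExp e1) (TExp e2) \<in> goal_eqns" unfolding goal_eqns_def by force
  with assms have "progress G H H" "ndf_entails G H (Eqn (STy FId) (TExp e1) (TExp e2))" by auto
  with e \<Gamma>(2) X(1) show "(e1, e2) \<in> bisimilarity G" by (intro progress_bisimilar[OF G, of H]) auto
qed

lemma circ_inv: "circ G st st' \<Longrightarrow> state_inv st \<Longrightarrow> state_inv st'"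
proof (induction rule: circ.induct)
  case (Done H S)
  then have "config_inv (H, {})" by (simp del: config_inv.simps)
  from config_inv_done[OF this] show ?case by simp
next
  case (Step c S C)
  then have c: "config_inv c" by simp
  note * = rule_step_inv[OF Step(2) c]
  have "\<exists>c'\<in>(S - {c}) \<union> C. config_sat c'" if all_bisimilar
  proof -
    from that Step.prems obtain c' where "c' \<in> S" "config_sat c'" by auto
    with * show ?thesis by (cases "c' = c") auto
  qed
  with * Step.prems show ?case by auto
next
  case (Fail_branch c S)
  have "\<exists>c'\<in>S - {c}. config_sat c'" if all_bisimilar
  proof -
    from that Fail_branch.prems obtain c' where "c' \<in> S" "config_sat c'" "config_inv c'" by auto
    with not_fails_sat Fail_branch(2) show ?thesis by blast
  qed
  with Fail_branch show ?case by auto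
next
  case (Fail c) then show ?case using not_fails_sat[of c] by auto
qed

lemma config_progress:
  assumes "config_inv (H, K)" "K \<noteq> {}"
  shows "(\<exists>C. rule_step G (H, K) C) \<or> fails G (H, K)"
proof -
  from assms(2) obtain e where e: "e \<in> K" by blast
  show ?thesis
  proof (cases "ndf_entails G H e")
    case True with e show ?thesis using Reduce by blast
  next
    case n: False
    show ?thesis
    proof (cases "derivable e")
      case True
      then obtain t u where tu: "e = Eqn (STy FId) t u" unfolding derivable_def by blast
      with assms(1) e have "wt G t (STy FId)" "wt G u (STy FId)" by auto
      then obtain x y where "deduce G (STy FId) t (TExp x)" "deduce G (STy FId) u (TExp y)"
        using wt_FId[OF G] by metis
      then have "derivative G e (Eqn (STy G) (TDelta G x) (TDelta G y))"
        unfolding derivative_def tu by blast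
      with Derive[OF e True n] show ?thesis by blast
    next
      case False
      show ?thesis
      proof (cases "\<exists>D. simplifies G e D")
        case True
        then obtain D where "simplifies G e D" by blast
        from Simplify[OF e this] show ?thesis by blast
      next
        case False
        with n e \<open>\<not> derivable e\<close> show ?thesis unfolding fails_def by auto
      qed
    qed
  qed
qed

lemma state_progress: "state_inv st \<Longrightarrow> \<nexists>st'. circ G st st' \<Longrightarrow> st = Success \<or> st = Failure"
proof (cases st)
  case (Running S)
  assume inv: "state_inv st" and n: "\<nexists>st'. circ G st st'"
  from inv Running obtain c where c: "c \<in> S" "config_inv c" by auto
  obtain H K where HK: "c = (H, K)" by (cases c)
  have "K \<noteq> {}" using n c(1) Done unfolding Running HK by blast
  with config_progress c(2) HK consider C where "rule_step G c C" | "fails G c" by blast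
  then show ?thesis
  proof cases
    case 1 with n c(1) Step show ?thesis unfolding Running by blast
  next
    case 2 with n c(1) Fail_branch Fail show ?thesis unfolding Running by (cases "S = {c}") blast+
  qed
qed simp_all

lemma circ_decreases:
  assumes "circ G (Running S) (Running S')" "state_inv (Running S)"
  shows "(mset_set S', mset_set S) \<in> mult1 (config_order G X)"
  using assms(1)
proof cases
  case (Step c C)
  with assms(2) rule_step_inv[of c C] show ?thesis by (auto intro!: mset_set_replace_mult1)
next
  case (Fail_branch c)
  with assms(2) mset_set_replace_mult1[of S c "{}" "config_order G X"] show ?thesis by simp
qed

lemma start_inv: "state_inv (start \<Gamma>)"
proof -
  have "config_inv ({}, goal_eqns)"
    using \<Gamma> X(1) by (fastforce simp: goal_eqns_def progress_def intro: wt.intros ent_hyp)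
  moreover have "config_sat ({}, goal_eqns)" if all_bisimilar
    using that unfolding all_bisimilar_def config_sat_def goal_eqns_def by auto
  ultimately show ?thesis unfolding start_def goal_eqns_def[symmetric] by simp
qed

lemma reachable_inv: "(circ G)\<^sup>*\<^sup>* (start \<Gamma>) st \<Longrightarrow> state_inv st"
  by (induction rule: rtranclp_induct) (auto intro: start_inv circ_inv)

lemma no_infinite_run: "\<nexists>\<rho>. \<rho> 0 = start \<Gamma> \<and> (\<forall>i::nat. circ G (\<rho> i) (\<rho> (Suc i)))"
proof clarify
  fix \<rho> :: "nat \<Rightarrow> ('a, 'b) state"
  assume \<rho>: "\<rho> 0 = start \<Gamma>" "\<forall>i. circ G (\<rho> i) (\<rho> (Suc i))"
  have inv: "state_inv (\<rho> i)" for i by (induction i) (use \<rho> start_inv circ_inv in auto)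
  have "\<exists>S. \<rho> i = Running S" for i using \<rho>(2)[rule_format, of i] by (auto elim: circ.cases)
  then obtain S where S: "\<And>i. \<rho> i = Running (S i)" by metis
  then have "(mset_set (S (Suc i)), mset_set (S i)) \<in> mult1 (config_order G X)" for i
    using circ_decreases inv \<rho>(2) by metis
  moreover have "wf (mult1 (config_order G X))" by (intro wf_mult1 wf_config_order)
  ultimately show False unfolding wf_iff_no_infinite_down_chain
    by (elim notE) (intro exI[of _ "\<lambda>i. mset_set (S i)"] allI)
qed

end

theorem theorem4:
  fixes G :: "('a, 'b) ndf"
    and \<Gamma> :: "(('a, 'b) exp \<times> ('a, 'b) exp) set"
  assumes "nd_functor G"
    and "finite \<Gamma>"
    and "\<Gamma> \<subseteq> Exp G \<times> Exp G"
  shows "(\<nexists>\<rho>. \<rho> 0 = start \<Gamma> \<and> (\<forall>i::nat. circ G (\<rho> i) (\<rho> (Suc i)))) \<and>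
     (\<forall>st. (circ G)\<^sup>*\<^sup>* (start \<Gamma>) st \<longrightarrow> (\<nexists>st'. circ G st st') \<longrightarrow> st = Success \<or> st = Failure) \<and>
     ((circ G)\<^sup>*\<^sup>* (start \<Gamma>) Success \<longrightarrow> (\<forall>(e1, e2) \<in> \<Gamma>. exp_bisimilar G e1 e2)) \<and>
     ((circ G)\<^sup>*\<^sup>* (start \<Gamma>) Failure \<longrightarrow> \<not> (\<forall>(e1, e2) \<in> \<Gamma>. exp_bisimilar G e1 e2))"
proof -
  have "finite (fst ` \<Gamma> \<union> snd ` \<Gamma>)" "fst ` \<Gamma> \<union> snd ` \<Gamma> \<subseteq> Exp G" using assms(2,3) by auto
  from finite_derivatives[OF assms(1) this] obtain X where X: "fst ` \<Gamma> \<union> snd ` \<Gamma> \<subseteq> X" "X \<subseteq> Exp G"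
    "aci_rel G `` X \<subseteq> X" "finite (aci_class ` X)"
    "\<And>e. e \<in> X \<Longrightarrow> rlift G (Id_on X) (delta G G e) (delta G G e)" by blast
  have "\<Gamma> \<subseteq> X \<times> X" using X(1) by force
  then interpret reduction G X \<Gamma>
    by (intro reduction.intro assms(1,2) X(2-5))
  have "all_bisimilar \<longleftrightarrow> (\<forall>(e1, e2) \<in> \<Gamma>. exp_bisimilar G e1 e2)"
    unfolding all_bisimilar_def bisimilarity_def by simp
  with reachable_inv[of Success] reachable_inv[of Failure]
  have "(circ G)\<^sup>*\<^sup>* (start \<Gamma>) Success \<longrightarrow> (\<forall>(e1, e2) \<in> \<Gamma>. exp_bisimilar G e1 e2)"
    "(circ G)\<^sup>*\<^sup>* (start \<Gamma>) Failure \<longrightarrow> \<not> (\<forall>(e1, e2) \<in> \<Gamma>. exp_bisimilar G e1 e2)" by simp_all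
  with no_infinite_run state_progress[OF reachable_inv] show ?thesis by blast
qed

end
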